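(* Consider the $d$-dimensional lattice $\mathbb{Z}_L^d$ with $L$ sites in each direction ($N=L^d$ sites, each occupied by a qubit), and a geometrically local Hamiltonian $H=\sum_{\alpha\in\mathbb{Z}_L^d} H_\alpha$, where $\|H_\alpha\|=\mathcal{O}(1)$ and $H_\alpha$ acts non-trivially only on sites within distance $r_0$ of $\alpha$, with $r_0=\mathcal{O}(1)$. Let $O$ be a local observable supported on $\mathcal{O}(1)$ (adjacent) sites. Let $$H' = H + \sum_{i=1}^M g_i V_i,$$ where $M=\mathcal{O}(N)$, each $V_i$ is a local Hermitian operator with $\|V_i\|\le 1$, each site is acted on by only $\mathcal{O}(1)$ of the error terms $V_i$, and $g_1,\dots,g_M$ are independent $\chi$-deformed Gaussian random variables with parameters $\delta>0$ and $\Gamma=\mathcal{O}(1)$. Suppose $t^{d/2+1}\delta\le\mathcal{O}(1)$. Then for any density matrix $\rho$, $$\big|\mathrm{tr}[\rho\, e^{iH't}Oe^{-iH't}] - \mathrm{tr}[\rho\, e^{iHt}Oe^{-iHt}]\big| = \mathcal{O}\!\left(a t^{\frac d2+1}\delta\|O\|\right) + \mathcal{O}\!\left(a t\delta\log^{d/2}(\delta^{-1})\|O\|\right)$$ with probability at least $1-2e^{-ca^2}$, for any $a>0$ and some absolute constant $c>0$.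
   Context: A random variable $g$ is a $\chi$-deformed Gaussian random variable (with parameters $\delta>0$, $\Gamma\in(0,+\infty]$) if $g=\chi(\theta)$ for some $\theta\sim\mathcal{N}(0,1)$, where $\chi:\mathbb{R}\to\mathbb{R}$ is a strictly monotonically increasing differentiable function with $|\mathrm{d}\chi(\theta)/\mathrm{d}\theta|\le\delta$ for all $\theta$, $\chi(0)=0$, $\lim_{\theta\to+\infty}\chi(\theta)=\Gamma$, $\lim_{\theta\to-\infty}\chi(\theta)=-\Gamma$, and $\mathbb{E}[\chi(\theta)]=0$. Independence of the $g_i$ means the underlying Gaussians $\theta_i$ are independent. $\|\cdot\|$ denotes the operator norm. The $\mathcal{O}(\cdot)$ notation hides constants independent of the system size $L$ (equivalently $N$), of $t$, $\delta$, $a$, $\rho$ and $O$; in particular the bound is independent of the system size.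
   Formalization: The formal theorem assumes δ ≤ 1/2: at δ = 1 the log term vanishes and the bound fails for small t (one qubit, H = 0, V = σ_x, O = σ_y), and for δ > 1 log^{d/2}(1/δ) is undefined in odd d; any fixed threshold below 1 follows by rescaling t, H and g_i. *)

theory Defs
  imports "HOL-Probability.Probability"
begin

type_synonym site = "nat \<Rightarrow> nat"

definition sites :: "nat \<Rightarrow> nat \<Rightarrow> site set" where
  "sites L d = {x. (\<forall>i<d. x i < L) \<and> (\<forall>i. d \<le> i \<longrightarrow> x i = 0)}"

definition tdist :: "nat \<Rightarrow> nat \<Rightarrow> site \<Rightarrow> site \<Rightarrow> nat" where
  "tdist L d x y = (\<Sum>i<d. let a = (if x i \<le> y i then y i - x i else x i - y i) in min a (L - a))"

definition lball :: "nat \<Rightarrow> nat \<Rightarrow> site \<Rightarrow> nat \<Rightarrow> site set" where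
  "lball L d c r = {x \<in> sites L d. tdist L d c x \<le> r}"

text \<open>Computational basis states of qubits on a finite set S of sites.\<close>
type_synonym cfg = "site \<Rightarrow> bool"
type_synonym qop = "cfg \<Rightarrow> cfg \<Rightarrow> complex"

definition cfgs :: "site set \<Rightarrow> cfg set" where
  "cfgs S = {\<sigma>. \<forall>x. x \<notin> S \<longrightarrow> \<sigma> x = False}"

definition restr :: "site set \<Rightarrow> cfg \<Rightarrow> cfg" where
  "restr X \<sigma> = (\<lambda>x. if x \<in> X then \<sigma> x else False)"

definition idop :: qop where
  "idop = (\<lambda>\<sigma> \<tau>. if \<sigma> = \<tau> then 1 else 0)"

definition oplus :: "qop \<Rightarrow> qop \<Rightarrow> qop" where
  "oplus A B = (\<lambda>\<sigma> \<tau>. A \<sigma> \<tau> + B \<sigma> \<tau>)"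

definition oscale :: "complex \<Rightarrow> qop \<Rightarrow> qop" where
  "oscale c A = (\<lambda>\<sigma> \<tau>. c * A \<sigma> \<tau>)"

definition osum :: "'i set \<Rightarrow> ('i \<Rightarrow> qop) \<Rightarrow> qop" where
  "osum I A = (\<lambda>\<sigma> \<tau>. \<Sum>i\<in>I. A i \<sigma> \<tau>)"

definition omul :: "site set \<Rightarrow> qop \<Rightarrow> qop \<Rightarrow> qop" where
  "omul S A B = (\<lambda>\<sigma> \<tau>. \<Sum>\<rho>\<in>cfgs S. A \<sigma> \<rho> * B \<rho> \<tau>)"

fun opow :: "site set \<Rightarrow> qop \<Rightarrow> nat \<Rightarrow> qop" where
  "opow S A 0 = idop"
| "opow S A (Suc n) = omul S A (opow S A n)"

definition oexp :: "site set \<Rightarrow> qop \<Rightarrow> qop" where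
  "oexp S A = (\<lambda>\<sigma> \<tau>. \<Sum>n. opow S A n \<sigma> \<tau> / of_nat (fact n))"

definition otrace :: "site set \<Rightarrow> qop \<Rightarrow> complex" where
  "otrace S A = (\<Sum>\<sigma>\<in>cfgs S. A \<sigma> \<sigma>)"

definition hermitian_op :: "site set \<Rightarrow> qop \<Rightarrow> bool" where
  "hermitian_op S A \<longleftrightarrow> (\<forall>\<sigma>\<in>cfgs S. \<forall>\<tau>\<in>cfgs S. A \<sigma> \<tau> = cnj (A \<tau> \<sigma>))"

definition vnorm :: "site set \<Rightarrow> (cfg \<Rightarrow> complex) \<Rightarrow> real" where
  "vnorm S v = sqrt (\<Sum>\<sigma>\<in>cfgs S. (cmod (v \<sigma>))\<^sup>2)"

definition oapply :: "site set \<Rightarrow> qop \<Rightarrow> (cfg \<Rightarrow> complex) \<Rightarrow> (cfg \<Rightarrow> complex)" where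
  "oapply S A v = (\<lambda>\<sigma>. \<Sum>\<tau>\<in>cfgs S. A \<sigma> \<tau> * v \<tau>)"

definition opnorm :: "site set \<Rightarrow> qop \<Rightarrow> real" where
  "opnorm S A = (SUP v\<in>{v. vnorm S v = 1}. vnorm S (oapply S A v))"

text \<open>A acts non-trivially only on the sites in X, i.e. A = B \<otimes> Id.\<close>
definition supported_on :: "site set \<Rightarrow> site set \<Rightarrow> qop \<Rightarrow> bool" where
  "supported_on S X A \<longleftrightarrow> (\<exists>B :: qop. \<forall>\<sigma>\<in>cfgs S. \<forall>\<tau>\<in>cfgs S.
      A \<sigma> \<tau> = (if (\<forall>x\<in>S - X. \<sigma> x = \<tau> x) then B (restr X \<sigma>) (restr X \<tau>) else 0))"

definition density_matrix :: "site set \<Rightarrow> qop \<Rightarrow> bool" where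
  "density_matrix S \<rho> \<longleftrightarrow> hermitian_op S \<rho> \<and> otrace S \<rho> = 1 \<and>
     (\<forall>v. 0 \<le> Re (\<Sum>\<sigma>\<in>cfgs S. \<Sum>\<tau>\<in>cfgs S. cnj (v \<sigma>) * \<rho> \<sigma> \<tau> * v \<tau>))"

definition heis :: "site set \<Rightarrow> qop \<Rightarrow> real \<Rightarrow> qop \<Rightarrow> qop" where
  "heis S H t Ob = omul S (omul S (oexp S (oscale (\<i> * of_real t) H)) Ob)
                         (oexp S (oscale (- \<i> * of_real t) H))"

definition std_normal_measure :: "real measure" where
  "std_normal_measure = density lborel std_normal_density"

definition chi_deformed :: "real \<Rightarrow> real \<Rightarrow> (real \<Rightarrow> real) \<Rightarrow> bool" where
  "chi_deformed \<delta> \<Gamma> chi \<longleftrightarrow>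
     strict_mono chi \<and> (\<forall>\<theta>. chi differentiable (at \<theta>)) \<and>
     (\<forall>\<theta>. \<bar>deriv chi \<theta>\<bar> \<le> \<delta>) \<and> chi 0 = 0 \<and>
     (chi \<longlongrightarrow> \<Gamma>) at_top \<and> (chi \<longlongrightarrow> - \<Gamma>) at_bot \<and>
     integral\<^sup>L std_normal_measure chi = 0"

definition gauss_prod :: "nat \<Rightarrow> (nat \<Rightarrow> real) measure" where
  "gauss_prod M = PiM {..<M} (\<lambda>_. std_normal_measure)"

end

theory Submission
  imports Defs
begin

text \<open>Lieb-Robinson bounds, valid uniformly for all couplings in a bounded range, show that the
  commutator of \<open>V i\<close> with the evolved observable is at most a number \<open>l i\<close> that decays exponentially
  outside the light cone, so that the \<open>l i\<close> sum up to \<open>O(\<parallel>O\<parallel> (1 + t) ^ d)\<close>. By Duhamel's formula the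
  expectation value is Lipschitz in \<open>g i\<close> with constant \<open>t * l i\<close>, and differs from its linearisation at
  \<open>g i = 0\<close> by at most \<open>2 * t\<^sup>2 * l i * (g i)\<^sup>2\<close>. Since \<open>g i\<close> is a centred \<open>\<delta>\<close>-Lipschitz function of a
  Gaussian, switching on one coupling at a time multiplies the moment generating function with parameter
  \<open>\<lambda>\<close> by at most \<open>exp (\<lambda>\<^sup>2 * (t * l i * \<delta>)\<^sup>2 + \<bar>\<lambda>\<bar> * 2 * t\<^sup>2 * l i * \<delta>\<^sup>2)\<close>, and Chernoff's bound for the
  real and the imaginary part gives the claim. The assumption on \<open>t powr (d / 2 + 1) * \<delta>\<close> makes the
  total bias as small as the fluctuations.\<close>

section \<open>Heisenberg evolution in a Banach algebra\<close>

text \<open>Two choices shape the proof. The dimension of the qubit operators depends on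
  \<open>L\<close>, so no matrix type of fixed size carries their exponentials and derivatives; the
  analysis is done in an abstract Banach algebra and then applied to a concrete one that holds all
  finite systems. In place of an adjoint, the abstract part uses only that
  \<open>exp (s *\<^sub>R K)\<close> is contractive for all real \<open>s\<close>. The exponent
  \<open>d / 2 + 1\<close> comes from adding variances: since each \<open>l i\<close> is bounded by
  a constant, the sum of \<open>(t * l i * \<delta>)\<^sup>2\<close> is of order
  \<open>(t * \<delta>)\<^sup>2 * (1 + t) ^ d\<close>, and its root is the typical deviation.
  First-order bounds on the shifts of the mean would add up to \<open>(1 + t) ^ d\<close> without
  the root; centredness makes these shifts second order, so that their sum is comparable to the
  square of the typical deviation. While one coupling is switched on, others sit at random values,
  so every estimate must be uniform in them. The logarithmic term pays for short times, where
  \<open>(1 + t) powr (d / 2)\<close> is not controlled by \<open>t powr (d / 2)\<close>.\<close>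

definition comm :: "'a::ring \<Rightarrow> 'a \<Rightarrow> 'a" where
  "comm A B = A * B - B * A"

definition evo :: "'a::{real_normed_algebra_1,banach} \<Rightarrow> real \<Rightarrow> 'a \<Rightarrow> 'a" where
  "evo K t A = exp (t *\<^sub>R K) * A * exp (- t *\<^sub>R K)"

text \<open>Stands in for anti-Hermiticity, which would need an adjoint. As \<open>s\<close> takes
  both signs, conjugation by these exponentials is an isometry and not only a contraction.\<close>

definition skew :: "'a::{real_normed_algebra_1,banach} \<Rightarrow> bool" where
  "skew K \<longleftrightarrow> (\<forall>s. norm (exp (s *\<^sub>R K)) \<le> 1)"

lemma evo_0 [simp]: "evo K 0 A = A"
  by (simp add: evo_def)

lemma norm_comm_le: "norm (comm A B) \<le> 2 * norm A * norm (B :: 'a::real_normed_algebra)"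
proof -
  have "norm (comm A B) \<le> norm (A * B) + norm (B * A)"
    unfolding comm_def by (rule norm_triangle_ineq4)
  also have "\<dots> \<le> norm A * norm B + norm B * norm A"
    by (intro add_mono norm_mult_ineq)
  finally show ?thesis by simp
qed

lemma comm_add_left: "comm (A + B) C = comm A C + comm B C"
  by (simp add: comm_def algebra_simps)

lemma comm_diff_left: "comm (A - B) C = comm A C - comm B C"
  by (simp add: comm_def algebra_simps)

lemma comm_scaleR_left: "comm (c *\<^sub>R A) B = c *\<^sub>R comm A (B :: 'a::real_algebra)"
  by (simp add: comm_def algebra_simps)

lemma comm_sum_left: "comm (sum f I) B = (\<Sum>i\<in>I. comm (f i) B)"
  by (simp add: comm_def sum_distrib_left sum_distrib_right sum_subtractf)

lemma exp_commute:
  fixes X :: "'a::{real_normed_algebra_1,banach}"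
  assumes "X * A = A * X"
  shows "exp X * A = A * exp X"
  by (simp add: exp_def suminf_mult[symmetric] suminf_mult2 summable_exp_generic
      power_commuting_commutes assms)

lemma exp_scaleR_minus_right:
  fixes K :: "'a::{real_normed_algebra_1,banach}"
  shows "exp (t *\<^sub>R K) * exp (- t *\<^sub>R K) = 1"
  using exp_minus_inverse[of "t *\<^sub>R K"] by simp

lemma exp_scaleR_minus_left:
  fixes K :: "'a::{real_normed_algebra_1,banach}"
  shows "exp (- t *\<^sub>R K) * exp (t *\<^sub>R K) = 1"
  using exp_scaleR_minus_right[of "- t" K] by simp

lemma evo_minus_left: "evo K (- t) (evo K t A) = A"
proof -
  have "evo K (- t) (evo K t A)
    = (exp (- t *\<^sub>R K) * exp (t *\<^sub>R K)) * A * (exp (- t *\<^sub>R K) * exp (t *\<^sub>R K))"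
    by (simp add: evo_def mult.assoc)
  then show ?thesis
    by (simp only: exp_scaleR_minus_left mult_1_left mult_1_right)
qed

lemma evo_self: "evo K t K = K"
  unfolding evo_def using exp_scaleR_minus_right[of t K]
  by (simp add: exp_times_scaleR_commute mult.assoc)

lemma evo_mult: "evo K t (A * B) = evo K t A * evo K t B"
proof -
  have "evo K t A * evo K t B
      = exp (t *\<^sub>R K) * A * (exp (- t *\<^sub>R K) * exp (t *\<^sub>R K)) * B * exp (- t *\<^sub>R K)"
    by (simp only: mult.assoc evo_def)
  then show ?thesis
    by (simp only: exp_scaleR_minus_left mult_1_right evo_def mult.assoc)
qed

lemma evo_diff: "evo K t (A - B) = evo K t A - evo K t B"
  by (simp add: evo_def algebra_simps)

lemma evo_scaleR: "evo K t (c *\<^sub>R A) = c *\<^sub>R evo K t A"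
  by (simp add: evo_def)

lemma evo_minus: "evo K t (- A) = - evo K t A"
  by (simp add: evo_def)

lemma evo_comm: "evo K t (comm A B) = comm (evo K t A) (evo K t B)"
  by (simp add: comm_def evo_diff evo_mult)

lemma norm_evo_le:
  assumes "skew K"
  shows "norm (evo K t A) \<le> norm A"
proof -
  have 1: "norm (exp (s *\<^sub>R K)) \<le> 1" for s
    using assms by (simp add: skew_def)
  have "norm (evo K t A) \<le> norm (exp (t *\<^sub>R K) * A) * norm (exp (- t *\<^sub>R K))"
    unfolding evo_def by (rule norm_mult_ineq)
  also have "\<dots> \<le> norm (exp (t *\<^sub>R K) * A) * 1"
    by (intro mult_left_mono 1) auto
  also have "\<dots> \<le> norm (exp (t *\<^sub>R K)) * norm A"
    using norm_mult_ineq by simp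
  also have "\<dots> \<le> 1 * norm A"
    by (intro mult_right_mono 1) auto
  finally show ?thesis by simp
qed

lemma norm_evo:
  assumes "skew K"
  shows "norm (evo K t A) = norm A"
  using norm_evo_le[OF assms, of t A] norm_evo_le[OF assms, of "- t" "evo K t A"]
  by (simp add: evo_minus_left)

section \<open>Derivatives of the evolution and Duhamel's formula\<close>

lemma has_vector_derivative_exp_scaleR:
  fixes K :: "'a::{real_normed_algebra_1,banach}"
  assumes "(f has_real_derivative f') (at s within T)"
  shows "((\<lambda>s. exp (f s *\<^sub>R K)) has_vector_derivative f' *\<^sub>R (K * exp (f s *\<^sub>R K))) (at s within T)"
proof -
  have "((\<lambda>t. exp (t *\<^sub>R K)) has_vector_derivative K * exp (f s *\<^sub>R K)) (at (f s) within f ` T)"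
    using exp_scaleR_has_vector_derivative_left has_vector_derivative_at_within by blast
  from vector_diff_chain_within[OF _ this, of f'] assms
  show ?thesis
    by (simp add: has_real_derivative_iff_has_vector_derivative o_def)
qed

text \<open>The evolution time may itself depend on \<open>s\<close>: with \<open>t - s\<close> this
  is the interpolation behind Duhamel's formula, with \<open>- s\<close> the passage to an
  interaction picture.\<close>

lemma has_vector_derivative_evo:
  assumes f: "(f has_real_derivative f') (at s within T)"
    and X: "(X has_vector_derivative X') (at s within T)"
  shows "((\<lambda>s. evo K (f s) (X s)) has_vector_derivative evo K (f s) (X' + f' *\<^sub>R comm K (X s)))
    (at s within T)"
proof -
  have c: "K * exp (f s *\<^sub>R K) = exp (f s *\<^sub>R K) * K"
    by (simp add: exp_times_scaleR_commute)
  have c': "K * (exp (f s *\<^sub>R K) * Z) = exp (f s *\<^sub>R K) * (K * Z)" for Z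
    unfolding mult.assoc[symmetric] c ..
  have f2: "((\<lambda>s. - f s) has_real_derivative - f') (at s within T)"
    using f by (rule derivative_intros)
  note d = has_vector_derivative_mult[OF has_vector_derivative_mult[OF
      has_vector_derivative_exp_scaleR[OF f, of K] X] has_vector_derivative_exp_scaleR[OF f2, of K]]
  show ?thesis
    unfolding evo_def
    by (rule has_vector_derivative_eq_rhs[OF d])
      (simp add: comm_def algebra_simps c c')
qed

lemma has_vector_derivative_evo_const:
  "((\<lambda>s. evo K s A) has_vector_derivative comm K (evo K s A)) (at s within T)"
  using has_vector_derivative_evo[OF DERIV_ident, of "\<lambda>_. A" 0 s T K] by (simp add: evo_comm evo_self)

text \<open>A mean value inequality with a real majorant \<open>g\<close>, used wherever one would
  otherwise estimate the integral of an algebra-valued function.\<close>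

lemma norm_diff_le_derivative:
  fixes f :: "real \<Rightarrow> 'a::real_normed_vector"
  assumes "0 \<le> t"
    and f: "\<And>s. 0 \<le> s \<Longrightarrow> s \<le> t \<Longrightarrow> (f has_vector_derivative f' s) (at s within {0..t})"
    and g: "\<And>s. 0 \<le> s \<Longrightarrow> s \<le> t \<Longrightarrow> (g has_real_derivative g' s) (at s within {0..t})"
    and le: "\<And>s. 0 \<le> s \<Longrightarrow> s \<le> t \<Longrightarrow> norm (f' s) \<le> g' s"
  shows "norm (f t - f 0) \<le> g t - g 0"
proof (cases "t = 0")
  case False
  then have "0 < t" using assms(1) by simp
  have cf: "continuous_on {0..t} f"
    using has_vector_derivative_continuous[OF f] by (auto simp: continuous_on_eq_continuous_within)
  have cg: "continuous_on {0..t} g"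
    using DERIV_continuous[OF g] by (auto simp: continuous_on_eq_continuous_within)
  show ?thesis
  proof (rule differentiable_bound_general[OF \<open>0 < t\<close> cf cg])
    fix s assume s: "0 < s" "s < t"
    then have at: "at s within {0..t} = at s"
      by (intro at_within_interior) auto
    show "(f has_vector_derivative f' s) (at s)" "(g has_vector_derivative g' s) (at s)"
      using f[of s] g[of s] s by (auto simp: at has_real_derivative_iff_has_vector_derivative)
    show "norm (f' s) \<le> g' s" using le s by simp
  qed
qed simp

text \<open>The path \<open>T s\<close> runs from the evolution under \<open>K'\<close> at
  \<open>s = 0\<close> to the one under \<open>K\<close> at \<open>s = t\<close>, and its derivative
  is, up to sign, a conjugate of \<open>comm (K' - K) (evo K s A)\<close>. So \<open>K'\<close> only
  has to be contractive, while the commutator is needed along the evolution of \<open>K\<close>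
  alone.\<close>

lemma duhamel:
  assumes K: "skew K'" and t: "0 \<le> t"
    and le: "\<And>s. 0 \<le> s \<Longrightarrow> s \<le> t \<Longrightarrow> norm (comm (K' - K) (evo K s A)) \<le> B"
  shows "norm (evo K' t A - evo K t A) \<le> t * B"
proof -
  define T where "T = (\<lambda>s. evo K' (t - s) (evo K s A))"
  note 1 = has_vector_derivative_evo_const[where K = K and A = A]
  have 2: "((\<lambda>s. t - s) has_real_derivative -1) (at s within {0..t})" for s
    by (auto intro!: derivative_eq_intros)
  have d: "(T has_vector_derivative evo K' (t - s) (- comm (K' - K) (evo K s A))) (at s within {0..t})" for s
    unfolding T_def
    by (rule has_vector_derivative_eq_rhs[OF has_vector_derivative_evo[OF 2 1]])
      (simp add: comm_diff_left)
  have "norm (T t - T 0) \<le> t * B - 0 * B"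
  proof (rule norm_diff_le_derivative[OF t d])
    show "((\<lambda>s. s * B) has_real_derivative B) (at s within {0..t})" for s
      by (auto intro!: derivative_eq_intros)
    show "norm (evo K' (t - s) (- comm (K' - K) (evo K s A))) \<le> B" if "0 \<le> s" "s \<le> t" for s
      using order_trans[OF norm_evo_le[OF K] , of "- comm (K' - K) (evo K s A)"] le[OF that] by simp
  qed
  then show ?thesis by (simp add: T_def norm_minus_commute)
qed

text \<open>Duhamel's bound with the trivial estimate of the commutator. Continuity in the generator
  later makes the deviation events measurable.\<close>

lemma continuous_on_evo:
  assumes K: "continuous_on T K" and sk: "\<And>x. x \<in> T \<Longrightarrow> skew (K x)" and t: "0 \<le> t"
  shows "continuous_on T (\<lambda>x. evo (K x) t A)"
proof -
  have "((\<lambda>y. evo (K y) t A) \<longlongrightarrow> evo (K x) t A) (at x within T)" if x: "x \<in> T" for x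
  proof (rule Lim_null[THEN iffD2], rule Lim_null_comparison)
    show "\<forall>\<^sub>F y in at x within T. norm (evo (K y) t A - evo (K x) t A) \<le> t * (2 * norm (K y - K x) * norm A)"
      unfolding eventually_at_topological
    proof (intro exI[of _ UNIV] conjI ballI impI)
      fix y assume y: "y \<in> T"
      show "norm (evo (K y) t A - evo (K x) t A) \<le> t * (2 * norm (K y - K x) * norm A)"
      proof (rule duhamel[OF sk[OF y] t])
        fix s
        show "norm (comm (K y - K x) (evo (K x) s A)) \<le> 2 * norm (K y - K x) * norm A"
          by (rule order_trans[OF norm_comm_le]) (intro mult_left_mono norm_evo_le sk x, simp)
      qed
    qed auto
    have "((\<lambda>y. t * (2 * norm (K y - K x) * norm A)) \<longlongrightarrow> t * (2 * norm (K x - K x) * norm A)) (at x within T)"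
      using K x by (intro tendsto_intros) (auto simp: continuous_on_def)
    then show "((\<lambda>y. t * (2 * norm (K y - K x) * norm A)) \<longlongrightarrow> 0) (at x within T)"
      by simp
  qed
  then show ?thesis by (simp add: continuous_on_def)
qed

text \<open>\<open>D\<close> is the image under \<open>\<phi>\<close> of the first-order Duhamel
  integral. In the remainder one commutator with \<open>W\<close> is estimated by \<open>l\<close>
  and the second one trivially; the surviving factor \<open>l\<close> is what makes the remainders
  summable over all error terms.\<close>

lemma second_order:
  fixes \<phi> :: "'a::{real_normed_algebra_1,banach} \<Rightarrow> 'b::real_normed_vector"
  assumes \<phi>: "linear \<phi>" and \<phi>1: "\<And>x. norm (\<phi> x) \<le> norm x"
    and sk: "\<And>y. \<bar>y\<bar> \<le> \<Gamma> \<Longrightarrow> skew (K + y *\<^sub>R W)" and t: "0 \<le> t" and W: "norm W \<le> 1"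
    and le: "\<And>s. 0 \<le> s \<Longrightarrow> s \<le> t \<Longrightarrow> norm (comm W (evo K s A)) \<le> l"
  obtains D where "\<And>y. \<bar>y\<bar> \<le> \<Gamma> \<Longrightarrow>
    norm (\<phi> (evo (K + y *\<^sub>R W) t A) - \<phi> (evo K t A) - y *\<^sub>R D) \<le> 2 * t\<^sup>2 * l * y\<^sup>2"
proof (cases "\<Gamma> < 0")
  case False
  have K: "skew K" using sk[of 0] False by simp
  have l: "0 \<le> l" using order_trans[OF norm_ge_zero le[of 0]] t by simp
  define C where "C = (\<lambda>s. comm W (evo K s A))"
  note 1 = has_vector_derivative_evo_const[where K = K and A = A]
  have 2: "((\<lambda>s. t - s) has_real_derivative -1) (at s within {0..t})" for s
    by (auto intro!: derivative_eq_intros)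
  have C: "(C has_vector_derivative comm W (comm K (evo K s A))) (at s within {0..t})" for s
    unfolding C_def comm_def[of W]
    by (intro has_vector_derivative_diff has_vector_derivative_mult_left has_vector_derivative_mult_right 1)
  have "continuous_on {0..t} (\<lambda>s. evo K (t - s) (C s))"
    using has_vector_derivative_continuous[OF has_vector_derivative_evo[OF 2 C]]
    by (auto simp: continuous_on_eq_continuous_within)
  \<comment> \<open>An antiderivative of the continuous integrand provides the Duhamel integral as
    \<open>P t - P 0\<close>.\<close>
  then obtain P where P: "\<And>s. s \<in> {0..t} \<Longrightarrow>
      (P has_vector_derivative evo K (t - s) (C s)) (at s within {0..t})"
    using antiderivative_continuous by blast
  show thesis
  proof (rule that[of "\<phi> (P t - P 0)"])
    fix y :: real assume y: "\<bar>y\<bar> \<le> \<Gamma>"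
    define K' where "K' = K + y *\<^sub>R W"
    have K': "skew K'" unfolding K'_def by (rule sk[OF y])
    \<comment> \<open>Adding \<open>y *\<^sub>R P s\<close> to the Duhamel path cancels the
      first-order part of its derivative. What remains is \<open>y\<close> times the difference of
      two evolutions of \<open>C s\<close>, to which Duhamel's bound applies once more.\<close>
    define T where "T = (\<lambda>s. evo K' (t - s) (evo K s A) + y *\<^sub>R P s)"
    have d: "(T has_vector_derivative (- y) *\<^sub>R (evo K' (t - s) (C s) - evo K (t - s) (C s))) (at s within {0..t})"
      if "0 \<le> s" "s \<le> t" for s
      unfolding T_def
      by (rule has_vector_derivative_eq_rhs[OF has_vector_derivative_add[OF has_vector_derivative_evo[OF 2 1]
              has_vector_derivative_scaleR[OF DERIV_const P]]])
        (use that in \<open>simp_all add: K'_def comm_add_left C_def comm_scaleR_left evo_scaleR evo_minus algebra_simps\<close>)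
    have b: "norm (evo K' (t - s) (C s) - evo K (t - s) (C s)) \<le> t * (2 * \<bar>y\<bar> * l)"
      if s: "0 \<le> s" "s \<le> t" for s
    proof -
      have "norm (evo K' (t - s) (C s) - evo K (t - s) (C s)) \<le> (t - s) * (2 * \<bar>y\<bar> * l)"
      proof (rule duhamel[OF K'])
        fix u
        have "norm (comm (K' - K) (evo K u (C s))) \<le> 2 * norm (y *\<^sub>R W) * norm (evo K u (C s))"
          using norm_comm_le[of "K' - K"] by (simp add: K'_def)
        also have "\<dots> \<le> 2 * (\<bar>y\<bar> * 1) * l"
          unfolding norm_scaleR
          by (intro mult_mono mult_left_mono order_trans[OF norm_evo_le[OF K]])
            (use W l le[OF s] in \<open>auto simp: C_def\<close>)
        finally show "norm (comm (K' - K) (evo K u (C s))) \<le> 2 * \<bar>y\<bar> * l" by simp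
      qed (use s in auto)
      also have "\<dots> \<le> t * (2 * \<bar>y\<bar> * l)"
        by (intro mult_right_mono) (use s l in auto)
      finally show ?thesis .
    qed
    have "norm (T t - T 0) \<le> t * (\<bar>y\<bar> * (t * (2 * \<bar>y\<bar> * l))) - 0 * (\<bar>y\<bar> * (t * (2 * \<bar>y\<bar> * l)))"
    proof (rule norm_diff_le_derivative[OF t d])
      fix s assume s: "0 \<le> s" "s \<le> t"
      show "((\<lambda>s. s * (\<bar>y\<bar> * (t * (2 * \<bar>y\<bar> * l)))) has_real_derivative \<bar>y\<bar> * (t * (2 * \<bar>y\<bar> * l))) (at s within {0..t})"
        by (auto intro!: derivative_eq_intros)
      show "norm ((- y) *\<^sub>R (evo K' (t - s) (C s) - evo K (t - s) (C s))) \<le> \<bar>y\<bar> * (t * (2 * \<bar>y\<bar> * l))"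
        using b[OF s] by (simp add: mult_left_mono)
    qed
    also have "\<dots> = 2 * t\<^sup>2 * l * (\<bar>y\<bar> * \<bar>y\<bar>)" by (simp add: power2_eq_square algebra_simps)
    also have "\<bar>y\<bar> * \<bar>y\<bar> = y\<^sup>2" by (simp add: power2_eq_square)
    finally have T: "norm (T t - T 0) \<le> 2 * t\<^sup>2 * l * y\<^sup>2" .
    have "\<phi> (evo K' t A) - \<phi> (evo K t A) - y *\<^sub>R \<phi> (P t - P 0) = \<phi> (- (T t - T 0))"
      by (simp add: T_def linear_diff[OF \<phi>] linear_add[OF \<phi>] linear_scale[OF \<phi>] algebra_simps)
    then show "norm (\<phi> (evo (K + y *\<^sub>R W) t A) - \<phi> (evo K t A) - y *\<^sub>R \<phi> (P t - P 0)) \<le> 2 * t\<^sup>2 * l * y\<^sup>2"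
      using \<phi>1[of "- (T t - T 0)"] T unfolding K'_def by (metis norm_minus_cancel order_trans)
  qed
qed (use that[of 0] in auto)

lemma evo_commuting:
  assumes "comm K A = 0"
  shows "evo K s A = A"
proof -
  have "(s *\<^sub>R K) * A = A * (s *\<^sub>R K)"
    using assms by (simp add: comm_def)
  then have "exp (s *\<^sub>R K) * A = A * exp (s *\<^sub>R K)"
    by (rule exp_commute)
  then show ?thesis
    unfolding evo_def using exp_scaleR_minus_right[of s K] by (simp add: mult.assoc)
qed

text \<open>The generators that do not commute with \<open>a j\<close> sum up to \<open>KN\<close>. Conjugating the commutator with the
  evolution of the remaining ones, which fixes \<open>a j\<close>, preserves its norm and leaves a derivative that
  involves \<open>KN\<close> only; the bound then follows by induction along chains of non-commuting generators.\<close>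

lemma lieb_robinson:
  fixes a :: "'j \<Rightarrow> 'a::{real_normed_algebra_1,banach}" and c :: "'j \<Rightarrow> real"
  assumes J: "finite J"
    and sk: "\<And>I. I \<subseteq> J \<Longrightarrow> skew (\<Sum>k\<in>I. c k *\<^sub>R a k)"
    and N: "\<And>j. j \<in> J \<Longrightarrow> N j \<subseteq> J" "\<And>j. j \<in> J \<Longrightarrow> card (N j) \<le> \<Delta>"
    and far: "\<And>j k. j \<in> J \<Longrightarrow> k \<in> J - N j \<Longrightarrow> comm (a k) (a j) = 0"
    and a: "\<And>j. j \<in> J \<Longrightarrow> norm (a j) \<le> \<alpha>" and c: "\<And>j. j \<in> J \<Longrightarrow> \<bar>c j\<bar> \<le> \<gamma>"
    and D0: "\<And>j. j \<in> J \<Longrightarrow> D j > 0 \<Longrightarrow> comm (a j) A = 0"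
    and D: "\<And>j k. j \<in> J \<Longrightarrow> k \<in> N j \<Longrightarrow> D j \<le> D k + 1"
    and K: "K = (\<Sum>k\<in>J. c k *\<^sub>R a k)"
    and j: "j \<in> J" and n: "n \<le> D j" and t: "0 \<le> t"
  shows "norm (comm (a j) (evo K t A)) \<le> 2 * \<alpha> * norm A * ((2 * \<alpha> * \<gamma> * \<Delta> * t) ^ n / fact n)"
  using j n t
proof (induction n arbitrary: j t)
  case 0
  have sK: "skew K" unfolding K by (rule sk) simp
  have "norm (comm (a j) (evo K t A)) \<le> 2 * norm (a j) * norm (evo K t A)"
    by (rule norm_comm_le)
  also have "\<dots> \<le> 2 * \<alpha> * norm A"
    using a[OF 0(1)] by (intro mult_mono norm_evo_le sK) (auto intro: order_trans[OF norm_ge_zero])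
  finally show ?case by simp
next
  case (Suc n)
  define v where "v = 2 * \<alpha> * \<gamma> * \<Delta>"
  define Q where "Q = 2 * \<alpha> * norm A"
  define KN where "KN = (\<Sum>k\<in>N j. c k *\<^sub>R a k)"
  define KF where "KF = (\<Sum>k\<in>J - N j. c k *\<^sub>R a k)"
  have Nj: "N j \<subseteq> J" "card (N j) \<le> \<Delta>" "finite (N j)"
    using N Suc.prems J finite_subset by blast+
  have split: "K = KF + KN"
    unfolding K KF_def KN_def by (rule sum.subset_diff[OF Nj(1) J])
  have sF: "skew KF" unfolding KF_def by (rule sk) auto
  have \<alpha>: "0 \<le> \<alpha>" using order_trans[OF norm_ge_zero a[OF Suc.prems(1)]] .
  have \<gamma>: "0 \<le> \<gamma>" using c[OF Suc.prems(1)] by linarith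
  have cF: "comm KF (a j) = 0"
    unfolding KF_def comm_sum_left comm_scaleR_left using far Suc.prems by simp
  note evoF = evo_commuting[OF cF]
  define E where "E = (\<lambda>s. comm (a j) (evo KF (- s) (evo K s A)))"
  have E_eq: "E s = evo KF (- s) (comm (a j) (evo K s A))" for s
    by (simp add: E_def evo_comm evoF)
  note 1 = has_vector_derivative_evo_const[where K = K and A = A]
  have 2: "((\<lambda>s. - s) has_real_derivative -1) (at s within {0..t})" for s
    by (auto intro!: derivative_eq_intros)
  define R where "R = (\<lambda>s. evo KF (- s) (comm KN (evo K s A)))"
  have 3: "((\<lambda>s. evo KF (- s) (evo K s A)) has_vector_derivative R s) (at s within {0..t})" for s
    by (rule has_vector_derivative_eq_rhs[OF has_vector_derivative_evo[OF 2 1]])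
      (simp add: split comm_add_left R_def)
  have d: "(E has_vector_derivative comm (a j) (R s)) (at s within {0..t})" for s
    unfolding E_def comm_def
    by (intro has_vector_derivative_diff has_vector_derivative_mult_left has_vector_derivative_mult_right 3)
  have v: "0 \<le> v" unfolding v_def using \<alpha> \<gamma> by auto
  have Q: "0 \<le> Q" unfolding Q_def using \<alpha> by auto
  have b: "norm (comm (a j) (R s)) \<le> v * Q * ((v * s) ^ n / fact n)" if s: "0 \<le> s" "s \<le> t" for s
  proof -
    have "norm (comm KN (evo K s A)) \<le> (\<Sum>k\<in>N j. norm (c k *\<^sub>R comm (a k) (evo K s A)))"
      unfolding KN_def comm_sum_left comm_scaleR_left by (rule norm_sum)
    also have "\<dots> \<le> (\<Sum>k\<in>N j. \<gamma> * (Q * ((v * s) ^ n / fact n)))"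
    proof (rule sum_mono)
      fix k assume k: "k \<in> N j"
      \<comment> \<open>A neighbour is at most one step closer to the observable, which costs
        exactly one order of the bound.\<close>
      have "n \<le> D k" using D[OF Suc.prems(1) k] Suc.prems(2) by simp
      from Suc.IH[OF _ this s(1)] k Nj
      have "norm (comm (a k) (evo K s A)) \<le> Q * ((v * s) ^ n / fact n)"
        unfolding Q_def v_def by auto
      then show "norm (c k *\<^sub>R comm (a k) (evo K s A)) \<le> \<gamma> * (Q * ((v * s) ^ n / fact n))"
        unfolding norm_scaleR using c k Nj \<gamma> by (intro mult_mono) auto
    qed
    also have "\<dots> = card (N j) * (\<gamma> * (Q * ((v * s) ^ n / fact n)))" by simp
    also have "\<dots> \<le> \<Delta> * (\<gamma> * (Q * ((v * s) ^ n / fact n)))"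
      using Nj \<gamma> Q v s by (intro mult_right_mono) auto
    finally have 4: "norm (comm KN (evo K s A)) \<le> \<Delta> * (\<gamma> * (Q * ((v * s) ^ n / fact n)))" .
    have "norm (comm (a j) (R s)) \<le> 2 * norm (a j) * norm (R s)" by (rule norm_comm_le)
    also have "\<dots> \<le> 2 * \<alpha> * (\<Delta> * (\<gamma> * (Q * ((v * s) ^ n / fact n))))"
      unfolding R_def using a[OF Suc.prems(1)] \<alpha>
      by (intro mult_mono order_trans[OF norm_evo_le[OF sF] 4]) auto
    also have "\<dots> = v * Q * ((v * s) ^ n / fact n)" unfolding v_def by simp
    finally show ?thesis .
  qed
  \<comment> \<open>Integrating the bound of order \<open>n\<close> over time yields the next power
    over the next factorial.\<close>
  have "norm (E t - E 0) \<le> Q * ((v * t) ^ Suc n / fact (Suc n)) - Q * ((v * 0) ^ Suc n / fact (Suc n))"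
  proof (rule norm_diff_le_derivative[OF Suc.prems(3) d])
    fix s assume s: "0 \<le> s" "s \<le> t"
    show "norm (comm (a j) (R s)) \<le> v * Q * ((v * s) ^ n / fact n)" by (rule b[OF s])
    have f: "(fact (Suc n) :: real) = real (Suc n) * fact n" by (rule fact_Suc)
    show "((\<lambda>s. Q * ((v * s) ^ Suc n / fact (Suc n))) has_real_derivative v * Q * ((v * s) ^ n / fact n))
        (at s within {0..t})"
      unfolding f by (rule derivative_eq_intros refl | simp)+
  qed
  \<comment> \<open>\<open>Suc n \<le> D j\<close> forces \<open>D j > 0\<close>, so the commutator
    vanishes initially and only the time integral contributes.\<close>
  moreover have "E 0 = 0" unfolding E_def using D0[of j] Suc.prems by simp
  moreover have "norm (E t) = norm (comm (a j) (evo K t A))"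
    unfolding E_eq by (rule norm_evo[OF sF])
  ultimately show ?case unfolding Q_def v_def by simp
qed

section \<open>A Banach algebra of matrix families\<close>

lemma finite_cfgs: "finite S \<Longrightarrow> finite (cfgs S)"
proof -
  assume "finite S"
  have "cfgs S \<subseteq> (\<lambda>A x. x \<in> A) ` Pow S"
  proof
    fix \<sigma> assume "\<sigma> \<in> cfgs S"
    then have "{x. \<sigma> x} \<in> Pow S" "\<sigma> = (\<lambda>x. x \<in> {x. \<sigma> x})" by (auto simp: cfgs_def)
    then show "\<sigma> \<in> (\<lambda>A x. x \<in> A) ` Pow S" by blast
  qed
  then show ?thesis using \<open>finite S\<close> finite_subset by blast
qed

text \<open>Ensures that no matrix space has dimension zero, not even for the empty set of sites:
  unit vectors exist, so the supremum in \<open>opnorm\<close> is taken over a nonempty set, and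
  \<open>0 \<noteq> 1\<close> in the algebra below.\<close>

lemma False_in_cfgs: "(\<lambda>_. False) \<in> cfgs S"
  by (simp add: cfgs_def)

lemma vnorm_L2_set: "vnorm S v = L2_set (\<lambda>\<sigma>. cmod (v \<sigma>)) (cfgs S)"
  by (simp add: vnorm_def L2_set_def)

lemma vnorm_nonneg: "0 \<le> vnorm S v"
  by (simp add: vnorm_L2_set)

lemma vnorm_cong: "(\<And>\<sigma>. \<sigma> \<in> cfgs S \<Longrightarrow> v \<sigma> = w \<sigma>) \<Longrightarrow> vnorm S v = vnorm S w"
  unfolding vnorm_L2_set by (rule L2_set_cong) auto

lemma vnorm_add_le: "vnorm S (\<lambda>\<sigma>. v \<sigma> + w \<sigma>) \<le> vnorm S v + vnorm S w"
proof -
  have "vnorm S (\<lambda>\<sigma>. v \<sigma> + w \<sigma>) \<le> L2_set (\<lambda>\<sigma>. cmod (v \<sigma>) + cmod (w \<sigma>)) (cfgs S)"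
    unfolding vnorm_L2_set by (intro L2_set_mono norm_triangle_ineq) auto
  also have "\<dots> \<le> vnorm S v + vnorm S w"
    unfolding vnorm_L2_set by (rule L2_set_triangle_ineq)
  finally show ?thesis .
qed

lemma vnorm_scale: "vnorm S (\<lambda>\<sigma>. c * v \<sigma>) = cmod c * vnorm S v"
  unfolding vnorm_L2_set norm_mult by (rule L2_set_right_distrib[symmetric]) simp

lemma cmod_le_vnorm: "finite S \<Longrightarrow> \<sigma> \<in> cfgs S \<Longrightarrow> cmod (v \<sigma>) \<le> vnorm S v"
  unfolding vnorm_L2_set by (rule member_le_L2_set) (auto simp: finite_cfgs)

lemma vnorm_indicator:
  assumes "finite S" "\<tau> \<in> cfgs S"
  shows "vnorm S (\<lambda>\<sigma>. if \<sigma> = \<tau> then 1 else 0) = 1"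
proof -
  have "(\<Sum>\<sigma>\<in>cfgs S. (cmod (if \<sigma> = \<tau> then 1 else 0))\<^sup>2) = (\<Sum>\<sigma>\<in>cfgs S. if \<sigma> = \<tau> then 1 else 0)"
    by (rule sum.cong) auto
  then show ?thesis using assms by (simp add: vnorm_def finite_cfgs)
qed

text \<open>A real supremum is informative only for bounded sets; the sum of all entries is a crude
  bound, but any bound will do.\<close>

lemma bdd_above_opnorm:
  assumes "finite S"
  shows "bdd_above ((\<lambda>v. vnorm S (oapply S A v)) ` {v. vnorm S v = 1})"
proof (rule bdd_aboveI2)
  fix v assume "v \<in> {v. vnorm S v = 1}"
  then have v: "cmod (v \<tau>) \<le> 1" if "\<tau> \<in> cfgs S" for \<tau>
    using cmod_le_vnorm[OF assms that, of v] by simp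
  have "vnorm S (oapply S A v) \<le> (\<Sum>\<sigma>\<in>cfgs S. cmod (oapply S A v \<sigma>))"
    unfolding vnorm_L2_set by (rule L2_set_le_sum) simp
  also have "\<dots> \<le> (\<Sum>\<sigma>\<in>cfgs S. \<Sum>\<tau>\<in>cfgs S. cmod (A \<sigma> \<tau>) * 1)"
    unfolding oapply_def
    by (intro sum_mono order_trans[OF norm_sum]) (auto simp: norm_mult intro!: mult_left_le v)
  finally show "vnorm S (oapply S A v) \<le> (\<Sum>\<sigma>\<in>cfgs S. \<Sum>\<tau>\<in>cfgs S. cmod (A \<sigma> \<tau>))" by simp
qed

lemma oapply_scale: "oapply S A (\<lambda>\<sigma>. c * v \<sigma>) = (\<lambda>\<sigma>. c * oapply S A v \<sigma>)"
  by (simp add: oapply_def sum_distrib_left mult.left_commute)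

lemma vnorm_oapply_le:
  assumes "finite S"
  shows "vnorm S (oapply S A v) \<le> opnorm S A * vnorm S v"
proof (cases "vnorm S v = 0")
  case True
  then have "v \<tau> = 0" if "\<tau> \<in> cfgs S" for \<tau>
    using cmod_le_vnorm[OF assms that, of v] by simp
  then have "oapply S A v = (\<lambda>_. 0)" by (simp add: oapply_def)
  then show ?thesis using True by (simp add: vnorm_def)
next
  case False
  define c where "c = complex_of_real (inverse (vnorm S v))"
  have c: "cmod c = inverse (vnorm S v)" using vnorm_nonneg[of S v] by (simp add: c_def norm_inverse)
  have "vnorm S (oapply S A (\<lambda>\<sigma>. c * v \<sigma>)) \<le> opnorm S A"
    unfolding opnorm_def
    by (rule cSUP_upper[OF _ bdd_above_opnorm[OF assms]]) (use False in \<open>simp add: vnorm_scale c\<close>)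
  then have "inverse (vnorm S v) * vnorm S (oapply S A v) \<le> opnorm S A"
    by (simp add: oapply_scale vnorm_scale c)
  then show ?thesis using False vnorm_nonneg[of S v] by (simp add: field_simps)
qed

lemma opnorm_le:
  assumes "finite S" "\<And>v. vnorm S (oapply S A v) \<le> C * vnorm S v"
  shows "opnorm S A \<le> C"
  unfolding opnorm_def
proof (rule cSUP_least)
  show "{v. vnorm S v = 1} \<noteq> {}"
    using vnorm_indicator[OF assms(1) False_in_cfgs] by blast
  show "vnorm S (oapply S A v) \<le> C" if "v \<in> {v. vnorm S v = 1}" for v
    using assms(2)[of v] that by simp
qed

lemma cmod_le_opnorm:
  assumes "finite S" "\<sigma> \<in> cfgs S" "\<tau> \<in> cfgs S"
  shows "cmod (A \<sigma> \<tau>) \<le> opnorm S A"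
proof -
  let ?v = "\<lambda>\<sigma>. if \<sigma> = \<tau> then 1 else 0"
  have "oapply S A ?v \<sigma> = A \<sigma> \<tau>"
    using assms by (simp add: oapply_def finite_cfgs if_distrib cong: if_cong)
  then show ?thesis
    using cmod_le_vnorm[OF assms(1,2), of "oapply S A ?v"] vnorm_oapply_le[OF assms(1), of A ?v]
    by (simp add: vnorm_indicator assms)
qed

lemma opnorm_nonneg: "finite S \<Longrightarrow> 0 \<le> opnorm S A"
  by (rule order_trans[OF norm_ge_zero cmod_le_opnorm[OF _ False_in_cfgs False_in_cfgs]])

lemma opnorm_cong:
  assumes "\<And>\<sigma> \<tau>. \<sigma> \<in> cfgs S \<Longrightarrow> \<tau> \<in> cfgs S \<Longrightarrow> A \<sigma> \<tau> = B \<sigma> \<tau>"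
  shows "opnorm S A = opnorm S B"
proof -
  have "vnorm S (oapply S A v) = vnorm S (oapply S B v)" for v
    by (rule vnorm_cong) (auto simp: oapply_def assms intro!: sum.cong)
  then show ?thesis by (simp add: opnorm_def)
qed

lemma opnorm_add_le:
  assumes "finite S"
  shows "opnorm S (\<lambda>\<sigma> \<tau>. A \<sigma> \<tau> + B \<sigma> \<tau>) \<le> opnorm S A + opnorm S B"
proof (rule opnorm_le[OF assms])
  fix v
  have "oapply S (\<lambda>\<sigma> \<tau>. A \<sigma> \<tau> + B \<sigma> \<tau>) v = (\<lambda>\<sigma>. oapply S A v \<sigma> + oapply S B v \<sigma>)"
    by (simp add: oapply_def distrib_right sum.distrib)
  then have "vnorm S (oapply S (\<lambda>\<sigma> \<tau>. A \<sigma> \<tau> + B \<sigma> \<tau>) v) \<le> vnorm S (oapply S A v) + vnorm S (oapply S B v)"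
    using vnorm_add_le by simp
  also have "\<dots> \<le> opnorm S A * vnorm S v + opnorm S B * vnorm S v"
    by (intro add_mono vnorm_oapply_le assms)
  finally show "vnorm S (oapply S (\<lambda>\<sigma> \<tau>. A \<sigma> \<tau> + B \<sigma> \<tau>) v) \<le> (opnorm S A + opnorm S B) * vnorm S v"
    by (simp add: distrib_right)
qed

lemma opnorm_scale_le:
  assumes "finite S"
  shows "opnorm S (\<lambda>\<sigma> \<tau>. c * A \<sigma> \<tau>) \<le> cmod c * opnorm S A"
proof (rule opnorm_le[OF assms])
  fix v
  have "oapply S (\<lambda>\<sigma> \<tau>. c * A \<sigma> \<tau>) v = (\<lambda>\<sigma>. c * oapply S A v \<sigma>)"
    by (simp add: oapply_def sum_distrib_left mult.assoc)
  then show "vnorm S (oapply S (\<lambda>\<sigma> \<tau>. c * A \<sigma> \<tau>) v) \<le> cmod c * opnorm S A * vnorm S v"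
    using mult_left_mono[OF vnorm_oapply_le[OF assms, of A v], of "cmod c"]
    by (simp add: vnorm_scale mult.assoc)
qed

lemma oapply_omul: "oapply S (omul S A B) v = oapply S A (oapply S B v)"
  unfolding oapply_def omul_def sum_distrib_left sum_distrib_right mult.assoc
  by (rule ext, rule sum.swap)

lemma opnorm_omul_le:
  assumes "finite S"
  shows "opnorm S (omul S A B) \<le> opnorm S A * opnorm S B"
proof (rule opnorm_le[OF assms])
  fix v
  have "vnorm S (oapply S A (oapply S B v)) \<le> opnorm S A * vnorm S (oapply S B v)"
    by (rule vnorm_oapply_le[OF assms])
  also have "\<dots> \<le> opnorm S A * (opnorm S B * vnorm S v)"
    by (intro mult_left_mono vnorm_oapply_le opnorm_nonneg assms)
  finally show "vnorm S (oapply S (omul S A B) v) \<le> opnorm S A * opnorm S B * vnorm S v"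
    by (simp add: oapply_omul mult.assoc)
qed

lemma opnorm_zero: "finite S \<Longrightarrow> opnorm S (\<lambda>_ _. 0) = 0"
  by (intro antisym opnorm_nonneg opnorm_le) (auto simp: oapply_def vnorm_def)

lemma opnorm_id:
  assumes "finite S"
  shows "opnorm S idop = 1"
proof (rule antisym)
  show "opnorm S idop \<le> 1"
  proof (rule opnorm_le[OF assms])
    fix v
    have "oapply S idop v \<sigma> = v \<sigma>" if "\<sigma> \<in> cfgs S" for \<sigma>
    proof -
      have "oapply S idop v \<sigma> = (\<Sum>\<tau>\<in>cfgs S. if \<sigma> = \<tau> then v \<tau> else 0)"
        unfolding oapply_def idop_def by (rule sum.cong) auto
      then show ?thesis using that assms by (simp add: finite_cfgs)
    qed
    then show "vnorm S (oapply S idop v) \<le> 1 * vnorm S v"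
      using vnorm_cong[of S "oapply S idop v" v] by simp
  qed
  show "1 \<le> opnorm S idop"
    using cmod_le_opnorm[OF assms False_in_cfgs False_in_cfgs, of idop] by (simp add: idop_def)
qed

text \<open>The matrices over \<open>cfgs S\<close> for all finite \<open>S\<close> at once, with uniformly bounded operator norms:
  a single type that is a Banach algebra and contains the operators on every finite system.\<close>

typedef qfam = "{A :: site set \<Rightarrow> qop.
    (\<forall>S \<sigma> \<tau>. A S \<sigma> \<tau> \<noteq> 0 \<longrightarrow> finite S \<and> \<sigma> \<in> cfgs S \<and> \<tau> \<in> cfgs S) \<and>
    (\<exists>C. \<forall>S. finite S \<longrightarrow> opnorm S (A S) \<le> C)}"
  morphisms ent Abs_qfam
  by (rule exI[of _ "\<lambda>_ _ _. 0"]) (auto simp: opnorm_zero intro!: exI[of _ 0])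

setup_lifting type_definition_qfam

lemma ent_nonzero: "ent A S \<sigma> \<tau> \<noteq> 0 \<Longrightarrow> finite S \<and> \<sigma> \<in> cfgs S \<and> \<tau> \<in> cfgs S"
  using ent[of A] by auto

lemma ent_bounded: "\<exists>C. \<forall>S. finite S \<longrightarrow> opnorm S (ent A S) \<le> C"
  using ent[of A] by auto

text \<open>All other entries vanish by the definition of the type. This reduces the algebra laws to
  entrywise identities of finite sums.\<close>

lemma qfam_eqI: "(\<And>S \<sigma> \<tau>. finite S \<Longrightarrow> \<sigma> \<in> cfgs S \<Longrightarrow> \<tau> \<in> cfgs S \<Longrightarrow> ent A S \<sigma> \<tau> = ent B S \<sigma> \<tau>) \<Longrightarrow> A = B"
  by (rule ent_inject[THEN iffD1], intro ext) (metis ent_nonzero)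

instantiation qfam :: real_normed_vector
begin

lift_definition zero_qfam :: qfam is "\<lambda>_ _ _. 0"
  by (auto simp: opnorm_zero intro!: exI[of _ 0])

lift_definition plus_qfam :: "qfam \<Rightarrow> qfam \<Rightarrow> qfam" is "\<lambda>A B S \<sigma> \<tau>. A S \<sigma> \<tau> + B S \<sigma> \<tau>"
proof safe
  fix A B :: "site set \<Rightarrow> qop" and C D
  assume "\<forall>S. finite S \<longrightarrow> opnorm S (A S) \<le> C" "\<forall>S. finite S \<longrightarrow> opnorm S (B S) \<le> D"
  then have "\<forall>S. finite S \<longrightarrow> opnorm S (\<lambda>\<sigma> \<tau>. A S \<sigma> \<tau> + B S \<sigma> \<tau>) \<le> C + D"
    by (auto intro: order_trans[OF opnorm_add_le] add_mono)
  then show "\<exists>C. \<forall>S. finite S \<longrightarrow> opnorm S (\<lambda>\<sigma> \<tau>. A S \<sigma> \<tau> + B S \<sigma> \<tau>) \<le> C" by blast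
qed (metis add.right_neutral)+

lift_definition scaleR_qfam :: "real \<Rightarrow> qfam \<Rightarrow> qfam" is "\<lambda>c A S \<sigma> \<tau>. complex_of_real c * A S \<sigma> \<tau>"
proof safe
  fix c :: real and A :: "site set \<Rightarrow> qop" and C
  assume "\<forall>S. finite S \<longrightarrow> opnorm S (A S) \<le> C"
  then have "\<forall>S. finite S \<longrightarrow> opnorm S (\<lambda>\<sigma> \<tau>. complex_of_real c * A S \<sigma> \<tau>) \<le> \<bar>c\<bar> * C"
    by (auto intro!: order_trans[OF opnorm_scale_le] mult_left_mono)
  then show "\<exists>C. \<forall>S. finite S \<longrightarrow> opnorm S (\<lambda>\<sigma> \<tau>. complex_of_real c * A S \<sigma> \<tau>) \<le> C" by blast
qed (metis mult_zero_right)+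

definition uminus_qfam :: "qfam \<Rightarrow> qfam" where "- A = (-1) *\<^sub>R (A :: qfam)"
definition minus_qfam :: "qfam \<Rightarrow> qfam \<Rightarrow> qfam" where "A - B = A + - (B :: qfam)"
definition norm_qfam :: "qfam \<Rightarrow> real" where "norm (A :: qfam) = (SUP S\<in>{S. finite S}. opnorm S (ent A S))"
definition dist_qfam :: "qfam \<Rightarrow> qfam \<Rightarrow> real" where "dist A B = norm (A - B :: qfam)"
definition sgn_qfam :: "qfam \<Rightarrow> qfam" where "sgn A = inverse (norm A) *\<^sub>R (A :: qfam)"
definition uniformity_qfam :: "(qfam \<times> qfam) filter" where
  "uniformity_qfam = (INF e\<in>{0<..}. principal {(x, y). dist x y < e})"
definition open_qfam :: "qfam set \<Rightarrow> bool" where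
  "open_qfam U \<longleftrightarrow> (\<forall>x\<in>U. \<forall>\<^sub>F (x', y) in uniformity. x' = x \<longrightarrow> y \<in> U)"

lemma ent_add: "ent (A + B) S \<sigma> \<tau> = ent A S \<sigma> \<tau> + ent B S \<sigma> \<tau>"
  by (simp add: plus_qfam.rep_eq)

lemma ent_scaleR: "ent (c *\<^sub>R A) S \<sigma> \<tau> = complex_of_real c * ent A S \<sigma> \<tau>"
  by (simp add: scaleR_qfam.rep_eq)

lemma ent_zero: "ent 0 S \<sigma> \<tau> = 0"
  by (simp add: zero_qfam.rep_eq)

lemma ent_minus: "ent (- A) S \<sigma> \<tau> = - ent A S \<sigma> \<tau>"
  by (simp add: uminus_qfam_def ent_scaleR)

lemma ent_diff: "ent (A - B) S \<sigma> \<tau> = ent A S \<sigma> \<tau> - ent B S \<sigma> \<tau>"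
  by (simp add: minus_qfam_def ent_add ent_minus)

lemmas ent_simps = ent_add ent_scaleR ent_zero ent_minus ent_diff

lemma opnorm_ent_le_norm: "finite S \<Longrightarrow> opnorm S (ent A S) \<le> norm A"
  unfolding norm_qfam_def
  by (rule cSUP_upper) (use ent_bounded[of A] in \<open>auto intro: bdd_aboveI2\<close>)

lemma norm_qfam_le: "(\<And>S. finite S \<Longrightarrow> opnorm S (ent A S) \<le> C) \<Longrightarrow> norm A \<le> (C::real)" for A :: qfam
  unfolding norm_qfam_def by (rule cSUP_least) auto

lemma norm_qfam_scaleR_le: "norm (c *\<^sub>R A) \<le> \<bar>c\<bar> * norm A" for A :: qfam
proof (rule norm_qfam_le)
  fix S :: "site set" assume S: "finite S"
  have "opnorm S (ent (c *\<^sub>R A) S) = opnorm S (\<lambda>\<sigma> \<tau>. complex_of_real c * ent A S \<sigma> \<tau>)"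
    by (rule opnorm_cong) (simp add: ent_scaleR)
  also have "\<dots> \<le> \<bar>c\<bar> * opnorm S (ent A S)" using opnorm_scale_le[OF S, of "complex_of_real c"] by simp
  also have "\<dots> \<le> \<bar>c\<bar> * norm A" by (intro mult_left_mono opnorm_ent_le_norm S) simp
  finally show "opnorm S (ent (c *\<^sub>R A) S) \<le> \<bar>c\<bar> * norm A" .
qed

instance
proof
  fix A B C :: qfam and c d :: real
  show "A + B + C = A + (B + C)" "A + B = B + A" "0 + A = A" "- A + A = 0" "A - B = A + - B"
    "c *\<^sub>R (A + B) = c *\<^sub>R A + c *\<^sub>R B" "(c + d) *\<^sub>R A = c *\<^sub>R A + d *\<^sub>R A"
    "c *\<^sub>R d *\<^sub>R A = (c * d) *\<^sub>R A" "1 *\<^sub>R A = A"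
    by (rule qfam_eqI; simp add: ent_simps algebra_simps)+
  show "dist A B = norm (A - B)" by (rule dist_qfam_def)
  show "sgn A = inverse (norm A) *\<^sub>R A" by (rule sgn_qfam_def)
  show "uniformity = (INF e\<in>{0<..}. principal {(x, y :: qfam). dist x y < e})" by (rule uniformity_qfam_def)
  show "open U \<longleftrightarrow> (\<forall>x\<in>U. \<forall>\<^sub>F (x', y) in uniformity. x' = x \<longrightarrow> y \<in> U)" for U :: "qfam set"
    by (rule open_qfam_def)
  show "norm (A + B) \<le> norm A + norm B"
  proof (rule norm_qfam_le)
    fix S :: "site set" assume S: "finite S"
    have "opnorm S (ent (A + B) S) = opnorm S (\<lambda>\<sigma> \<tau>. ent A S \<sigma> \<tau> + ent B S \<sigma> \<tau>)"
      by (rule opnorm_cong) (simp add: ent_add)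
    also have "\<dots> \<le> opnorm S (ent A S) + opnorm S (ent B S)" by (rule opnorm_add_le[OF S])
    also have "\<dots> \<le> norm A + norm B" by (intro add_mono opnorm_ent_le_norm S)
    finally show "opnorm S (ent (A + B) S) \<le> norm A + norm B" .
  qed
  show "norm A = 0 \<longleftrightarrow> A = 0"
  proof
    assume A: "norm A = 0"
    show "A = 0"
    proof (rule qfam_eqI)
      fix S \<sigma> \<tau> assume "finite S" "\<sigma> \<in> cfgs S" "\<tau> \<in> cfgs S"
      then have "cmod (ent A S \<sigma> \<tau>) \<le> norm A"
        by (blast intro: order_trans[OF cmod_le_opnorm opnorm_ent_le_norm])
      then show "ent A S \<sigma> \<tau> = ent 0 S \<sigma> \<tau>" using A by (simp add: ent_zero)
    qed
  next
    assume "A = 0"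
    then have "ent A S = (\<lambda>_ _. 0)" for S by (simp add: fun_eq_iff ent_zero)
    then have "norm A \<le> 0" by (intro norm_qfam_le) (simp add: opnorm_zero)
    moreover have "0 \<le> norm A"
      using order_trans[OF opnorm_nonneg opnorm_ent_le_norm, of "{}"] by simp
    ultimately show "norm A = 0" by simp
  qed
  show "norm (c *\<^sub>R A) = \<bar>c\<bar> * norm A"
  proof (rule antisym[OF norm_qfam_scaleR_le])
    show "\<bar>c\<bar> * norm A \<le> norm (c *\<^sub>R A)"
    proof (cases "c = 0")
      case False
      \<comment> \<open>The reverse inequality is the same estimate for the scalar
        \<open>inverse c\<close>.\<close>
      have "inverse c *\<^sub>R c *\<^sub>R A = A"
        by (rule qfam_eqI) (use False in \<open>simp add: ent_scaleR\<close>)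
      then have "norm A \<le> \<bar>inverse c\<bar> * norm (c *\<^sub>R A)"
        using norm_qfam_scaleR_le[of "inverse c" "c *\<^sub>R A"] by simp
      then show ?thesis using False by (simp add: field_simps abs_inverse)
    next
      case True
      then show ?thesis
        using order_trans[OF opnorm_nonneg opnorm_ent_le_norm, of "{}" "c *\<^sub>R A"] by simp
    qed
  qed
qed

end

instantiation qfam :: real_normed_algebra_1
begin

text \<open>The unit acts as the identity on every finite system at once. Hence exponentials in this
  algebra are the identity on all systems on which the exponent vanishes.\<close>

lift_definition one_qfam :: qfam is "\<lambda>S \<sigma> \<tau>. if finite S \<and> \<sigma> \<in> cfgs S \<and> \<tau> \<in> cfgs S then idop \<sigma> \<tau> else 0"
proof safe
  have "\<forall>S. finite S \<longrightarrow>
      opnorm S (\<lambda>\<sigma> \<tau>. if finite S \<and> \<sigma> \<in> cfgs S \<and> \<tau> \<in> cfgs S then idop \<sigma> \<tau> else 0) = opnorm S idop"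
    by (auto intro: opnorm_cong)
  then show "\<exists>C. \<forall>S. finite S \<longrightarrow>
      opnorm S (\<lambda>\<sigma> \<tau>. if finite S \<and> \<sigma> \<in> cfgs S \<and> \<tau> \<in> cfgs S then idop \<sigma> \<tau> else 0) \<le> C"
    by (intro exI[of _ 1]) (auto simp: opnorm_id)
qed (auto split: if_splits)

lift_definition times_qfam :: "qfam \<Rightarrow> qfam \<Rightarrow> qfam" is "\<lambda>A B S. omul S (A S) (B S)"
proof (rule conjI, goal_cases)
  case (1 A B)
  show ?case
  proof (intro allI impI)
    fix S \<sigma> \<tau>
    assume "omul S (A S) (B S) \<sigma> \<tau> \<noteq> 0"
    then obtain \<rho> where "A S \<sigma> \<rho> * B S \<rho> \<tau> \<noteq> 0"
      unfolding omul_def by (rule sum.not_neutral_contains_not_neutral)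
    then have "A S \<sigma> \<rho> \<noteq> 0" "B S \<rho> \<tau> \<noteq> 0" by auto
    with 1 show "finite S \<and> \<sigma> \<in> cfgs S \<and> \<tau> \<in> cfgs S" by simp
  qed
next
  case (2 A B)
  then obtain C D where CD: "\<And>S. finite S \<Longrightarrow> opnorm S (A S) \<le> C" "\<And>S. finite S \<Longrightarrow> opnorm S (B S) \<le> D"
    by auto
  have "0 \<le> C" using order_trans[OF opnorm_nonneg CD(1), of "{}"] by simp
  then have "\<forall>S. finite S \<longrightarrow> opnorm S (omul S (A S) (B S)) \<le> C * D"
    using CD by (auto intro!: order_trans[OF opnorm_omul_le] mult_mono opnorm_nonneg)
  then show ?case by (rule exI)
qed

lemma ent_one: "finite S \<Longrightarrow> \<sigma> \<in> cfgs S \<Longrightarrow> \<tau> \<in> cfgs S \<Longrightarrow> ent 1 S \<sigma> \<tau> = idop \<sigma> \<tau>"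
  by (simp add: one_qfam.rep_eq)

lemma ent_mult: "ent (A * B) S = omul S (ent A S) (ent B S)"
  by (simp add: times_qfam.rep_eq)

instance
proof
  fix A B C :: qfam and c :: real
  show "A * B * C = A * (B * C)"
  proof (rule qfam_eqI)
    fix S \<sigma> \<tau>
    show "ent (A * B * C) S \<sigma> \<tau> = ent (A * (B * C)) S \<sigma> \<tau>"
      unfolding ent_mult omul_def sum_distrib_left sum_distrib_right mult.assoc by (rule sum.swap)
  qed
  show "(A + B) * C = A * C + B * C" "A * (B + C) = A * B + A * C"
    "c *\<^sub>R A * B = c *\<^sub>R (A * B)" "A * c *\<^sub>R B = c *\<^sub>R (A * B)"
    by (rule qfam_eqI; simp add: ent_simps ent_mult omul_def algebra_simps sum.distrib sum_distrib_left)+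
  show "1 * A = A"
  proof (rule qfam_eqI)
    fix S \<sigma> \<tau> assume S: "finite S" "\<sigma> \<in> cfgs S" "\<tau> \<in> cfgs S"
    have "ent (1 * A) S \<sigma> \<tau> = (\<Sum>\<rho>\<in>cfgs S. if \<sigma> = \<rho> then ent A S \<rho> \<tau> else 0)"
      unfolding ent_mult omul_def by (rule sum.cong) (auto simp: ent_one S idop_def)
    then show "ent (1 * A) S \<sigma> \<tau> = ent A S \<sigma> \<tau>" using S by (simp add: finite_cfgs)
  qed
  show "A * 1 = A"
  proof (rule qfam_eqI)
    fix S \<sigma> \<tau> assume S: "finite S" "\<sigma> \<in> cfgs S" "\<tau> \<in> cfgs S"
    have "ent (A * 1) S \<sigma> \<tau> = (\<Sum>\<rho>\<in>cfgs S. if \<rho> = \<tau> then ent A S \<sigma> \<rho> else 0)"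
      unfolding ent_mult omul_def by (rule sum.cong) (auto simp: ent_one S idop_def)
    then show "ent (A * 1) S \<sigma> \<tau> = ent A S \<sigma> \<tau>" using S by (simp add: finite_cfgs)
  qed
  have "ent (0 :: qfam) {} (\<lambda>_. False) (\<lambda>_. False) \<noteq> ent 1 {} (\<lambda>_. False) (\<lambda>_. False)"
    by (simp add: ent_zero ent_one False_in_cfgs idop_def)
  then show "(0 :: qfam) \<noteq> 1" by metis
  have one: "opnorm S (ent 1 S) = 1" if "finite S" for S
    using opnorm_cong[of S "ent 1 S" idop] that by (simp add: ent_one opnorm_id)
  show "norm (1 :: qfam) = 1"
  proof (rule antisym)
    show "norm (1 :: qfam) \<le> 1" by (rule norm_qfam_le) (simp add: one)
    show "1 \<le> norm (1 :: qfam)" using opnorm_ent_le_norm[of "{}" 1] one[of "{}"] by simp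
  qed
  show "norm (A * B) \<le> norm A * norm B"
  proof (rule norm_qfam_le)
    fix S :: "site set" assume S: "finite S"
    have "opnorm S (ent (A * B) S) \<le> opnorm S (ent A S) * opnorm S (ent B S)"
      unfolding ent_mult by (rule opnorm_omul_le[OF S])
    also have "\<dots> \<le> norm A * norm B"
      by (intro mult_mono opnorm_ent_le_norm opnorm_nonneg norm_ge_zero S)
    finally show "opnorm S (ent (A * B) S) \<le> norm A * norm B" .
  qed
qed

end

lemma cmod_ent_le_norm: "cmod (ent A S \<sigma> \<tau>) \<le> norm A"
proof (cases "ent A S \<sigma> \<tau> = 0")
  case False
  then show ?thesis
    using ent_nonzero[OF False] by (intro order_trans[OF cmod_le_opnorm opnorm_ent_le_norm]) auto
qed simp

text \<open>The limit is taken entry by entry. Since there are infinitely many systems, this alone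
  does not give convergence in norm: the Cauchy estimate is first passed to the limit for fixed
  \<open>S\<close> and \<open>v\<close>, where everything is a finite sum, and the index
  \<open>N\<close> obtained is the same for all \<open>S\<close>.\<close>

instance qfam :: banach
proof
  fix X :: "nat \<Rightarrow> qfam" assume X: "Cauchy X"
  define L where "L = (\<lambda>S \<sigma> \<tau>. lim (\<lambda>n. ent (X n) S \<sigma> \<tau>))"
  have lim: "(\<lambda>n. ent (X n) S \<sigma> \<tau>) \<longlonglongrightarrow> L S \<sigma> \<tau>" for S \<sigma> \<tau>
  proof -
    have "Cauchy (\<lambda>n. ent (X n) S \<sigma> \<tau>)"
    proof (rule metric_CauchyI)
      fix e :: real assume "0 < e"
      then obtain N where N: "\<And>m n. m \<ge> N \<Longrightarrow> n \<ge> N \<Longrightarrow> dist (X m) (X n) < e"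
        using metric_CauchyD[OF X] by blast
      have "dist (ent (X m) S \<sigma> \<tau>) (ent (X n) S \<sigma> \<tau>) \<le> dist (X m) (X n)" for m n
        using cmod_ent_le_norm[of "X m - X n" S \<sigma> \<tau>] by (simp add: dist_norm ent_diff)
      then show "\<exists>N. \<forall>m\<ge>N. \<forall>n\<ge>N. dist (ent (X m) S \<sigma> \<tau>) (ent (X n) S \<sigma> \<tau>) < e"
        using N by (blast intro: le_less_trans)
    qed
    then show ?thesis unfolding L_def using Cauchy_convergent convergent_LIMSEQ_iff by blast
  qed
  have close: "\<exists>N. \<forall>n\<ge>N. \<forall>S. finite S \<longrightarrow> opnorm S (\<lambda>\<sigma> \<tau>. ent (X n) S \<sigma> \<tau> - L S \<sigma> \<tau>) \<le> e"
    if e: "0 < e" for e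
  proof -
    obtain N where N: "\<And>m n. m \<ge> N \<Longrightarrow> n \<ge> N \<Longrightarrow> dist (X m) (X n) < e"
      using metric_CauchyD[OF X e] by blast
    have "opnorm S (\<lambda>\<sigma> \<tau>. ent (X n) S \<sigma> \<tau> - L S \<sigma> \<tau>) \<le> e" if n: "n \<ge> N" and S: "finite S" for n S
    proof (rule opnorm_le[OF S])
      fix v
      show "vnorm S (oapply S (\<lambda>\<sigma> \<tau>. ent (X n) S \<sigma> \<tau> - L S \<sigma> \<tau>) v) \<le> e * vnorm S v"
      proof (rule tendsto_upperbound)
        show "(\<lambda>m. vnorm S (oapply S (\<lambda>\<sigma> \<tau>. ent (X n) S \<sigma> \<tau> - ent (X m) S \<sigma> \<tau>) v))
            \<longlonglongrightarrow> vnorm S (oapply S (\<lambda>\<sigma> \<tau>. ent (X n) S \<sigma> \<tau> - L S \<sigma> \<tau>) v)"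
          unfolding vnorm_def oapply_def by (intro tendsto_intros lim)
        show "\<forall>\<^sub>F m in sequentially.
            vnorm S (oapply S (\<lambda>\<sigma> \<tau>. ent (X n) S \<sigma> \<tau> - ent (X m) S \<sigma> \<tau>) v) \<le> e * vnorm S v"
          unfolding eventually_sequentially
        proof (intro exI[of _ N] allI impI)
          fix m assume m: "N \<le> m"
          have eq: "(\<lambda>\<sigma> \<tau>. ent (X n) S \<sigma> \<tau> - ent (X m) S \<sigma> \<tau>) = ent (X n - X m) S"
            by (simp add: fun_eq_iff ent_diff)
          have "vnorm S (oapply S (ent (X n - X m) S) v) \<le> opnorm S (ent (X n - X m) S) * vnorm S v"
            by (rule vnorm_oapply_le[OF S])
          also have "\<dots> \<le> e * vnorm S v"
            using N[OF n m] opnorm_ent_le_norm[OF S, of "X n - X m"]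
            by (intro mult_right_mono vnorm_nonneg) (simp add: dist_norm)
          finally show "vnorm S (oapply S (\<lambda>\<sigma> \<tau>. ent (X n) S \<sigma> \<tau> - ent (X m) S \<sigma> \<tau>) v) \<le> e * vnorm S v"
            unfolding eq .
        qed
      qed simp
    qed
    then show ?thesis by blast
  qed
  have "L \<in> {A. (\<forall>S \<sigma> \<tau>. A S \<sigma> \<tau> \<noteq> 0 \<longrightarrow> finite S \<and> \<sigma> \<in> cfgs S \<and> \<tau> \<in> cfgs S) \<and>
      (\<exists>C. \<forall>S. finite S \<longrightarrow> opnorm S (A S) \<le> C)}"
  proof (intro CollectI conjI allI impI)
    fix S \<sigma> \<tau> assume L: "L S \<sigma> \<tau> \<noteq> 0"
    have "\<exists>n. ent (X n) S \<sigma> \<tau> \<noteq> 0"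
    proof (rule ccontr)
      assume "\<not> ?thesis"
      then have "(\<lambda>n. ent (X n) S \<sigma> \<tau>) = (\<lambda>_. 0)" by auto
      then have "(\<lambda>_. 0) \<longlonglongrightarrow> L S \<sigma> \<tau>" using lim[of S \<sigma> \<tau>] by simp
      from LIMSEQ_unique[OF this tendsto_const] L show False by simp
    qed
    then show "finite S" "\<sigma> \<in> cfgs S" "\<tau> \<in> cfgs S" using ent_nonzero by blast+
  next
    obtain N where N: "\<And>S. finite S \<Longrightarrow> opnorm S (\<lambda>\<sigma> \<tau>. ent (X N) S \<sigma> \<tau> - L S \<sigma> \<tau>) \<le> 1"
      using close[of 1] by auto
    have "opnorm S (L S) \<le> norm (X N) + 1" if S: "finite S" for S
    proof -
      have "opnorm S (L S)
          = opnorm S (\<lambda>\<sigma> \<tau>. ent (X N) S \<sigma> \<tau> + (-1) * (ent (X N) S \<sigma> \<tau> - L S \<sigma> \<tau>))"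
        by (rule opnorm_cong) simp
      also have "\<dots> \<le> opnorm S (ent (X N) S) + opnorm S (\<lambda>\<sigma> \<tau>. (-1) * (ent (X N) S \<sigma> \<tau> - L S \<sigma> \<tau>))"
        by (rule opnorm_add_le[OF S])
      also have "\<dots> \<le> norm (X N) + cmod (-1) * opnorm S (\<lambda>\<sigma> \<tau>. ent (X N) S \<sigma> \<tau> - L S \<sigma> \<tau>)"
        by (intro add_mono opnorm_ent_le_norm opnorm_scale_le S)
      finally show ?thesis using N[OF S] by simp
    qed
    then show "\<exists>C. \<forall>S. finite S \<longrightarrow> opnorm S (L S) \<le> C" by blast
  qed
  then have L: "ent (Abs_qfam L) = L" by (rule Abs_qfam_inverse)
  have "X \<longlonglongrightarrow> Abs_qfam L"
  proof (rule metric_LIMSEQ_I)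
    fix e :: real assume e: "0 < e"
    then obtain N where N: "\<And>n S. n \<ge> N \<Longrightarrow> finite S \<Longrightarrow> opnorm S (\<lambda>\<sigma> \<tau>. ent (X n) S \<sigma> \<tau> - L S \<sigma> \<tau>) \<le> e / 2"
      using close[of "e / 2"] by auto
    have "dist (X n) (Abs_qfam L) < e" if n: "n \<ge> N" for n
    proof -
      have "norm (X n - Abs_qfam L) \<le> e / 2"
      proof (rule norm_qfam_le)
        fix S :: "site set" assume S: "finite S"
        have "ent (X n - Abs_qfam L) S = (\<lambda>\<sigma> \<tau>. ent (X n) S \<sigma> \<tau> - L S \<sigma> \<tau>)"
          by (simp add: fun_eq_iff ent_diff L)
        then show "opnorm S (ent (X n - Abs_qfam L) S) \<le> e / 2" using N[OF n S] by simp
      qed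
      then show ?thesis using e by (simp add: dist_norm)
    qed
    then show "\<exists>N. \<forall>n\<ge>N. dist (X n) (Abs_qfam L) < e" by blast
  qed
  then show "convergent X" by (rule convergentI)
qed

section \<open>Qubit operators as elements of the Banach algebra\<close>

text \<open>A \<open>qop\<close> may take arbitrary values off \<open>cfgs S\<close>. They are cut
  away, so that \<open>emb S A\<close> depends only on the matrix on \<open>cfgs S\<close>, which
  occupies the component \<open>S\<close> and leaves all others zero.\<close>

lift_definition emb :: "site set \<Rightarrow> qop \<Rightarrow> qfam" is
  "\<lambda>S A T \<sigma> \<tau>. if T = S \<and> finite S \<and> \<sigma> \<in> cfgs S \<and> \<tau> \<in> cfgs S then A \<sigma> \<tau> else 0"
proof (rule conjI, goal_cases)
  case (2 S A)
  have "opnorm T (\<lambda>\<sigma> \<tau>. if T = S \<and> finite S \<and> \<sigma> \<in> cfgs S \<and> \<tau> \<in> cfgs S then A \<sigma> \<tau> else 0)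
      \<le> max 0 (opnorm S A)" if T: "finite T" for T
  proof (cases "T = S")
    case True
    have "opnorm S (\<lambda>\<sigma> \<tau>. if T = S \<and> finite S \<and> \<sigma> \<in> cfgs S \<and> \<tau> \<in> cfgs S then A \<sigma> \<tau> else 0) = opnorm S A"
      by (rule opnorm_cong) (use True T in auto)
    then show ?thesis using True by simp
  qed (use T in \<open>simp add: opnorm_zero\<close>)
  then show ?case by (intro exI allI impI)
qed (auto split: if_splits)

lemma ent_emb: "ent (emb S A) T \<sigma> \<tau>
    = (if T = S \<and> finite S \<and> \<sigma> \<in> cfgs S \<and> \<tau> \<in> cfgs S then A \<sigma> \<tau> else 0)"
  by (simp add: emb.rep_eq)

lemma emb_cong:
  "(\<And>\<sigma> \<tau>. \<sigma> \<in> cfgs S \<Longrightarrow> \<tau> \<in> cfgs S \<Longrightarrow> A \<sigma> \<tau> = B \<sigma> \<tau>) \<Longrightarrow> emb S A = emb S B"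
  by (rule qfam_eqI) (simp add: ent_emb)

lemma norm_emb_le:
  assumes "finite S"
  shows "norm (emb S A) \<le> opnorm S A"
proof (rule norm_qfam_le)
  fix T :: "site set" assume T: "finite T"
  show "opnorm T (ent (emb S A) T) \<le> opnorm S A"
  proof (cases "T = S")
    case True
    have "opnorm S (ent (emb S A) T) = opnorm S A"
      by (rule opnorm_cong) (use True T in \<open>simp add: ent_emb\<close>)
    then show ?thesis using True by simp
  next
    case False
    then have "ent (emb S A) T = (\<lambda>_ _. 0)" by (simp add: fun_eq_iff ent_emb)
    then show ?thesis using T assms by (simp add: opnorm_zero opnorm_nonneg)
  qed
qed

lemma emb_oplus: "emb S (oplus A B) = emb S A + emb S B"
  by (rule qfam_eqI) (simp add: ent_emb ent_simps oplus_def)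

lemma emb_scale: "emb S (oscale (of_real c) A) = c *\<^sub>R emb S A"
  by (rule qfam_eqI) (simp add: ent_emb ent_simps oscale_def)

lemma ent_sum: "ent (sum f I) S \<sigma> \<tau> = (\<Sum>i\<in>I. ent (f i) S \<sigma> \<tau>)"
  by (induction I rule: infinite_finite_induct) (simp_all add: ent_simps)

lemma emb_osum: "emb S (osum I A) = (\<Sum>i\<in>I. emb S (A i))"
proof (rule qfam_eqI)
  fix T \<sigma> \<tau>
  show "ent (emb S (osum I A)) T \<sigma> \<tau> = ent (\<Sum>i\<in>I. emb S (A i)) T \<sigma> \<tau>"
    unfolding ent_emb ent_sum osum_def
    by (cases "T = S \<and> finite S \<and> \<sigma> \<in> cfgs S \<and> \<tau> \<in> cfgs S")
      (simp, simp only: if_False sum.neutral_const)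
qed

lemma emb_omul: "emb S A * emb S B = emb S (omul S A B)"
proof (rule qfam_eqI)
  fix T \<sigma> \<tau> assume "finite T" "\<sigma> \<in> cfgs T" "\<tau> \<in> cfgs T"
  then show "ent (emb S A * emb S B) T \<sigma> \<tau> = ent (emb S (omul S A B)) T \<sigma> \<tau>"
    by (cases "T = S") (simp_all add: ent_mult ent_emb omul_def cong: sum.cong)
qed

lemma bounded_linear_ent: "bounded_linear (\<lambda>A. ent A S \<sigma> \<tau>)"
  by (rule bounded_linear_intro[of _ 1])
    (auto simp: ent_simps cmod_ent_le_norm scaleR_conv_of_real[where 'a = complex])

lemma ent_emb_power:
  assumes "finite S" "\<sigma> \<in> cfgs S" "\<tau> \<in> cfgs S"
  shows "ent (emb S A ^ n) S \<sigma> \<tau> = opow S A n \<sigma> \<tau>"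
  using assms(2,3)
proof (induction n arbitrary: \<sigma> \<tau>)
  case 0
  then show ?case using assms(1) by (simp add: ent_one)
next
  case (Suc n)
  then show ?case
    by (auto simp: ent_mult omul_def ent_emb assms(1) intro!: sum.cong)
qed

text \<open>Taking an entry is bounded linear and therefore passes through the exponential series,
  which becomes the entrywise series defining \<open>oexp\<close>.\<close>

lemma ent_exp_emb:
  assumes "finite S" "\<sigma> \<in> cfgs S" "\<tau> \<in> cfgs S"
  shows "ent (exp (emb S A)) S \<sigma> \<tau> = oexp S A \<sigma> \<tau>"
proof -
  have "ent (exp (emb S A)) S \<sigma> \<tau> = (\<Sum>n. ent (emb S A ^ n /\<^sub>R fact n) S \<sigma> \<tau>)"
    unfolding exp_def
    by (rule bounded_linear.suminf[OF bounded_linear_ent summable_exp_generic])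
  also have "\<dots> = oexp S A \<sigma> \<tau>"
    unfolding oexp_def
    by (rule suminf_cong) (simp add: ent_simps ent_emb_power assms divide_inverse mult.commute of_real_inverse)
  finally show ?thesis .
qed

lemma ent_mult_cfgs:
  "ent (A * B) S \<sigma> \<tau> = (\<Sum>\<rho>\<in>cfgs S. ent A S \<sigma> \<rho> * ent B S \<rho> \<tau>)"
  by (simp add: ent_mult omul_def)

lemma ent_evo_emb:
  assumes S: "finite S" "\<sigma> \<in> cfgs S" "\<tau> \<in> cfgs S"
  shows "ent (evo (emb S (oscale \<i> H)) t (emb S A)) S \<sigma> \<tau> = heis S H t A \<sigma> \<tau>"
proof -
  have scale: "s *\<^sub>R emb S (oscale \<i> H) = emb S (oscale (\<i> * of_real s) H)" for s
    by (rule qfam_eqI) (simp add: ent_emb ent_simps oscale_def)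
  have "oscale (\<i> * of_real (- t)) H = oscale (- \<i> * of_real t) H" by (simp add: oscale_def)
  then show ?thesis
    unfolding evo_def scale heis_def ent_mult_cfgs omul_def
    by (auto simp: ent_exp_emb S ent_emb intro!: sum.cong)
qed

section \<open>Anti-Hermitian families generate isometries\<close>

lemma ent_exp_derivative:
  "((\<lambda>s. ent (exp (s *\<^sub>R K)) S \<sigma> \<tau>) has_vector_derivative
    (\<Sum>\<rho>\<in>cfgs S. ent K S \<sigma> \<rho> * ent (exp (s *\<^sub>R K)) S \<rho> \<tau>)) (at s)"
  using bounded_linear.has_vector_derivative[OF bounded_linear_ent exp_scaleR_has_vector_derivative_left]
  unfolding ent_mult_cfgs .

definition antiherm :: "qfam \<Rightarrow> bool" where
  "antiherm K \<longleftrightarrow> (\<forall>S \<sigma> \<tau>. ent K S \<sigma> \<tau> = - cnj (ent K S \<tau> \<sigma>))"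

lemma antihermD: "antiherm K \<Longrightarrow> ent K S \<sigma> \<tau> = - cnj (ent K S \<tau> \<sigma>)"
  unfolding antiherm_def by (elim allE)

text \<open>The vector \<open>y s = exp (s *\<^sub>R K) v\<close> solves \<open>y' = K y\<close>,
  and the derivative of its squared norm is twice the real part of the product of \<open>y\<close>
  with \<open>K y\<close>, which vanishes. So the norm of \<open>y\<close> is conserved; the
  spectral theorem is avoided.\<close>

lemma antiherm_skew:
  assumes K: "antiherm K"
  shows "skew K"
  unfolding skew_def
proof (intro allI norm_qfam_le opnorm_le)
  fix t :: real and S :: "site set" and v :: "cfg \<Rightarrow> complex"
  assume S: "finite S"
  define y where "y = (\<lambda>s. oapply S (ent (exp (s *\<^sub>R K)) S) v)"
  define y' where "y' = (\<lambda>s \<sigma>. \<Sum>\<tau>\<in>cfgs S. ent K S \<sigma> \<tau> * y s \<tau>)"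
  define N where "N = (\<lambda>s. \<Sum>\<sigma>\<in>cfgs S. inner (y s \<sigma>) (y s \<sigma>))"
  have y: "((\<lambda>s. y s \<sigma>) has_vector_derivative y' s \<sigma>) (at s)" for s \<sigma>
  proof -
    have "((\<lambda>s. y s \<sigma>) has_vector_derivative
        (\<Sum>\<tau>\<in>cfgs S. (\<Sum>\<rho>\<in>cfgs S. ent K S \<sigma> \<rho> * ent (exp (s *\<^sub>R K)) S \<rho> \<tau>) * v \<tau>)) (at s)"
      unfolding y_def oapply_def
      by (intro has_vector_derivative_sum has_vector_derivative_mult_left ent_exp_derivative)
    moreover have "(\<Sum>\<tau>\<in>cfgs S. (\<Sum>\<rho>\<in>cfgs S. ent K S \<sigma> \<rho> * ent (exp (s *\<^sub>R K)) S \<rho> \<tau>) * v \<tau>) = y' s \<sigma>"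
      unfolding y'_def y_def oapply_def sum_distrib_left sum_distrib_right mult.assoc by (rule sum.swap)
    ultimately show ?thesis by simp
  qed
  have "(N has_real_derivative 0) (at s)" for s
  proof -
    have "(N has_vector_derivative (\<Sum>\<sigma>\<in>cfgs S. inner (y s \<sigma>) (y' s \<sigma>) + inner (y' s \<sigma>) (y s \<sigma>))) (at s)"
      unfolding N_def
      by (intro has_vector_derivative_sum bounded_bilinear.has_vector_derivative[OF bounded_bilinear_inner] y)
    moreover have "(\<Sum>\<sigma>\<in>cfgs S. inner (y s \<sigma>) (y' s \<sigma>) + inner (y' s \<sigma>) (y s \<sigma>)) = 0"
    proof -
      \<comment> \<open>As \<open>inner\<close> on complex numbers is the real part of the Hermitian
        product, anti-Hermiticity makes \<open>f\<close> antisymmetric, and the double sum equals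
        its own negative.\<close>
      define f where "f = (\<lambda>\<sigma> \<tau>. inner (y s \<sigma>) (ent K S \<sigma> \<tau> * y s \<tau>))"
      have f: "f \<tau> \<sigma> = - f \<sigma> \<tau>" for \<sigma> \<tau>
        unfolding f_def by (subst antihermD[OF K]) (simp add: inner_complex_def algebra_simps)
      have eq: "(\<Sum>\<sigma>\<in>cfgs S. inner (y s \<sigma>) (y' s \<sigma>)) = (\<Sum>\<sigma>\<in>cfgs S. \<Sum>\<tau>\<in>cfgs S. f \<sigma> \<tau>)"
        unfolding y'_def f_def inner_sum_right ..
      have "(\<Sum>\<sigma>\<in>cfgs S. \<Sum>\<tau>\<in>cfgs S. f \<sigma> \<tau>) = (\<Sum>\<sigma>\<in>cfgs S. \<Sum>\<tau>\<in>cfgs S. f \<tau> \<sigma>)"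
        by (rule sum.swap)
      also have "\<dots> = - (\<Sum>\<sigma>\<in>cfgs S. \<Sum>\<tau>\<in>cfgs S. f \<sigma> \<tau>)"
        unfolding sum_negf[symmetric] by (intro sum.cong refl f)
      finally have "(\<Sum>\<sigma>\<in>cfgs S. inner (y s \<sigma>) (y' s \<sigma>)) = 0" unfolding eq by simp
      then show ?thesis by (simp add: sum.distrib inner_commute flip: sum_distrib_left)
    qed
    ultimately show ?thesis by (simp add: has_real_derivative_iff_has_vector_derivative)
  qed
  then have "N t = N 0" by (intro DERIV_isconst_all) auto
  moreover have "N s = (vnorm S (y s))\<^sup>2" for s
    unfolding N_def vnorm_def by (simp add: sum_nonneg power2_norm_eq_inner)
  moreover have "vnorm S (y 0) = vnorm S v"
  proof (rule vnorm_cong)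
    fix \<sigma> assume \<sigma>: "\<sigma> \<in> cfgs S"
    have "y 0 \<sigma> = (\<Sum>\<tau>\<in>cfgs S. if \<sigma> = \<tau> then v \<tau> else 0)"
      unfolding y_def oapply_def by (rule sum.cong) (auto simp: ent_one S \<sigma> idop_def)
    then show "y 0 \<sigma> = v \<sigma>" using \<sigma> S by (simp add: finite_cfgs)
  qed
  ultimately have "(vnorm S (y t))\<^sup>2 = (vnorm S v)\<^sup>2" by simp
  then have "vnorm S (y t) = vnorm S v" by (rule power2_eq_imp_eq) (rule vnorm_nonneg)+
  then show "vnorm S (oapply S (ent (exp (t *\<^sub>R K)) S) v) \<le> 1 * vnorm S v"
    unfolding y_def by simp
qed

lemma antiherm_emb:
  assumes "hermitian_op S H"
  shows "antiherm (emb S (oscale \<i> H))"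
  unfolding antiherm_def
proof (intro allI)
  fix T \<sigma> \<tau>
  show "ent (emb S (oscale \<i> H)) T \<sigma> \<tau> = - cnj (ent (emb S (oscale \<i> H)) T \<tau> \<sigma>)"
  proof (cases "T = S \<and> finite S \<and> \<sigma> \<in> cfgs S \<and> \<tau> \<in> cfgs S")
    case True
    then have h: "H \<sigma> \<tau> = cnj (H \<tau> \<sigma>)" using assms unfolding hermitian_op_def by blast
    have "\<i> * H \<sigma> \<tau> = - cnj (\<i> * H \<tau> \<sigma>)" unfolding h by simp
    then show ?thesis using True by (simp add: ent_emb oscale_def)
  qed (auto simp: ent_emb)
qed

lemma antiherm_scaleR:
  assumes "antiherm A"
  shows "antiherm (c *\<^sub>R A)"
  unfolding antiherm_def ent_simps
proof (intro allI)
  fix S \<sigma> \<tau>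
  note h = antihermD[OF assms, of S \<sigma> \<tau>]
  show "complex_of_real c * ent A S \<sigma> \<tau> = - cnj (complex_of_real c * ent A S \<tau> \<sigma>)"
    unfolding h by simp
qed

lemma antiherm_sum:
  assumes "\<And>i. i \<in> I \<Longrightarrow> antiherm (A i)"
  shows "antiherm (sum A I)"
  unfolding antiherm_def ent_sum cnj_sum sum_negf[symmetric]
  by (intro allI sum.cong refl antihermD assms)

section \<open>Operators with disjoint supports commute\<close>

lemma omul_disjoint_support:
  assumes S: "finite S" and disj: "X \<inter> Y = {}" and \<sigma>: "\<sigma> \<in> cfgs S" and \<tau>: "\<tau> \<in> cfgs S"
    and A: "\<And>\<sigma> \<tau>. \<sigma> \<in> cfgs S \<Longrightarrow> \<tau> \<in> cfgs S \<Longrightarrow>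
      A \<sigma> \<tau> = (if \<forall>x\<in>S - X. \<sigma> x = \<tau> x then A' (restr X \<sigma>) (restr X \<tau>) else 0)"
    and B: "\<And>\<sigma> \<tau>. \<sigma> \<in> cfgs S \<Longrightarrow> \<tau> \<in> cfgs S \<Longrightarrow>
      B \<sigma> \<tau> = (if \<forall>x\<in>S - Y. \<sigma> x = \<tau> x then B' (restr Y \<sigma>) (restr Y \<tau>) else 0)"
  shows "omul S A B \<sigma> \<tau> = (if \<forall>x\<in>S - (X \<union> Y). \<sigma> x = \<tau> x
    then A' (restr X \<sigma>) (restr X \<tau>) * B' (restr Y \<sigma>) (restr Y \<tau>) else 0)"
proof -
  \<comment> \<open>The only intermediate configuration that contributes: \<open>A\<close> changes
    sites of \<open>X\<close> only, so it agrees with \<open>\<sigma>\<close> off \<open>X\<close>;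
    \<open>B\<close> changes sites of \<open>Y\<close> only, so it agrees with \<open>\<tau>\<close>
    off \<open>Y\<close> and in particular on \<open>X\<close>.\<close>
  define \<kappa> where "\<kappa> = (\<lambda>x. if x \<in> X then \<tau> x else \<sigma> x)"
  have \<kappa>: "\<kappa> \<in> cfgs S" using \<sigma> \<tau> by (auto simp: \<kappa>_def cfgs_def)
  have zero: "A \<sigma> \<rho> * B \<rho> \<tau> = 0" if \<rho>: "\<rho> \<in> cfgs S - {\<kappa>}" for \<rho>
  proof (rule ccontr)
    assume nz: "A \<sigma> \<rho> * B \<rho> \<tau> \<noteq> 0"
    then have 1: "\<forall>x\<in>S - X. \<sigma> x = \<rho> x" using A[OF \<sigma>, of \<rho>] \<rho> by (auto split: if_splits)
    from nz have 2: "\<forall>x\<in>S - Y. \<rho> x = \<tau> x" using B[OF _ \<tau>, of \<rho>] \<rho> by (auto split: if_splits)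
    have "\<rho> x = \<kappa> x" for x
    proof (cases "x \<in> S")
      case True
      then show ?thesis using 1 2 disj by (auto simp: \<kappa>_def)
    next
      case False
      then show ?thesis using \<rho> \<kappa> by (simp add: cfgs_def)
    qed
    then show False using \<rho> by auto
  qed
  have "omul S A B \<sigma> \<tau> = (\<Sum>\<rho>\<in>{\<kappa>}. A \<sigma> \<rho> * B \<rho> \<tau>)"
    unfolding omul_def by (rule sum.mono_neutral_right) (use zero \<kappa> S in \<open>auto simp: finite_cfgs\<close>)
  also have "\<dots> = A \<sigma> \<kappa> * B \<kappa> \<tau>" by simp
  also have "A \<sigma> \<kappa> = A' (restr X \<sigma>) (restr X \<tau>)"
  proof -
    have "restr X \<kappa> = restr X \<tau>" by (auto simp: restr_def \<kappa>_def)
    then show ?thesis using A[OF \<sigma> \<kappa>] by (auto simp: \<kappa>_def)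
  qed
  also have "B \<kappa> \<tau> = (if \<forall>x\<in>S - (X \<union> Y). \<sigma> x = \<tau> x then B' (restr Y \<sigma>) (restr Y \<tau>) else 0)"
  proof -
    have "restr Y \<kappa> = restr Y \<sigma>" using disj by (auto simp: restr_def \<kappa>_def)
    moreover have "(\<forall>x\<in>S - Y. \<kappa> x = \<tau> x) \<longleftrightarrow> (\<forall>x\<in>S - (X \<union> Y). \<sigma> x = \<tau> x)"
      by (auto simp: \<kappa>_def)
    ultimately show ?thesis using B[OF \<kappa> \<tau>] by simp
  qed
  finally show ?thesis by simp
qed

text \<open>The entry formula for a product of operators with disjoint supports is symmetric in the
  two factors.\<close>

lemma emb_commute_disjoint:
  assumes "finite S" "supported_on S X A" "supported_on S Y B" "X \<inter> Y = {}"
  shows "emb S A * emb S B = emb S B * emb S A"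
  unfolding emb_omul
proof (rule emb_cong)
  fix \<sigma> \<tau> assume \<sigma>\<tau>: "\<sigma> \<in> cfgs S" "\<tau> \<in> cfgs S"
  obtain A' B' where A: "\<And>\<sigma> \<tau>. \<sigma> \<in> cfgs S \<Longrightarrow> \<tau> \<in> cfgs S \<Longrightarrow>
      A \<sigma> \<tau> = (if \<forall>x\<in>S - X. \<sigma> x = \<tau> x then A' (restr X \<sigma>) (restr X \<tau>) else 0)"
    and B: "\<And>\<sigma> \<tau>. \<sigma> \<in> cfgs S \<Longrightarrow> \<tau> \<in> cfgs S \<Longrightarrow>
      B \<sigma> \<tau> = (if \<forall>x\<in>S - Y. \<sigma> x = \<tau> x then B' (restr Y \<sigma>) (restr Y \<tau>) else 0)"
    using assms(2,3) unfolding supported_on_def by blast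
  have "omul S A B \<sigma> \<tau> = (if \<forall>x\<in>S - (X \<union> Y). \<sigma> x = \<tau> x
    then A' (restr X \<sigma>) (restr X \<tau>) * B' (restr Y \<sigma>) (restr Y \<tau>) else 0)"
    by (rule omul_disjoint_support[OF assms(1) assms(4) \<sigma>\<tau> A B])
  moreover have "omul S B A \<sigma> \<tau> = (if \<forall>x\<in>S - (Y \<union> X). \<sigma> x = \<tau> x
    then B' (restr Y \<sigma>) (restr Y \<tau>) * A' (restr X \<sigma>) (restr X \<tau>) else 0)"
    by (rule omul_disjoint_support[OF assms(1) _ \<sigma>\<tau> B A]) (use assms(4) in auto)
  ultimately show "omul S A B \<sigma> \<tau> = omul S B A \<sigma> \<tau>"
    by (simp add: Un_commute mult.commute)
qed

lemma supported_on_scale: "supported_on S X A \<Longrightarrow> supported_on S X (oscale c A)"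
proof -
  assume "supported_on S X A"
  then obtain B where B: "\<And>\<sigma> \<tau>. \<sigma> \<in> cfgs S \<Longrightarrow> \<tau> \<in> cfgs S \<Longrightarrow>
      A \<sigma> \<tau> = (if \<forall>x\<in>S - X. \<sigma> x = \<tau> x then B (restr X \<sigma>) (restr X \<tau>) else 0)"
    unfolding supported_on_def by blast
  show "supported_on S X (oscale c A)"
    unfolding supported_on_def
    by (rule exI[of _ "\<lambda>\<sigma> \<tau>. c * B \<sigma> \<tau>"]) (simp add: oscale_def B)
qed

section \<open>Density matrices as contractive functionals\<close>

definition psd_on :: "'i set \<Rightarrow> ('i \<Rightarrow> 'i \<Rightarrow> complex) \<Rightarrow> bool" where
  "psd_on I \<rho> \<longleftrightarrow> (\<forall>i\<in>I. \<forall>j\<in>I. \<rho> i j = cnj (\<rho> j i)) \<and>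
    (\<forall>v. 0 \<le> Re (\<Sum>i\<in>I. \<Sum>j\<in>I. cnj (v i) * \<rho> i j * v j))"

text \<open>The quadratic form at \<open>v\<close> with its entry at \<open>e\<close> replaced by
  \<open>z\<close>. As \<open>z\<close> is free, it can be chosen to complete the square. The index
  set is general because elimination of an index leaves sets that are not of the form
  \<open>cfgs S\<close>.\<close>

lemma psd_on_insert_form:
  assumes "finite I" "e \<notin> I" and psd: "psd_on (insert e I) \<rho>"
  shows "0 \<le> Re (\<Sum>i\<in>I. \<Sum>j\<in>I. cnj (v i) * \<rho> i j * v j)
    + 2 * Re (cnj z * (\<Sum>j\<in>I. \<rho> e j * v j)) + Re (\<rho> e e) * (cmod z)\<^sup>2"
proof -
  let ?w = "v(e := z)"
  have h: "\<rho> i e = cnj (\<rho> e i)" if "i \<in> I" for i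
    using psd that unfolding psd_on_def by blast
  have neq: "i \<noteq> e" if "i \<in> I" for i using that assms by auto
  have in1: "(\<Sum>j\<in>I. cnj (?w i) * \<rho> i j * ?w j) = cnj (?w i) * (\<Sum>j\<in>I. \<rho> i j * v j)" for i
    unfolding sum_distrib_left by (rule sum.cong) (auto simp: neq)
  have "(\<Sum>i\<in>insert e I. \<Sum>j\<in>insert e I. cnj (?w i) * \<rho> i j * ?w j)
    = cnj z * \<rho> e e * z + cnj z * (\<Sum>j\<in>I. \<rho> e j * v j)
      + (\<Sum>i\<in>I. cnj (v i) * \<rho> i e * z + cnj (v i) * (\<Sum>j\<in>I. \<rho> i j * v j))"
    using assms by (simp add: in1 neq sum_distrib_left mult.assoc cong: sum.cong)
  also have "(\<Sum>i\<in>I. cnj (v i) * \<rho> i e * z + cnj (v i) * (\<Sum>j\<in>I. \<rho> i j * v j))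
    = cnj (cnj z * (\<Sum>j\<in>I. \<rho> e j * v j)) + (\<Sum>i\<in>I. \<Sum>j\<in>I. cnj (v i) * \<rho> i j * v j)"
    by (simp add: sum.distrib sum_distrib_left h mult_ac cong: sum.cong)
  finally have eq: "(\<Sum>i\<in>insert e I. \<Sum>j\<in>insert e I. cnj (?w i) * \<rho> i j * ?w j)
    = cnj z * \<rho> e e * z + cnj z * (\<Sum>j\<in>I. \<rho> e j * v j)
      + (cnj (cnj z * (\<Sum>j\<in>I. \<rho> e j * v j)) + (\<Sum>i\<in>I. \<Sum>j\<in>I. cnj (v i) * \<rho> i j * v j))" .
  have "Re (cnj z * \<rho> e e * z) = Re (\<rho> e e) * (cmod z)\<^sup>2"
    unfolding cmod_power2 by (simp add: power2_eq_square algebra_simps)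
  moreover have "0 \<le> Re (\<Sum>i\<in>insert e I. \<Sum>j\<in>insert e I. cnj (?w i) * \<rho> i j * ?w j)"
    using psd unfolding psd_on_def by blast
  moreover have re: "Re (a + b + (cnj b + c)) = Re a + 2 * Re b + Re c" for a b c by simp
  ultimately show ?thesis unfolding eq re by linarith
qed

text \<open>Cholesky factorisation, by eliminating one index at a time.\<close>

lemma psd_on_factor:
  assumes "finite I" "psd_on I \<rho>"
  shows "\<exists>w :: 'i \<Rightarrow> 'i \<Rightarrow> complex. \<forall>i\<in>I. \<forall>j\<in>I. \<rho> i j = (\<Sum>k\<in>I. w k i * cnj (w k j))"
  using assms
proof (induction I arbitrary: \<rho> rule: finite_induct)
  case (insert e I)
  note form = psd_on_insert_form[OF insert.hyps insert.prems]
  have herm: "\<rho> i j = cnj (\<rho> j i)" if "i \<in> insert e I" "j \<in> insert e I" for i j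
    using insert.prems that unfolding psd_on_def by blast
  define r where "r = Re (\<rho> e e)"
  have \<rho>ee: "\<rho> e e = of_real r"
    using herm[of e e] by (simp add: r_def complex_eq_iff)
  have r0: "0 \<le> r" using form[of "\<lambda>_. 0" 1] by (simp add: r_def)
  \<comment> \<open>The column of the pivot \<open>e\<close>, scaled as in a Cholesky step. For a
    vanishing pivot, division by zero makes it the zero vector, which is right because the column is
    then zero.\<close>
  define u where "u = (\<lambda>i. \<rho> i e / of_real (sqrt r))"
  have ue: "u i * cnj (u e) = \<rho> i e" if i: "i \<in> insert e I" for i
  proof (cases "r = 0")
    case False
    then have "complex_of_real (sqrt r) * of_real (sqrt r) = of_real r"
      using r0 by (simp flip: of_real_mult)
    then show ?thesis using False r0 by (simp add: u_def \<rho>ee divide_simps)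
  next
    case True
    have "\<rho> i e = 0"
    proof (cases "i = e")
      case False
      then have iI: "i \<in> I" using i by simp
      \<comment> \<open>With zero pivot, the form at the unit vector at \<open>i\<close> and
        \<open>z = - n * \<rho> e i\<close> is affine in \<open>n\<close>. It can be nonnegative for
        all real \<open>n\<close> only if \<open>\<rho> e i\<close> is zero.\<close>
      have "0 \<le> Re (\<rho> i i) - 2 * n * (cmod (\<rho> e i))\<^sup>2" for n :: real
      proof -
        have s: "(\<Sum>j\<in>I. f j * (if j = i then 1 else 0)) = f i" for f :: "'i \<Rightarrow> complex"
          using iI insert.hyps by (simp add: if_distrib cong: if_cong)
        have s2: "(\<Sum>j\<in>I. cnj (if j = i then 1 else 0) * f j) = f i" for f :: "'i \<Rightarrow> complex"
        proof -
          have "(\<Sum>j\<in>I. cnj (if j = i then 1 else 0) * f j) = (\<Sum>j\<in>I. f j * (if j = i then 1 else 0))"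
            by (rule sum.cong) auto
          then show ?thesis unfolding s .
        qed
        have "(\<Sum>k\<in>I. \<Sum>j\<in>I. cnj (if k = i then 1 else 0) * \<rho> k j * (if j = i then 1 else 0)) = \<rho> i i"
          unfolding s unfolding s2 ..
        then have "0 \<le> Re (\<rho> i i) + 2 * Re (cnj (- of_real n * \<rho> e i) * \<rho> e i)"
          using form[of "\<lambda>j. if j = i then 1 else 0" "- of_real n * \<rho> e i"] True by (simp add: s r_def)
        then show ?thesis unfolding cmod_power2 by (simp add: power2_eq_square algebra_simps)
      qed
      then have le: "2 * n * (cmod (\<rho> e i))\<^sup>2 \<le> Re (\<rho> i i)" for n :: real by (metis diff_ge_0_iff_ge)
      have "cmod (\<rho> e i) = 0"
      proof (rule ccontr)
        assume "cmod (\<rho> e i) \<noteq> 0"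
        then have "2 * ((Re (\<rho> i i) + 1) / (2 * (cmod (\<rho> e i))\<^sup>2)) * (cmod (\<rho> e i))\<^sup>2 = Re (\<rho> i i) + 1"
          by simp
        then show False using le[of "(Re (\<rho> i i) + 1) / (2 * (cmod (\<rho> e i))\<^sup>2)"] by linarith
      qed
      then show ?thesis using herm[of i e] iI by simp
    qed (simp add: \<rho>ee True)
    then show ?thesis by (simp add: u_def)
  qed
  \<comment> \<open>The Schur complement of the pivot; it has to be shown positive again for the
    induction.\<close>
  define \<rho>' where "\<rho>' = (\<lambda>i j. \<rho> i j - u i * cnj (u j))"
  have "psd_on I \<rho>'"
    unfolding psd_on_def
  proof (intro conjI ballI allI)
    fix i j assume ij: "i \<in> I" "j \<in> I"
    show "\<rho>' i j = cnj (\<rho>' j i)"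
      unfolding \<rho>'_def using herm[of i j] ij by simp
  next
    fix v
    define b where "b = (\<Sum>j\<in>I. \<rho> e j * v j)"
    have cb: "(\<Sum>j\<in>I. cnj (u j) * v j) = b / of_real (sqrt r)"
      unfolding b_def sum_divide_distrib u_def by (rule sum.cong) (use herm[of _ e] in \<open>auto simp: herm[of e]\<close>)
    have "(\<Sum>i\<in>I. \<Sum>j\<in>I. cnj (v i) * \<rho>' i j * v j)
      = (\<Sum>i\<in>I. \<Sum>j\<in>I. cnj (v i) * \<rho> i j * v j) - cnj (\<Sum>j\<in>I. cnj (u j) * v j) * (\<Sum>j\<in>I. cnj (u j) * v j)"
      unfolding \<rho>'_def cnj_sum sum_product
      by (simp add: sum_subtractf algebra_simps)
    also have "cnj (\<Sum>j\<in>I. cnj (u j) * v j) * (\<Sum>j\<in>I. cnj (u j) * v j) = of_real ((cmod b)\<^sup>2 / r)"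
    proof -
      have "cnj (b / of_real (sqrt r)) * (b / of_real (sqrt r)) = of_real ((cmod (b / of_real (sqrt r)))\<^sup>2)"
        unfolding complex_norm_square by (rule mult.commute)
      also have "(cmod (b / of_real (sqrt r)))\<^sup>2 = (cmod b)\<^sup>2 / r"
        using r0 by (simp add: norm_divide power_divide)
      finally show ?thesis unfolding cb .
    qed
    finally have 1: "Re (\<Sum>i\<in>I. \<Sum>j\<in>I. cnj (v i) * \<rho>' i j * v j)
      = Re (\<Sum>i\<in>I. \<Sum>j\<in>I. cnj (v i) * \<rho> i j * v j) - (cmod b)\<^sup>2 / r" by simp
    \<comment> \<open>For \<open>r > 0\<close> the value \<open>z = - b / r\<close> minimises the
      form over the entry at \<open>e\<close>. For \<open>r = 0\<close> it is \<open>0\<close>, and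
      so is \<open>(cmod b)\<^sup>2 / r\<close>, so both cases are covered.\<close>
    have "Re (cnj (- b / of_real r) * b) = - (cmod b)\<^sup>2 / r"
    proof -
      have "cnj (- b / of_real r) * b = - (b * cnj b) / of_real r" by simp
      also have "\<dots> = of_real (- (cmod b)\<^sup>2 / r)" unfolding complex_norm_square[symmetric] by simp
      finally show ?thesis by (simp only: Re_complex_of_real)
    qed
    moreover have "r * (cmod (- b / of_real r))\<^sup>2 = (cmod b)\<^sup>2 / r"
      using r0 by (cases "r = 0") (simp_all add: norm_divide power_divide power2_eq_square)
    ultimately have "0 \<le> Re (\<Sum>i\<in>I. \<Sum>j\<in>I. cnj (v i) * \<rho> i j * v j) - (cmod b)\<^sup>2 / r"
      using form[of v "- b / of_real r"] unfolding b_def[symmetric] r_def[symmetric] by linarith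
    then show "0 \<le> Re (\<Sum>i\<in>I. \<Sum>j\<in>I. cnj (v i) * \<rho>' i j * v j)" unfolding 1 .
  qed
  then obtain w where w: "\<And>i j. i \<in> I \<Longrightarrow> j \<in> I \<Longrightarrow> \<rho>' i j = (\<Sum>k\<in>I. w k i * cnj (w k j))"
    using insert.IH by blast
  \<comment> \<open>The factor vectors of the complement are padded by \<open>0\<close> at
    \<open>e\<close>, and \<open>u\<close> is added under the index \<open>e\<close>.\<close>
  define W where "W = (\<lambda>k i. if k = e then u i else if i = e then 0 else w k i)"
  have "\<rho> i j = (\<Sum>k\<in>insert e I. W k i * cnj (W k j))" if ij: "i \<in> insert e I" "j \<in> insert e I" for i j
  proof -
    have "(\<Sum>k\<in>insert e I. W k i * cnj (W k j)) = u i * cnj (u j) + (\<Sum>k\<in>I. W k i * cnj (W k j))"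
      using insert.hyps by (simp add: W_def)
    also have "(\<Sum>k\<in>I. W k i * cnj (W k j)) = (if i = e \<or> j = e then 0 else \<rho>' i j)"
    proof (cases "i = e \<or> j = e")
      case True
      then show ?thesis using insert.hyps by (auto simp: W_def intro!: sum.neutral)
    next
      case False
      then have "(\<Sum>k\<in>I. W k i * cnj (W k j)) = (\<Sum>k\<in>I. w k i * cnj (w k j))"
        using insert.hyps by (intro sum.cong) (auto simp: W_def)
      then show ?thesis using False w[of i j] ij by simp
    qed
    finally show ?thesis
      using ue[OF ij(1)] ue[OF ij(2)] herm[OF ij] unfolding \<rho>'_def
      by (auto simp: mult.commute) (metis complex_cnj_cnj complex_cnj_mult mult.commute)
  qed
  then show ?case by blast
qed simp

text \<open>Writing \<open>\<rho>\<close> as a sum of rank-one matrices turns the trace into a sum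
  of quadratic forms of \<open>A\<close> at the vectors \<open>w k\<close>. Cauchy-Schwarz bounds
  each by \<open>opnorm S A\<close> times a squared norm, and these squared norms add up to the
  trace of \<open>\<rho>\<close>.\<close>

lemma density_matrix_trace_le:
  assumes S: "finite S" and \<rho>: "density_matrix S \<rho>"
  shows "cmod (otrace S (omul S \<rho> A)) \<le> opnorm S A"
proof -
  have "psd_on (cfgs S) \<rho>"
    using \<rho> unfolding density_matrix_def psd_on_def hermitian_op_def by blast
  then obtain w where w: "\<And>\<sigma> \<tau>. \<sigma> \<in> cfgs S \<Longrightarrow> \<tau> \<in> cfgs S \<Longrightarrow>
      \<rho> \<sigma> \<tau> = (\<Sum>k\<in>cfgs S. w k \<sigma> * cnj (w k \<tau>))"
    using psd_on_factor[OF finite_cfgs[OF S]] by blast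
  have "otrace S (omul S \<rho> A)
      = (\<Sum>\<sigma>\<in>cfgs S. \<Sum>\<tau>\<in>cfgs S. \<Sum>k\<in>cfgs S. cnj (w k \<tau>) * (A \<tau> \<sigma> * w k \<sigma>))"
    unfolding otrace_def omul_def
    by (intro sum.cong refl) (simp add: w sum_distrib_left sum_distrib_right mult_ac)
  also have "\<dots> = (\<Sum>\<tau>\<in>cfgs S. \<Sum>k\<in>cfgs S. \<Sum>\<sigma>\<in>cfgs S. cnj (w k \<tau>) * (A \<tau> \<sigma> * w k \<sigma>))"
    by (subst sum.swap) (intro sum.cong refl sum.swap)
  also have "\<dots> = (\<Sum>k\<in>cfgs S. \<Sum>\<tau>\<in>cfgs S. cnj (w k \<tau>) * oapply S A (w k) \<tau>)"
    by (subst sum.swap) (simp add: oapply_def sum_distrib_left)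
  finally have eq: "otrace S (omul S \<rho> A) = (\<Sum>k\<in>cfgs S. \<Sum>\<tau>\<in>cfgs S. cnj (w k \<tau>) * oapply S A (w k) \<tau>)" .
  have "cmod (otrace S (omul S \<rho> A)) \<le> (\<Sum>k\<in>cfgs S. opnorm S A * (vnorm S (w k))\<^sup>2)"
    unfolding eq
  proof (rule order_trans[OF norm_sum sum_mono])
    fix k
    have "cmod (\<Sum>\<tau>\<in>cfgs S. cnj (w k \<tau>) * oapply S A (w k) \<tau>)
        \<le> (\<Sum>\<tau>\<in>cfgs S. \<bar>cmod (w k \<tau>)\<bar> * \<bar>cmod (oapply S A (w k) \<tau>)\<bar>)"
      by (rule order_trans[OF norm_sum]) (simp add: norm_mult)
    also have "\<dots> \<le> vnorm S (w k) * vnorm S (oapply S A (w k))"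
      unfolding vnorm_L2_set by (rule L2_set_mult_ineq)
    also have "\<dots> \<le> vnorm S (w k) * (opnorm S A * vnorm S (w k))"
      by (intro mult_left_mono vnorm_oapply_le vnorm_nonneg S)
    finally show "cmod (\<Sum>\<tau>\<in>cfgs S. cnj (w k \<tau>) * oapply S A (w k) \<tau>) \<le> opnorm S A * (vnorm S (w k))\<^sup>2"
      by (simp add: power2_eq_square mult_ac)
  qed
  also have "\<dots> = opnorm S A * (\<Sum>k\<in>cfgs S. (vnorm S (w k))\<^sup>2)" by (simp add: sum_distrib_left)
  also have "(\<Sum>k\<in>cfgs S. (vnorm S (w k))\<^sup>2) = 1"
  proof -
    have "complex_of_real (\<Sum>k\<in>cfgs S. (vnorm S (w k))\<^sup>2)
        = (\<Sum>k\<in>cfgs S. \<Sum>\<sigma>\<in>cfgs S. w k \<sigma> * cnj (w k \<sigma>))"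
      unfolding vnorm_def by (simp add: sum_nonneg flip: complex_norm_square)
    also have "\<dots> = (\<Sum>\<sigma>\<in>cfgs S. \<rho> \<sigma> \<sigma>)"
      by (subst sum.swap) (simp add: w)
    also have "\<dots> = 1" using \<rho> by (simp add: density_matrix_def otrace_def)
    finally show ?thesis by (metis of_real_eq_1_iff)
  qed
  finally show ?thesis by simp
qed

section \<open>Concentration for deformed Gaussian variables\<close>

lemma prob_space_std_normal: "prob_space std_normal_measure"
  unfolding std_normal_measure_def by (rule prob_space_normal_density) simp

lemma sets_std_normal [measurable_cong]: "sets std_normal_measure = sets borel"
  and space_std_normal [simp]: "space std_normal_measure = UNIV"
  by (simp_all add: std_normal_measure_def)

lemma prob_space_gauss_prod: "prob_space (gauss_prod M)"
  unfolding gauss_prod_def by (intro prob_space_PiM prob_space_std_normal)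

lemma nn_integral_std_normal_exp:
  "(\<integral>\<^sup>+x. ennreal (exp (c * x)) \<partial>std_normal_measure) = ennreal (exp (c\<^sup>2 / 2))"
proof -
  have "(\<integral>\<^sup>+x. ennreal (exp (c * x)) \<partial>std_normal_measure)
      = (\<integral>\<^sup>+x. ennreal (std_normal_density x) * ennreal (exp (c * x)) \<partial>lborel)"
    unfolding std_normal_measure_def by (subst nn_integral_density) auto
  also have "\<dots> = (\<integral>\<^sup>+x. ennreal (exp (c\<^sup>2 / 2)) * ennreal (normal_density c 1 x) \<partial>lborel)"
  proof (intro nn_integral_cong)
    fix x
    have "- x\<^sup>2 / 2 + c * x = c\<^sup>2 / 2 + - (x - c)\<^sup>2 / 2" by (simp add: power2_eq_square field_simps)
    then have "exp (- x\<^sup>2 / 2) * exp (c * x) = exp (c\<^sup>2 / 2) * exp (- (x - c)\<^sup>2 / 2)"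
      unfolding exp_add[symmetric] by simp
    then show "ennreal (std_normal_density x) * ennreal (exp (c * x))
        = ennreal (exp (c\<^sup>2 / 2)) * ennreal (normal_density c 1 x)"
      by (simp add: std_normal_density_def normal_density_def flip: ennreal_mult)
  qed
  also have "\<dots> = ennreal (exp (c\<^sup>2 / 2)) * (\<integral>\<^sup>+x. ennreal (normal_density c 1 x) \<partial>lborel)"
    by (rule nn_integral_cmult) simp
  also have "(\<integral>\<^sup>+x. ennreal (normal_density c 1 x) \<partial>lborel) = 1"
    by (subst nn_integral_eq_integral) simp_all
  finally show ?thesis by simp
qed

text \<open>Symmetrisation: with an independent copy \<open>y\<close> of \<open>x\<close>, Jensen's inequality bounds the moment
  generating function of \<open>h - E h\<close> by that of \<open>h x - h y\<close>, which is even and hence dominated by the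
  one of \<open>b (x - y)\<close>.\<close>

lemma std_normal_mgf_lipschitz:
  assumes lip: "\<And>x y. \<bar>h x - h y\<bar> \<le> b * \<bar>x - y\<bar>" and b: "0 \<le> b"
    and bdd: "\<And>x. \<bar>h x\<bar> \<le> B"
    and bias: "\<bar>integral\<^sup>L std_normal_measure h - h0\<bar> \<le> \<beta>"
  shows "(\<integral>\<^sup>+x. ennreal (exp (l * (h x - h0))) \<partial>std_normal_measure)
    \<le> ennreal (exp (l\<^sup>2 * b\<^sup>2 + \<bar>l\<bar> * \<beta>))"
proof -
  let ?N = std_normal_measure
  interpret prob_space ?N by (rule prob_space_std_normal)
  have "continuous_on UNIV h"
    by (rule lipschitz_on_continuous_on[of b]) (use lip b in \<open>auto simp: lipschitz_on_def dist_real_def\<close>)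
  then have h [measurable]: "h \<in> borel_measurable borel"
    by (rule borel_measurable_continuous_onI)
  define m where "m = integral\<^sup>L ?N h"
  have ih: "integrable ?N h"
    by (rule integrable_const_bound[where B = B]) (use bdd in auto)
  have ie: "integrable ?N (\<lambda>y. exp (- l * h y))"
  proof (rule integrable_const_bound[where B = "exp (\<bar>l\<bar> * B)"])
    have "- l * h y \<le> \<bar>l\<bar> * B" for y
    proof -
      have "- l * h y \<le> \<bar>l\<bar> * \<bar>h y\<bar>" using abs_ge_self[of "- l * h y"] by (simp add: abs_mult)
      also have "\<dots> \<le> \<bar>l\<bar> * B" using bdd by (intro mult_left_mono) auto
      finally show ?thesis .
    qed
    then show "AE x in ?N. norm (exp (- l * h x)) \<le> exp (\<bar>l\<bar> * B)" by simp
  qed simp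
  define G where "G = (\<lambda>c h. \<integral>\<^sup>+x. ennreal (exp (c * (h x :: real))) \<partial>?N)"
  have jensen: "ennreal (exp (- l * m)) \<le> G (- l) h"
  proof -
    have "exp (- l * m) = (\<integral>y. exp (- l * m) * (1 + (- l * (h y - m))) \<partial>?N)"
      using ih prob_space by (simp add: m_def)
    also have "\<dots> \<le> (\<integral>y. exp (- l * h y) \<partial>?N)"
    proof (rule integral_mono)
      fix y
      have "exp (- l * m) * (1 + (- l * (h y - m))) \<le> exp (- l * m) * exp (- l * (h y - m))"
        by (intro mult_left_mono exp_ge_add_one_self) simp
      also have "\<dots> = exp (- l * h y)" by (simp add: algebra_simps flip: exp_add)
      finally show "exp (- l * m) * (1 + (- l * (h y - m))) \<le> exp (- l * h y)" .
    qed (use ih ie in auto)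
    finally show ?thesis
      unfolding G_def by (subst nn_integral_eq_integral[OF ie]) (auto intro: ennreal_leI)
  qed
  \<comment> \<open>With both signs added, the integrand is twice a hyperbolic cosine, so that the
    comparison of \<open>h\<close> with the linear function can be made pointwise. The identity is
    used for both functions.\<close>
  have dbl: "(\<integral>\<^sup>+x. \<integral>\<^sup>+y. (ennreal (exp (c * (k x - k y))) + ennreal (exp (- c * (k x - k y)))) \<partial>?N \<partial>?N)
      = 2 * (G c k * G (- c) k)" if [measurable]: "k \<in> borel_measurable borel" for c and k :: "real \<Rightarrow> real"
  proof -
    have "(\<integral>\<^sup>+x. \<integral>\<^sup>+y. (ennreal (exp (c * (k x - k y))) + ennreal (exp (- c * (k x - k y)))) \<partial>?N \<partial>?N)
      = (\<integral>\<^sup>+x. \<integral>\<^sup>+y. (ennreal (exp (c * k x)) * ennreal (exp (- c * k y))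
          + ennreal (exp (- c * k x)) * ennreal (exp (c * k y))) \<partial>?N \<partial>?N)"
      by (simp add: algebra_simps flip: ennreal_mult exp_add)
    also have "\<dots> = (\<integral>\<^sup>+x. (ennreal (exp (c * k x)) * G (- c) k + ennreal (exp (- c * k x)) * G c k) \<partial>?N)"
      unfolding G_def by (simp add: nn_integral_add nn_integral_cmult)
    also have "\<dots> = G c k * G (- c) k + G (- c) k * G c k"
      by (subst nn_integral_add) (auto simp: nn_integral_multc G_def)
    finally show ?thesis by (simp add: mult.commute mult_2)
  qed
  have "2 * (G l h * G (- l) h) \<le> 2 * (G (l * b) (\<lambda>x. x) * G (- (l * b)) (\<lambda>x. x))"
    unfolding dbl[OF h, symmetric] dbl[of "\<lambda>x. x", OF measurable_ident_sets[OF refl], symmetric]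
  proof (intro nn_integral_mono)
    fix x y
    have cosh: "exp u + exp (- u) \<le> exp v + exp (- v)" if "\<bar>u\<bar> \<le> \<bar>v\<bar>" for u v :: real
    proof -
      have "exp \<bar>w\<bar> + exp (- \<bar>w\<bar>) = exp w + exp (- w)" for w :: real
        by (cases "0 \<le> w") auto
      moreover have "exp \<bar>u\<bar> + exp (- \<bar>u\<bar>) \<le> exp \<bar>v\<bar> + exp (- \<bar>v\<bar>)"
        using cosh_real_nonneg_le_iff[of "\<bar>u\<bar>" "\<bar>v\<bar>"] that by (simp add: cosh_def)
      ultimately show ?thesis by metis
    qed
    have "\<bar>l * (h x - h y)\<bar> \<le> \<bar>l * b * (x - y)\<bar>"
      using lip[of x y] b by (simp add: abs_mult mult_left_mono mult.assoc)
    from cosh[OF this]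
    show "ennreal (exp (l * (h x - h y))) + ennreal (exp (- l * (h x - h y)))
      \<le> ennreal (exp (l * b * (x - y))) + ennreal (exp (- (l * b) * (x - y)))"
      by (simp flip: ennreal_plus)
  qed
  \<comment> \<open>Each of the two independent copies contributes
    \<open>exp (l\<^sup>2 * b\<^sup>2 / 2)\<close>; symmetrisation thus costs a factor 2 in the
    exponent, which only affects constants.\<close>
  also have "G (l * b) (\<lambda>x. x) * G (- (l * b)) (\<lambda>x. x) = ennreal (exp (l\<^sup>2 * b\<^sup>2))"
    unfolding G_def nn_integral_std_normal_exp
    by (simp add: power_mult_distrib flip: ennreal_mult exp_add)
  finally have GG: "G l h * G (- l) h \<le> ennreal (exp (l\<^sup>2 * b\<^sup>2))"
    by (simp add: ennreal_mult_le_mult_iff)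
  have "(\<integral>\<^sup>+x. ennreal (exp (l * (h x - h0))) \<partial>?N)
      = (\<integral>\<^sup>+x. ennreal (exp (l * h x)) * ennreal (exp (- l * h0)) \<partial>?N)"
    by (simp add: algebra_simps flip: ennreal_mult exp_add)
  also have "\<dots> = G l h * ennreal (exp (- l * h0))"
    unfolding G_def by (rule nn_integral_multc) simp
  \<comment> \<open>The factor with the mean \<open>m\<close> is absorbed by Jensen's inequality,
    the other one by the bias bound.\<close>
  also have "exp (- l * h0) = exp (- l * m) * exp (l * (m - h0))"
    by (simp add: algebra_simps flip: exp_add)
  also have "G l h * ennreal (exp (- l * m) * exp (l * (m - h0)))
      \<le> G l h * (G (- l) h * ennreal (exp (\<bar>l\<bar> * \<beta>)))"
  proof -
    have "l * (m - h0) \<le> \<bar>l\<bar> * \<bar>m - h0\<bar>" using abs_ge_self[of "l * (m - h0)"] by (simp add: abs_mult)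
    also have "\<dots> \<le> \<bar>l\<bar> * \<beta>" using bias unfolding m_def by (intro mult_left_mono) auto
    finally show ?thesis
      using jensen by (subst ennreal_mult) (auto intro!: mult_mono ennreal_leI)
  qed
  also have "\<dots> = (G l h * G (- l) h) * ennreal (exp (\<bar>l\<bar> * \<beta>))"
    by (simp add: mult.assoc)
  also have "\<dots> \<le> ennreal (exp (l\<^sup>2 * b\<^sup>2)) * ennreal (exp (\<bar>l\<bar> * \<beta>))"
    by (rule mult_right_mono[OF GG]) simp
  also have "\<dots> = ennreal (exp (l\<^sup>2 * b\<^sup>2 + \<bar>l\<bar> * \<beta>))"
    by (simp add: exp_add ennreal_mult)
  finally show ?thesis .
qed

text \<open>A monotone function stays between its limits. This confines the couplings to a range
  fixed in advance, on which the Lieb-Robinson bound is uniform.\<close>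

lemma chi_deformed_bound:
  assumes "chi_deformed \<delta> \<Gamma> chi"
  shows "\<bar>chi x\<bar> \<le> \<Gamma>"
proof -
  have sm: "strict_mono chi" and top: "(chi \<longlongrightarrow> \<Gamma>) at_top" and bot: "(chi \<longlongrightarrow> - \<Gamma>) at_bot"
    using assms by (auto simp: chi_deformed_def)
  have "chi x \<le> \<Gamma>"
    by (rule tendsto_lowerbound[OF top])
      (use sm in \<open>auto simp: eventually_at_top_linorder strict_mono_less_eq intro!: exI[of _ x]\<close>)
  moreover have "- \<Gamma> \<le> chi x"
    by (rule tendsto_upperbound[OF bot])
      (use sm in \<open>auto simp: eventually_at_bot_linorder strict_mono_less_eq intro!: exI[of _ x]\<close>)
  ultimately show ?thesis by linarith
qed

lemma chi_deformed_lipschitz: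
  assumes "chi_deformed \<delta> \<Gamma> chi"
  shows "\<bar>chi x - chi y\<bar> \<le> \<delta> * \<bar>x - y\<bar>"
proof -
  have "norm (chi x - chi y) \<le> \<delta> * norm (x - y)"
  proof (rule field_differentiable_bound[of UNIV])
    show "(chi has_field_derivative deriv chi z) (at z within UNIV)" for z
      using assms by (auto simp: chi_deformed_def DERIV_deriv_iff_real_differentiable)
    show "norm (deriv chi z) \<le> \<delta>" for z
      using assms by (auto simp: chi_deformed_def)
  qed auto
  then show ?thesis by simp
qed

lemma chi_deformed_measurable:
  assumes "chi_deformed \<delta> \<Gamma> chi"
  shows "chi \<in> borel_measurable borel"
  using assms
  by (intro borel_measurable_continuous_onI continuous_at_imp_continuous_on)
    (auto simp: chi_deformed_def intro: differentiable_imp_continuous_within)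

lemma integral_std_normal_square: "integrable std_normal_measure (\<lambda>x. x\<^sup>2)"
    "(\<integral>x. x\<^sup>2 \<partial>std_normal_measure) = 1"
proof -
  show "integrable std_normal_measure (\<lambda>x. x\<^sup>2)"
    unfolding std_normal_measure_def
    by (subst integrable_density) (use integrable_std_normal_moment[of 2] in auto)
  show "(\<integral>x. x\<^sup>2 \<partial>std_normal_measure) = 1"
    unfolding std_normal_measure_def
    by (subst integral_density) (use integral_std_normal_moment_even[of 1] in auto)
qed

text \<open>Centredness of \<open>chi\<close> removes the linear term whatever \<open>D\<close> is,
  so the mean of \<open>H (chi x)\<close> differs from \<open>H 0\<close> by at most
  \<open>q\<close> times the second moment of \<open>chi\<close>, and
  \<open>\<bar>chi x\<bar> \<le> \<delta> * \<bar>x\<bar>\<close>. The reference value is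
  \<open>H 0\<close> and not the mean, so that successive steps telescope.\<close>

lemma chi_deformed_mgf:
  assumes chi: "chi_deformed \<delta> \<Gamma> chi" and \<Gamma>: "\<Gamma> \<le> \<Gamma>0"
    and p: "0 \<le> p" "\<And>y z. \<bar>y\<bar> \<le> \<Gamma>0 \<Longrightarrow> \<bar>z\<bar> \<le> \<Gamma>0 \<Longrightarrow> \<bar>H y - H z\<bar> \<le> p * \<bar>y - z\<bar>"
    and q: "0 \<le> q" "\<And>y. \<bar>y\<bar> \<le> \<Gamma>0 \<Longrightarrow> \<bar>H y - H 0 - y * D\<bar> \<le> q * y\<^sup>2"
  shows "(\<integral>\<^sup>+x. ennreal (exp (l * (H (chi x) - H 0))) \<partial>std_normal_measure)
    \<le> ennreal (exp (l\<^sup>2 * (p * \<delta>)\<^sup>2 + \<bar>l\<bar> * (q * \<delta>\<^sup>2)))"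
proof (rule std_normal_mgf_lipschitz[where B = "\<bar>H 0\<bar> + p * \<Gamma>0"])
  let ?N = std_normal_measure
  interpret prob_space ?N by (rule prob_space_std_normal)
  have bd: "\<bar>chi x\<bar> \<le> \<Gamma>0" for x using chi_deformed_bound[OF chi, of x] \<Gamma> by linarith
  have \<delta>: "0 \<le> \<delta>" using chi by (auto simp: chi_deformed_def intro: order_trans[OF abs_ge_zero])
  have c0: "chi 0 = 0" using chi by (simp add: chi_deformed_def)
  show lip: "\<bar>H (chi x) - H (chi y)\<bar> \<le> p * \<delta> * \<bar>x - y\<bar>" for x y
  proof -
    have "\<bar>H (chi x) - H (chi y)\<bar> \<le> p * \<bar>chi x - chi y\<bar>" by (intro p bd)
    also have "\<dots> \<le> p * (\<delta> * \<bar>x - y\<bar>)" by (intro mult_left_mono chi_deformed_lipschitz[OF chi] p)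
    finally show ?thesis by (simp add: mult.assoc)
  qed
  show "0 \<le> p * \<delta>" using p \<delta> by simp
  show bdd: "\<bar>H (chi x)\<bar> \<le> \<bar>H 0\<bar> + p * \<Gamma>0" for x
  proof -
    have "\<bar>H (chi x) - H 0\<bar> \<le> p * \<bar>chi x - 0\<bar>" using bd[of 0] by (intro p bd) (simp add: c0)
    also have "\<dots> \<le> p * \<Gamma>0" using bd[of x] p by (intro mult_left_mono) auto
    finally show ?thesis by linarith
  qed
  have "continuous_on UNIV (\<lambda>x. H (chi x))"
    by (rule lipschitz_on_continuous_on[of "p * \<delta>"])
      (use lip \<open>0 \<le> p * \<delta>\<close> in \<open>auto simp: lipschitz_on_def dist_real_def\<close>)
  then have [measurable]: "(\<lambda>x. H (chi x)) \<in> borel_measurable borel"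
    by (rule borel_measurable_continuous_onI)
  note [measurable] = chi_deformed_measurable[OF chi]
  have iH: "integrable ?N (\<lambda>x. H (chi x))"
    by (rule integrable_const_bound[where B = "\<bar>H 0\<bar> + p * \<Gamma>0"]) (use bdd in auto)
  have ic: "integrable ?N chi"
    by (rule integrable_const_bound[where B = \<Gamma>0]) (use bd in auto)
  have "\<bar>(\<integral>x. H (chi x) - H 0 - chi x * D \<partial>?N)\<bar> \<le> (\<integral>x. \<bar>H (chi x) - H 0 - chi x * D\<bar> \<partial>?N)"
    by (rule integral_abs_bound)
  also have "\<dots> \<le> (\<integral>x. q * \<delta>\<^sup>2 * x\<^sup>2 \<partial>?N)"
  proof (rule integral_mono)
    fix x
    have "\<bar>chi x\<bar>\<^sup>2 \<le> (\<delta> * \<bar>x\<bar>)\<^sup>2"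
      using chi_deformed_lipschitz[OF chi, of x 0] by (intro power_mono) (auto simp: c0)
    then have "q * (chi x)\<^sup>2 \<le> q * (\<delta>\<^sup>2 * x\<^sup>2)"
      using q by (intro mult_left_mono) (auto simp: power_mult_distrib)
    then show "\<bar>H (chi x) - H 0 - chi x * D\<bar> \<le> q * \<delta>\<^sup>2 * x\<^sup>2"
      using q(2)[OF bd, of x] by (simp add: mult.assoc)
  qed (use iH ic integral_std_normal_square in auto)
  also have "\<dots> = q * \<delta>\<^sup>2" by (simp add: integral_std_normal_square)
  also have "(\<integral>x. H (chi x) - H 0 - chi x * D \<partial>?N) = (\<integral>x. H (chi x) \<partial>?N) - H 0"
    using iH ic chi prob_space by (simp add: chi_deformed_def)
  finally show "\<bar>(\<integral>x. H (chi x) \<partial>?N) - H 0\<bar> \<le> q * \<delta>\<^sup>2" .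
qed

text \<open>A hybrid argument: the newest coordinate is integrated first with the earlier ones
  frozen, and the bound \<open>r k\<close> does not depend on where they are frozen, so it factors
  out. The truncation is explicit because points of the product space are \<open>undefined\<close>
  outside \<open>{..<k}\<close>.\<close>

lemma product_mgf:
  fixes \<Psi> :: "(nat \<Rightarrow> real) \<Rightarrow> real"
  assumes prob: "prob_space N"
    and meas: "\<And>k. (\<lambda>x. \<Psi> (\<lambda>i. if i < k then x i else 0)) \<in> borel_measurable (PiM {..<k} (\<lambda>_. N))"
    and step: "\<And>k x. k < M \<Longrightarrow>
      (\<integral>\<^sup>+y. ennreal (exp (l * (\<Psi> (x(k := y)) - \<Psi> (x(k := 0))))) \<partial>N) \<le> ennreal (exp (r k))"
    and k: "k \<le> M"
  shows "(\<integral>\<^sup>+x. ennreal (exp (l * (\<Psi> (\<lambda>i. if i < k then x i else 0) - \<Psi> (\<lambda>_. 0))))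
    \<partial>PiM {..<k} (\<lambda>_. N)) \<le> ennreal (exp (\<Sum>i<k. r i))"
  using k
proof (induction k)
  case 0
  then show ?case by (simp add: PiM_empty nn_integral_count_space_finite)
next
  case (Suc k)
  interpret prob_space N by (rule prob)
  interpret product_sigma_finite "\<lambda>_. N" by standard
  let ?T = "\<lambda>k x i. if i < k then x i else (0::real)"
  note [measurable] = meas
  have T: "?T (Suc k) (x(k := y)) = (?T k x)(k := y)" "(?T k x)(k := 0) = ?T k x" for x y
    by auto
  have "(\<integral>\<^sup>+x. ennreal (exp (l * (\<Psi> (?T (Suc k) x) - \<Psi> (\<lambda>_. 0)))) \<partial>PiM {..<Suc k} (\<lambda>_. N))
    = (\<integral>\<^sup>+x. \<integral>\<^sup>+y. ennreal (exp (l * (\<Psi> (?T (Suc k) (x(k := y))) - \<Psi> (\<lambda>_. 0)))) \<partial>N \<partial>PiM {..<k} (\<lambda>_. N))"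
    unfolding lessThan_Suc
    by (rule product_nn_integral_insert) (use meas[of "Suc k", unfolded lessThan_Suc] in measurable)
  also have "\<dots> \<le> (\<integral>\<^sup>+x. ennreal (exp (l * (\<Psi> (?T k x) - \<Psi> (\<lambda>_. 0)))) * ennreal (exp (r k)) \<partial>PiM {..<k} (\<lambda>_. N))"
  proof (rule nn_integral_mono)
    fix x assume x: "x \<in> space (PiM {..<k} (\<lambda>_. N))"
    have m: "(\<lambda>y. \<Psi> ((?T k x)(k := y))) \<in> borel_measurable N"
    proof -
      have "(\<lambda>y. x(k := y)) \<in> measurable N (PiM (insert k {..<k}) (\<lambda>_. N))"
        by (rule measurable_fun_upd[where J = "{..<k}"]) (use x in auto)
      from measurable_compose[OF this[folded lessThan_Suc] meas]
      show ?thesis unfolding T .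
    qed
    have "(\<integral>\<^sup>+y. ennreal (exp (l * (\<Psi> (?T (Suc k) (x(k := y))) - \<Psi> (\<lambda>_. 0)))) \<partial>N)
      = (\<integral>\<^sup>+y. ennreal (exp (l * (\<Psi> (?T k x) - \<Psi> (\<lambda>_. 0)))) *
          ennreal (exp (l * (\<Psi> ((?T k x)(k := y)) - \<Psi> ((?T k x)(k := 0))))) \<partial>N)"
      unfolding T by (simp add: algebra_simps flip: ennreal_mult exp_add)
    also have "\<dots> = ennreal (exp (l * (\<Psi> (?T k x) - \<Psi> (\<lambda>_. 0)))) *
          (\<integral>\<^sup>+y. ennreal (exp (l * (\<Psi> ((?T k x)(k := y)) - \<Psi> ((?T k x)(k := 0))))) \<partial>N)"
      by (rule nn_integral_cmult) (use m in measurable)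
    also have "\<dots> \<le> ennreal (exp (l * (\<Psi> (?T k x) - \<Psi> (\<lambda>_. 0)))) * ennreal (exp (r k))"
      by (intro mult_left_mono step) (use Suc.prems in auto)
    finally show "(\<integral>\<^sup>+y. ennreal (exp (l * (\<Psi> (?T (Suc k) (x(k := y))) - \<Psi> (\<lambda>_. 0)))) \<partial>N)
      \<le> ennreal (exp (l * (\<Psi> (?T k x) - \<Psi> (\<lambda>_. 0)))) * ennreal (exp (r k))" .
  qed
  also have "\<dots> = (\<integral>\<^sup>+x. ennreal (exp (l * (\<Psi> (?T k x) - \<Psi> (\<lambda>_. 0)))) \<partial>PiM {..<k} (\<lambda>_. N)) * ennreal (exp (r k))"
    by (rule nn_integral_multc) measurable
  also have "\<dots> \<le> ennreal (exp (\<Sum>i<k. r i)) * ennreal (exp (r k))"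
    by (intro mult_right_mono Suc.IH) (use Suc.prems in auto)
  also have "\<dots> = ennreal (exp (\<Sum>i<Suc k. r i))"
    by (simp add: exp_add ennreal_mult)
  finally show ?case .
qed

lemma (in prob_space) chernoff_two_sided:
  assumes X [measurable]: "random_variable borel X"
    and mgf: "\<And>l. (\<integral>\<^sup>+x. ennreal (exp (l * X x)) \<partial>M) \<le> ennreal (exp (l\<^sup>2 * v + \<bar>l\<bar> * \<beta>))"
    and v: "0 < v" and a: "0 < a"
  shows "prob {x \<in> space M. 2 * a * sqrt v + \<beta> < \<bar>X x\<bar>} \<le> 2 * exp (- a\<^sup>2)"
proof -
  define s where "s = 2 * a * sqrt v + \<beta>"
  have one: "prob {x \<in> space M. s < \<sigma> * X x} \<le> exp (- a\<^sup>2)" if \<sigma>: "\<bar>\<sigma>\<bar> = 1" for \<sigma>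
  proof -
    \<comment> \<open>This value minimises \<open>- 2 * a * l * sqrt v + l\<^sup>2 * v\<close>, with
      minimum \<open>- a\<^sup>2\<close>; the summand \<open>\<beta>\<close> of the threshold
      cancels the bias exactly. The sign \<open>\<sigma>\<close> handles both tails.\<close>
    define l where "l = a / sqrt v"
    have l: "0 < l" using v a by (simp add: l_def)
    have "emeasure M {x \<in> space M. s < \<sigma> * X x}
        \<le> emeasure M {x \<in> space M. 1 \<le> ennreal (exp (- l * s)) * ennreal (exp (l * \<sigma> * X x))}"
    proof (rule emeasure_mono)
      show "{x \<in> space M. s < \<sigma> * X x}
        \<subseteq> {x \<in> space M. 1 \<le> ennreal (exp (- l * s)) * ennreal (exp (l * \<sigma> * X x))}"
      proof safe
        fix x assume "s < \<sigma> * X x"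
        then have "l * s \<le> l * (\<sigma> * X x)" using l by (intro mult_left_mono) auto
        then have "1 \<le> exp (- l * s + l * \<sigma> * X x)" by (simp add: mult.assoc)
        then have "1 \<le> exp (- l * s) * exp (l * \<sigma> * X x)" by (simp only: exp_add)
        then show "1 \<le> ennreal (exp (- l * s)) * ennreal (exp (l * \<sigma> * X x))"
          by (simp flip: ennreal_mult)
      qed
    qed measurable
    also have "\<dots> \<le> ennreal (exp (- l * s)) * (\<integral>\<^sup>+x. ennreal (exp (l * \<sigma> * X x)) * indicator (space M) x \<partial>M)"
      by (rule nn_integral_Markov_inequality) measurable
    also have "(\<integral>\<^sup>+x. ennreal (exp (l * \<sigma> * X x)) * indicator (space M) x \<partial>M)
        = (\<integral>\<^sup>+x. ennreal (exp (l * \<sigma> * X x)) \<partial>M)"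
      by (intro nn_integral_cong) simp
    also have "ennreal (exp (- l * s)) * \<dots> \<le> ennreal (exp (- l * s)) * ennreal (exp ((l * \<sigma>)\<^sup>2 * v + \<bar>l * \<sigma>\<bar> * \<beta>))"
      by (intro mult_left_mono mgf) simp
    also have "\<dots> = ennreal (exp (- l * s + ((l * \<sigma>)\<^sup>2 * v + \<bar>l * \<sigma>\<bar> * \<beta>)))"
      unfolding exp_add[of "- l * s"] by (rule ennreal_mult[symmetric]) auto
    also have "- l * s + ((l * \<sigma>)\<^sup>2 * v + \<bar>l * \<sigma>\<bar> * \<beta>) = - a\<^sup>2"
    proof -
      have 1: "\<sigma>\<^sup>2 = 1" using \<sigma> by (metis power2_abs power_one)
      have 2: "l * sqrt v = a" "l\<^sup>2 * v = a\<^sup>2"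
        using v by (auto simp: l_def power_divide)
      have "- l * s + ((l * \<sigma>)\<^sup>2 * v + \<bar>l * \<sigma>\<bar> * \<beta>) = - 2 * a * (l * sqrt v) + l\<^sup>2 * v"
        unfolding s_def power_mult_distrib 1 abs_mult \<sigma> using l by (simp add: algebra_simps)
      then show ?thesis unfolding 2 by (simp add: power2_eq_square)
    qed
    finally show ?thesis by (simp add: emeasure_eq_measure)
  qed
  have "prob {x \<in> space M. s < \<bar>X x\<bar>}
      = prob ({x \<in> space M. s < 1 * X x} \<union> {x \<in> space M. s < (- 1) * X x})"
    by (rule arg_cong[where f = prob]) auto
  also have "\<dots> \<le> prob {x \<in> space M. s < 1 * X x} + prob {x \<in> space M. s < (- 1) * X x}"
    by (rule measure_Un_le) measurable
  also have "\<dots> \<le> exp (- a\<^sup>2) + exp (- a\<^sup>2)" by (intro add_mono one) auto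
  finally show ?thesis by (simp add: s_def)
qed

text \<open>There are two cut-offs: \<open>M\<close> is the number of couplings, and
  \<open>k\<close> counts the Gaussian coordinates already switched on, the later ones being set to
  \<open>0\<close>.\<close>

lemma measurable_chi_deformed_family:
  fixes \<Phi> :: "(nat \<Rightarrow> real) \<Rightarrow> 'b::topological_space"
  assumes chi: "\<And>i. i < M \<Longrightarrow> chi_deformed \<delta> \<Gamma> (chi i)"
    and cont: "continuous_on UNIV \<Phi>"
  shows "(\<lambda>x. \<Phi> (\<lambda>i. if i < M then chi i (if i < k then x i else 0) else 0))
    \<in> borel_measurable (PiM {..<k} (\<lambda>_. std_normal_measure))"
proof -
  have "(\<lambda>x i. if i < M then chi i (if i < k then x i else 0) else (0::real))
      \<in> borel_measurable (PiM {..<k} (\<lambda>_. std_normal_measure))"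
  proof (rule measurable_coordinatewise_then_product)
    fix i
    show "(\<lambda>x. if i < M then chi i (if i < k then x i else 0) else (0::real))
      \<in> borel_measurable (PiM {..<k} (\<lambda>_. std_normal_measure))"
    proof (cases "i < M \<and> i < k")
      case True
      then have "(\<lambda>x. x i) \<in> measurable (PiM {..<k} (\<lambda>_. std_normal_measure)) borel"
        using measurable_component_singleton[of i "{..<k}" "\<lambda>_. std_normal_measure"]
        by (simp add: sets_std_normal cong: measurable_cong_sets)
      from measurable_compose[OF this chi_deformed_measurable[OF chi]] True
      show ?thesis by simp
    next
      case False
      then have "(\<lambda>x. if i < M then chi i (if i < k then x i else 0) else (0::real))
          = (\<lambda>_. if i < M then chi i 0 else 0)" by auto
      then show ?thesis by simp
    qed
  qed
  from measurable_compose[OF this borel_measurable_continuous_onI[OF cont]] show ?thesis .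
qed

text \<open>The one-coordinate estimates are required at every base point \<open>g\<close> of the
  cube of radius \<open>\<Gamma>0\<close>, but \<open>D\<close> may depend on \<open>g\<close>: it
  disappears when the single coupling is averaged.\<close>

lemma chi_deformed_concentration:
  fixes \<Phi> :: "(nat \<Rightarrow> real) \<Rightarrow> real"
  assumes chi: "\<And>i. i < M \<Longrightarrow> chi_deformed \<delta> \<Gamma> (chi i)" and \<Gamma>: "\<Gamma> \<le> \<Gamma>0" "0 \<le> \<Gamma>0"
    and cont: "continuous_on UNIV \<Phi>"
    and p: "\<And>i. 0 \<le> p i" "\<And>g i y z. i < M \<Longrightarrow> (\<And>j. \<bar>g j\<bar> \<le> \<Gamma>0) \<Longrightarrow> \<bar>y\<bar> \<le> \<Gamma>0 \<Longrightarrow> \<bar>z\<bar> \<le> \<Gamma>0 \<Longrightarrow>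
      \<bar>\<Phi> (g(i := y)) - \<Phi> (g(i := z))\<bar> \<le> p i * \<bar>y - z\<bar>"
    and q: "\<And>i. 0 \<le> q i" "\<And>g i. i < M \<Longrightarrow> (\<And>j. \<bar>g j\<bar> \<le> \<Gamma>0) \<Longrightarrow>
      \<exists>D. \<forall>y. \<bar>y\<bar> \<le> \<Gamma>0 \<longrightarrow> \<bar>\<Phi> (g(i := y)) - \<Phi> (g(i := 0)) - y * D\<bar> \<le> q i * y\<^sup>2"
    and v: "0 < v" "(\<Sum>i<M. (p i * \<delta>)\<^sup>2) \<le> v" and \<beta>: "(\<Sum>i<M. q i * \<delta>\<^sup>2) \<le> \<beta>" and a: "0 < a"
  shows "measure (gauss_prod M) {\<theta> \<in> space (gauss_prod M). 2 * a * sqrt v + \<beta> <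
    \<bar>\<Phi> (\<lambda>i. if i < M then chi i (\<theta> i) else 0) - \<Phi> (\<lambda>_. 0)\<bar>} \<le> 2 * exp (- a\<^sup>2)"
proof -
  interpret prob_space "gauss_prod M" by (rule prob_space_gauss_prod)
  define \<Psi> where "\<Psi> = (\<lambda>\<theta>. \<Phi> (\<lambda>i. if i < M then chi i (\<theta> i) else 0))"
  have meas': "(\<lambda>x. \<Psi> (\<lambda>i. if i < k then x i else 0)) \<in> borel_measurable (PiM {..<k} (\<lambda>_. std_normal_measure))" for k
    unfolding \<Psi>_def by (rule measurable_chi_deformed_family[OF chi cont])
  have c0: "chi i 0 = 0" if "i < M" for i using chi[OF that] by (simp add: chi_deformed_def)
  have trunc: "\<Psi> (\<lambda>i. if i < M then x i else 0) = \<Psi> x" for x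
    unfolding \<Psi>_def by (rule arg_cong[where f = \<Phi>]) auto
  have zero: "\<Psi> (\<lambda>_. 0) = \<Phi> (\<lambda>_. 0)"
    unfolding \<Psi>_def by (rule arg_cong[where f = \<Phi>]) (auto simp: c0)
  have "prob {\<theta> \<in> space (gauss_prod M). 2 * a * sqrt v + \<beta> < \<bar>\<Psi> \<theta> - \<Psi> (\<lambda>_. 0)\<bar>} \<le> 2 * exp (- a\<^sup>2)"
  proof (rule chernoff_two_sided[OF _ _ v(1) a])
    show "(\<lambda>\<theta>. \<Psi> \<theta> - \<Psi> (\<lambda>_. 0)) \<in> borel_measurable (gauss_prod M)"
      using meas'[of M] unfolding trunc gauss_prod_def by measurable
    fix l
    have "(\<integral>\<^sup>+x. ennreal (exp (l * (\<Psi> (\<lambda>i. if i < M then x i else 0) - \<Psi> (\<lambda>_. 0))))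
        \<partial>PiM {..<M} (\<lambda>_. std_normal_measure))
      \<le> ennreal (exp (\<Sum>i<M. l\<^sup>2 * (p i * \<delta>)\<^sup>2 + \<bar>l\<bar> * (q i * \<delta>\<^sup>2)))"
    proof (rule product_mgf[OF prob_space_std_normal meas' _ order_refl])
      fix k x assume k: "k < M"
      define g where "g = (\<lambda>i. if i < M then chi i (x i) else 0)"
      have g: "\<bar>g j\<bar> \<le> \<Gamma>0" for j
        using chi_deformed_bound[OF chi, of j "x j"] \<Gamma> by (auto simp: g_def)
      have upd: "\<Psi> (x(k := y)) = \<Phi> (g(k := chi k y))" for y
        unfolding \<Psi>_def g_def by (rule arg_cong[where f = \<Phi>]) (use k in auto)
      obtain D where "\<forall>y. \<bar>y\<bar> \<le> \<Gamma>0 \<longrightarrow> \<bar>\<Phi> (g(k := y)) - \<Phi> (g(k := 0)) - y * D\<bar> \<le> q k * y\<^sup>2"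
        using q(2)[where g = g, OF k g] by (elim exE)
      then have D: "\<bar>\<Phi> (g(k := y)) - \<Phi> (g(k := 0)) - y * D\<bar> \<le> q k * y\<^sup>2" if "\<bar>y\<bar> \<le> \<Gamma>0" for y
        using that by (elim allE impE)
      show "(\<integral>\<^sup>+y. ennreal (exp (l * (\<Psi> (x(k := y)) - \<Psi> (x(k := 0))))) \<partial>std_normal_measure)
        \<le> ennreal (exp (l\<^sup>2 * (p k * \<delta>)\<^sup>2 + \<bar>l\<bar> * (q k * \<delta>\<^sup>2)))"
        unfolding upd c0[OF k]
        by (rule chi_deformed_mgf[where H = "\<lambda>y. \<Phi> (g(k := y))", OF chi[OF k] \<Gamma>(1) p(1)
              p(2)[where g = g, OF k g] q(1) D])
    qed
    also have "\<dots> \<le> ennreal (exp (l\<^sup>2 * v + \<bar>l\<bar> * \<beta>))"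
    proof -
      have "(\<Sum>i<M. l\<^sup>2 * (p i * \<delta>)\<^sup>2 + \<bar>l\<bar> * (q i * \<delta>\<^sup>2))
          = l\<^sup>2 * (\<Sum>i<M. (p i * \<delta>)\<^sup>2) + \<bar>l\<bar> * (\<Sum>i<M. q i * \<delta>\<^sup>2)"
        by (simp add: sum.distrib sum_distrib_left)
      also have "\<dots> \<le> l\<^sup>2 * v + \<bar>l\<bar> * \<beta>" by (intro add_mono mult_left_mono v \<beta>) auto
      finally show ?thesis by (intro ennreal_leI) simp
    qed
    finally show "(\<integral>\<^sup>+x. ennreal (exp (l * (\<Psi> x - \<Psi> (\<lambda>_. 0)))) \<partial>gauss_prod M)
      \<le> ennreal (exp (l\<^sup>2 * v + \<bar>l\<bar> * \<beta>))"
      unfolding trunc gauss_prod_def .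
  qed
  then show ?thesis unfolding zero unfolding \<Psi>_def .
qed

section \<open>Lieb-Robinson bounds on the lattice\<close>

lemma power_div_fact_le_exp:
  fixes x :: real
  assumes "0 \<le> x"
  shows "x ^ n / fact n \<le> exp x"
proof -
  have "(\<Sum>k\<in>{n}. x ^ k /\<^sub>R fact k) \<le> (\<Sum>k. x ^ k /\<^sub>R fact k)"
    by (rule sum_le_suminf[OF summable_exp_generic]) (use assms in auto)
  then show ?thesis by (simp add: exp_def divide_inverse mult.commute)
qed

text \<open>Bounds the sum of \<open>(k + 1) ^ d * exp (- k)\<close>: half of the exponential
  absorbs the polynomial, through one term of the exponential series, and the other half leaves a
  geometric series.\<close>

definition shell_const :: "nat \<Rightarrow> real" where
  "shell_const d = 2 ^ d * fact d * exp (1 / 2) / (1 - exp (- 1 / 2))"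

lemma shell_const_pos: "0 < shell_const d"
  by (simp add: shell_const_def)

lemma sum_power_exp_le_shell_const:
  assumes "finite F"
  shows "(\<Sum>k\<in>F. (real k + 1) ^ d * exp (- real k)) \<le> shell_const d"
proof -
  define q where "q = exp (- 1 / 2 :: real)"
  have q: "0 < q" "q < 1" by (simp_all add: q_def)
  have "(\<Sum>k\<in>F. (real k + 1) ^ d * exp (- real k)) \<le> (\<Sum>k\<in>F. 2 ^ d * fact d * exp (1 / 2) * q ^ k)"
  proof (rule sum_mono)
    fix k
    have "((real k + 1) / 2) ^ d / fact d \<le> exp ((real k + 1) / 2)"
      by (rule power_div_fact_le_exp) simp
    then have "(real k + 1) ^ d \<le> 2 ^ d * fact d * exp ((real k + 1) / 2)"
      by (simp add: power_divide field_simps)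
    then have "(real k + 1) ^ d * exp (- real k) \<le> 2 ^ d * fact d * exp ((real k + 1) / 2) * exp (- real k)"
      by (rule mult_right_mono) simp
    also have "\<dots> = 2 ^ d * fact d * (exp ((real k + 1) / 2) * exp (- real k))" by simp
    also have "exp ((real k + 1) / 2) * exp (- real k) = exp (1 / 2) * q ^ k"
      unfolding q_def exp_of_nat_mult[symmetric] exp_add[symmetric] by (simp add: field_simps)
    finally show "(real k + 1) ^ d * exp (- real k) \<le> 2 ^ d * fact d * exp (1 / 2) * q ^ k"
      by (simp add: mult.assoc)
  qed
  also have "\<dots> = 2 ^ d * fact d * exp (1 / 2) * (\<Sum>k\<in>F. q ^ k)" by (simp add: sum_distrib_left)
  also have "(\<Sum>k\<in>F. q ^ k) \<le> (\<Sum>k. q ^ k)"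
    by (rule sum_le_suminf) (use q assms in \<open>auto intro: summable_geometric\<close>)
  also have "(\<Sum>k. q ^ k) = 1 / (1 - q)" by (rule suminf_geometric) (use q in simp)
  finally show ?thesis by (simp add: shell_const_def q_def)
qed

text \<open>\<open>E i\<close> is the distance beyond the light cone and, by truncated subtraction,
  \<open>0\<close> inside it. The shell \<open>E i = k\<close> lies in a ball of radius
  \<open>p + k\<close>, and \<open>p + k + 1 \<le> (p + 1) * (k + 1)\<close> separates the size of
  the cone from the sum over shells.\<close>

lemma sum_light_cone:
  fixes D :: "'i \<Rightarrow> nat" and x :: real
  assumes I: "finite I" and A: "0 \<le> A" and x: "0 \<le> x"
    and count: "\<And>m. real (card {i \<in> I. D i \<le> m}) \<le> A * (real m + 1) ^ d"
  shows "(\<Sum>i\<in>I. min 1 (exp (x - D i))) \<le> A * 2 ^ d * (1 + x) ^ d * shell_const d"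
proof -
  define p where "p = nat \<lceil>x\<rceil>"
  have p: "x \<le> p" "real p \<le> x + 1" unfolding p_def using x by linarith+
  define E where "E = (\<lambda>i. D i - p)"
  have "(\<Sum>i\<in>I. min 1 (exp (x - D i))) \<le> (\<Sum>i\<in>I. exp (- real (E i)))"
  proof (rule sum_mono)
    fix i
    show "min 1 (exp (x - D i)) \<le> exp (- real (E i))"
    proof (cases "D i \<le> p")
      case False
      then have "exp (x - D i) \<le> exp (- real (E i))" using p by (simp add: E_def of_nat_diff)
      then show ?thesis by simp
    qed (simp add: E_def)
  qed
  also have "\<dots> = (\<Sum>k\<in>E ` I. \<Sum>i | i \<in> I \<and> E i = k. exp (- real (E i)))"
    by (rule sum.image_gen[OF I])
  also have "\<dots> = (\<Sum>k\<in>E ` I. real (card {i \<in> I. E i = k}) * exp (- real k))"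
    by (rule sum.cong) auto
  also have "\<dots> \<le> (\<Sum>k\<in>E ` I. (A * (real p + 1) ^ d) * ((real k + 1) ^ d * exp (- real k)))"
  proof (rule sum_mono)
    fix k
    have "real (card {i \<in> I. E i = k}) \<le> real (card {i \<in> I. D i \<le> p + k})"
      by (intro of_nat_mono card_mono) (use I in \<open>auto simp: E_def\<close>)
    also have "\<dots> \<le> A * (real (p + k) + 1) ^ d" by (rule count)
    also have "\<dots> \<le> A * ((real p + 1) * (real k + 1)) ^ d"
      by (intro mult_left_mono power_mono A) (auto simp: algebra_simps)
    finally show "real (card {i \<in> I. E i = k}) * exp (- real k)
        \<le> (A * (real p + 1) ^ d) * ((real k + 1) ^ d * exp (- real k))"
      by (simp add: power_mult_distrib mult.assoc mult_right_mono)
  qed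
  also have "\<dots> = (A * (real p + 1) ^ d) * (\<Sum>k\<in>E ` I. (real k + 1) ^ d * exp (- real k))"
    by (simp add: sum_distrib_left)
  also have "\<dots> \<le> (A * (2 * (1 + x)) ^ d) * shell_const d"
    using p by (intro mult_mono mult_left_mono power_mono sum_power_exp_le_shell_const A)
      (use I x A in \<open>auto intro!: sum_nonneg\<close>)
  finally show ?thesis by (simp only: power_mult_distrib mult.assoc)
qed

section \<open>Distances and balls on the discrete torus\<close>

definition cdist :: "nat \<Rightarrow> nat \<Rightarrow> nat \<Rightarrow> nat" where
  "cdist L a b = (let c = (if a \<le> b then b - a else a - b) in min c (L - c))"

lemma tdist_cdist: "tdist L d x y = (\<Sum>i<d. cdist L (x i) (y i))"
  by (simp add: tdist_def cdist_def)

lemma cdist_sym: "cdist L a b = cdist L b a"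
  by (cases a b rule: linorder_cases) (simp_all add: cdist_def)

lemma cdist_int:
  assumes "a < L" "b < L"
  shows "int (cdist L a b) = min \<bar>int a - int b\<bar> (int L - \<bar>int a - int b\<bar>)"
  using assms by (cases "a \<le> b") (simp_all add: cdist_def of_nat_min of_nat_diff)

lemma cdist_triangle:
  assumes "a < L" "b < L" "c < L"
  shows "cdist L a c \<le> cdist L a b + cdist L b c"
proof -
  have "int (cdist L a c) \<le> int (cdist L a b) + int (cdist L b c)"
  proof -
    define p q where "p = int a - int b" and "q = int b - int c"
    have pq: "int a - int c = p + q" by (simp add: p_def q_def)
    have "\<bar>p\<bar> < int L" "\<bar>q\<bar> < int L" "\<bar>p + q\<bar> < int L"
      using assms unfolding p_def q_def by auto
    \<comment> \<open>Each distance on the right is realised by one of the two ways round the cycle;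
      the four combinations are linear facts.\<close>
    then have "min \<bar>p + q\<bar> (int L - \<bar>p + q\<bar>) \<le> \<bar>p\<bar> + \<bar>q\<bar>"
      "min \<bar>p + q\<bar> (int L - \<bar>p + q\<bar>) \<le> \<bar>p\<bar> + (int L - \<bar>q\<bar>)"
      "min \<bar>p + q\<bar> (int L - \<bar>p + q\<bar>) \<le> (int L - \<bar>p\<bar>) + \<bar>q\<bar>"
      "min \<bar>p + q\<bar> (int L - \<bar>p + q\<bar>) \<le> (int L - \<bar>p\<bar>) + (int L - \<bar>q\<bar>)"
      by linarith+
    moreover have "z \<le> min u v + min u' v'" if "z \<le> u + u'" "z \<le> u + v'" "z \<le> v + u'" "z \<le> v + v'"
      for u v u' v' z :: int
      using that by (simp add: min_def)
    ultimately show ?thesis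
      unfolding cdist_int[OF assms(1,2)] cdist_int[OF assms(2,3)] cdist_int[OF assms(1,3)] pq
        p_def[symmetric] q_def[symmetric] by blast
  qed
  then show ?thesis by (simp only: of_nat_add[symmetric] of_nat_le_iff)
qed

lemma tdist_sym: "tdist L d x y = tdist L d y x"
  unfolding tdist_cdist by (rule sum.cong[OF refl cdist_sym])

lemma tdist_triangle:
  assumes "x \<in> sites L d" "y \<in> sites L d" "z \<in> sites L d"
  shows "tdist L d x z \<le> tdist L d x y + tdist L d y z"
  unfolding tdist_cdist sum.distrib[symmetric]
  by (intro sum_mono cdist_triangle) (use assms in \<open>auto simp: sites_def\<close>)

text \<open>Every such point is a residue of \<open>a + k\<close> with
  \<open>\<bar>k\<bar> \<le> r\<close>, wrapping round at most once. The cover need not be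
  injective, so large radii need no separate treatment.\<close>

lemma card_cdist_le:
  assumes "a < L"
  shows "card {b. b < L \<and> cdist L a b \<le> r} \<le> 2 * r + 1"
proof -
  have "{b. b < L \<and> cdist L a b \<le> r} \<subseteq> (\<lambda>k. nat ((int a + k) mod int L)) ` {- int r..int r}"
  proof
    fix b assume "b \<in> {b. b < L \<and> cdist L a b \<le> r}"
    then have b: "b < L" "cdist L a b \<le> r" by auto
    have *: "b \<in> (\<lambda>k. nat ((int a + k) mod int L)) ` {- int r..int r}"
      if k: "k \<in> {- int r..int r}" "int a + k = int b + m * int L" for k m
    proof (rule image_eqI[OF _ k(1)])
      show "b = nat ((int a + k) mod int L)" unfolding k(2) using b by simp
    qed
    consider "int b - int a \<in> {- int r..int r}" | "int b - int a - int L \<in> {- int r..int r}"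
      | "int b - int a + int L \<in> {- int r..int r}"
    proof -
      have "int (cdist L a b) \<le> int r" using b by simp
      then have "\<bar>int a - int b\<bar> \<le> int r \<or> int L - \<bar>int a - int b\<bar> \<le> int r"
        unfolding cdist_int[OF assms b(1)] by (simp only: min_le_iff_disj)
      then show ?thesis
        using that b assms by (cases "a \<le> b") auto
    qed
    then show "b \<in> (\<lambda>k. nat ((int a + k) mod int L)) ` {- int r..int r}"
      using *[of "int b - int a" 0] *[of "int b - int a - int L" "-1"] *[of "int b - int a + int L" 1]
      by cases auto
  qed
  then have "card {b. b < L \<and> cdist L a b \<le> r} \<le> card {- int r..int r}"
    by (intro order_trans[OF card_mono card_image_le]) auto
  then show ?thesis by simp
qed

lemma inj_on_restrict_sites: "inj_on (\<lambda>x. restrict x {..<d}) (sites L d)"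
proof (rule inj_onI)
  fix x y assume x: "x \<in> sites L d" "y \<in> sites L d" and eq: "restrict x {..<d} = restrict y {..<d}"
  show "x = y"
  proof
    fix i
    show "x i = y i"
    proof (cases "i < d")
      case True
      then show ?thesis using fun_cong[OF eq, of i] by simp
    next
      case False
      then show ?thesis using x by (simp add: sites_def)
    qed
  qed
qed

lemma finite_sites: "finite (sites L d)"
proof (rule inj_on_finite[OF inj_on_restrict_sites])
  show "(\<lambda>x. restrict x {..<d}) ` sites L d \<subseteq> PiE {..<d} (\<lambda>_. {..<L})"
    by (auto simp: sites_def split: if_splits)
qed (intro finite_PiE, auto)

text \<open>A ball of the summed distance lies in the box with the same radius in each coordinate;
  only the power \<open>d\<close> of the radius matters later.\<close>

lemma card_lball_le:
  assumes c: "c \<in> sites L d"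
  shows "card (lball L d c r) \<le> (2 * r + 1) ^ d"
proof -
  let ?F = "\<lambda>i. {b. b < L \<and> cdist L (c i) b \<le> r}"
  have "(\<lambda>x. restrict x {..<d}) ` lball L d c r \<subseteq> PiE {..<d} ?F"
  proof
    fix z assume "z \<in> (\<lambda>x. restrict x {..<d}) ` lball L d c r"
    then obtain y where y: "y \<in> sites L d" "tdist L d c y \<le> r" "z = restrict y {..<d}"
      by (auto simp: lball_def)
    have "cdist L (c i) (y i) \<le> r" if "i < d" for i
    proof -
      have "cdist L (c i) (y i) \<le> (\<Sum>i<d. cdist L (c i) (y i))"
        by (rule member_le_sum) (use that in auto)
      then show ?thesis using y(2) by (simp add: tdist_cdist)
    qed
    then show "z \<in> PiE {..<d} ?F" using y by (auto simp: sites_def split: if_splits)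
  qed
  moreover have "inj_on (\<lambda>x. restrict x {..<d}) (lball L d c r)"
    by (rule inj_on_subset[OF inj_on_restrict_sites]) (auto simp: lball_def)
  ultimately have "card (lball L d c r) \<le> card (PiE {..<d} ?F)"
    by (intro card_inj_on_le finite_PiE) auto
  also have "\<dots> = (\<Prod>i<d. card (?F i))" by (simp add: card_PiE)
  also have "\<dots> \<le> (\<Prod>i<d. 2 * r + 1)"
    by (intro prod_mono conjI card_cdist_le) (use c in \<open>auto simp: sites_def\<close>)
  finally show ?thesis by simp
qed

lemma finite_lball: "finite (lball L d c r)"
  by (rule finite_subset[OF _ finite_sites[of L d]]) (auto simp: lball_def)

lemma lball_mono: "r \<le> r' \<Longrightarrow> lball L d c r \<subseteq> lball L d c r'"
  by (auto simp: lball_def)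

text \<open>The deterministic data of one system. The requirement \<open>1 \<le> \<gamma>\<close>
  lets one bound cover both the random couplings and the coefficient 1 of the Hamiltonian
  terms.\<close>

locale lattice_model =
  fixes L d r0 r1 s0 Kn M :: nat and hH \<gamma> :: real
    and H :: "site \<Rightarrow> qop" and V :: "nat \<Rightarrow> qop" and X :: "nat \<Rightarrow> site set"
    and Ob :: qop and SO :: "site set"
  assumes L: "1 \<le> L" and \<gamma>: "1 \<le> \<gamma>"
    and H_herm: "\<alpha> \<in> sites L d \<Longrightarrow> hermitian_op (sites L d) (H \<alpha>)"
    and H_norm: "\<alpha> \<in> sites L d \<Longrightarrow> opnorm (sites L d) (H \<alpha>) \<le> hH"
    and H_supp: "\<alpha> \<in> sites L d \<Longrightarrow> supported_on (sites L d) (lball L d \<alpha> r0) (H \<alpha>)"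
    and V_herm: "i < M \<Longrightarrow> hermitian_op (sites L d) (V i)"
    and V_norm: "i < M \<Longrightarrow> opnorm (sites L d) (V i) \<le> 1"
    and V_ball: "i < M \<Longrightarrow> \<exists>c\<in>sites L d. X i \<subseteq> lball L d c r1"
    and V_supp: "i < M \<Longrightarrow> supported_on (sites L d) (X i) (V i)"
    and X_card: "x \<in> sites L d \<Longrightarrow> card {i. i < M \<and> x \<in> X i} \<le> Kn"
    and SO_sites: "SO \<subseteq> sites L d"
    and SO_diam: "x \<in> SO \<Longrightarrow> y \<in> SO \<Longrightarrow> tdist L d x y \<le> s0"
    and Ob_supp: "supported_on (sites L d) SO Ob"
begin

abbreviation "S \<equiv> sites L d"
abbreviation "dst \<equiv> tdist L d"

definition "r = max r0 r1"
text \<open>The unit of length for counting steps. \<open>2 * r \<le> R\<close> ensures that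
  overlapping terms are at most one step apart, and \<open>s0 + r < R\<close> that terms meeting the
  observable are at step 0.\<close>

definition "R = 2 * r + s0 + 1"
definition "\<alpha>0 = max 1 hH"
text \<open>A term overlaps Hamiltonian terms centred within \<open>2 * r\<close> of its own centre,
  and at most \<open>Kn\<close> error terms at each site of its support.\<close>

definition "\<Delta> = (2 * (2 * r) + 1) ^ d + Kn * (2 * r + 1) ^ d"
definition "vel = 2 * \<alpha>0 * \<gamma> * real \<Delta>"
definition "Q = opnorm S Ob"
definition "cnt = real Kn * (4 * real R + 1) ^ d"

definition W :: "nat \<Rightarrow> qfam" where "W i = emb S (oscale \<i> (V i))"
definition OB :: qfam where "OB = emb S Ob"
definition KK :: "(nat \<Rightarrow> real) \<Rightarrow> qfam" where
  "KK g = (\<Sum>\<alpha>\<in>S. emb S (oscale \<i> (H \<alpha>))) + (\<Sum>i<M. g i *\<^sub>R W i)"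

text \<open>Hamiltonian terms (\<open>Inl\<close>) and error terms (\<open>Inr\<close>) share one
  index type because the chains in the Lieb-Robinson bound mix both kinds.\<close>

definition term_op :: "site + nat \<Rightarrow> qfam" where
  "term_op j = (case j of Inl \<alpha> \<Rightarrow> emb S (oscale \<i> (H \<alpha>)) | Inr i \<Rightarrow> W i)"
definition coef :: "(nat \<Rightarrow> real) \<Rightarrow> site + nat \<Rightarrow> real" where
  "coef g j = (case j of Inl \<alpha> \<Rightarrow> 1 | Inr i \<Rightarrow> g i)"
definition J :: "(site + nat) set" where "J = S <+> {..<M}"
definition supp :: "site + nat \<Rightarrow> site set" where
  "supp j = (case j of Inl \<alpha> \<Rightarrow> lball L d \<alpha> r0 | Inr i \<Rightarrow> X i)"
definition centre :: "site + nat \<Rightarrow> site" where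
  "centre j = (case j of Inl \<alpha> \<Rightarrow> \<alpha> | Inr i \<Rightarrow> SOME c. c \<in> S \<and> X i \<subseteq> lball L d c r1)"
definition nbrs :: "site + nat \<Rightarrow> (site + nat) set" where
  "nbrs j = {k \<in> J. supp k \<inter> supp j \<noteq> {}}"
definition origin :: site where "origin = (SOME x. x \<in> S \<and> SO \<subseteq> lball L d x s0)"
text \<open>Coarse-grained distance from the observable in units of \<open>R\<close>: the function
  \<open>D\<close> of \<open>lieb_robinson\<close>.\<close>

definition Dst :: "site + nat \<Rightarrow> nat" where "Dst j = dst origin (centre j) div R"

text \<open>An error term with empty support is a multiple of the identity and is not counted by the
  overlap bound; it does not affect the dynamics.\<close>

definition lcb :: "real \<Rightarrow> nat \<Rightarrow> real" where
  "lcb t i = (if X i = {} then 0 else 2 * \<alpha>0 * Q * min 1 (exp (exp 1 * (vel * t) - Dst (Inr i))))"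

lemma finite_J: "finite J" and finite_S: "finite S"
  by (auto simp: J_def finite_sites)

lemma R_pos: "0 < R" by (simp add: R_def)

lemma \<alpha>0_pos: "1 \<le> \<alpha>0" by (simp add: \<alpha>0_def)

lemma vel_nonneg: "0 \<le> vel"
  using \<alpha>0_pos \<gamma> by (simp add: vel_def)

lemma Q_nonneg: "0 \<le> Q"
  unfolding Q_def by (rule opnorm_nonneg[OF finite_S])

lemma norm_OB_le: "norm OB \<le> Q"
  unfolding OB_def Q_def by (rule norm_emb_le[OF finite_S])

lemma KK_sum: "KK g = (\<Sum>j\<in>J. coef g j *\<^sub>R term_op j)"
  unfolding J_def KK_def by (subst sum.Plus) (simp_all add: finite_sites coef_def term_op_def)

lemma norm_emb_i_le: "norm (emb S (oscale \<i> A)) \<le> opnorm S A"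
  using norm_emb_le[OF finite_S, of "oscale \<i> A"] opnorm_scale_le[OF finite_S, of \<i> A]
  by (simp add: oscale_def)

lemma norm_W_le: "i < M \<Longrightarrow> norm (W i) \<le> 1"
  unfolding W_def using norm_emb_i_le V_norm order_trans by blast

lemma norm_term_op_le: "j \<in> J \<Longrightarrow> norm (term_op j) \<le> \<alpha>0"
proof -
  assume "j \<in> J"
  then consider \<alpha> where "\<alpha> \<in> S" "j = Inl \<alpha>" | i where "i < M" "j = Inr i" by (auto simp: J_def)
  then show ?thesis
  proof cases
    case 1
    have "norm (emb S (oscale \<i> (H \<alpha>))) \<le> hH"
      by (rule order_trans[OF norm_emb_i_le H_norm[OF 1(1)]])
    then show ?thesis using 1(2) by (simp add: term_op_def \<alpha>0_def)
  next
    case 2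
    show ?thesis using norm_W_le[OF 2(1)] \<alpha>0_pos 2(2) by (simp add: term_op_def)
  qed
qed

lemma antiherm_term_op: "j \<in> J \<Longrightarrow> antiherm (term_op j)"
  unfolding J_def term_op_def W_def
  by (erule PlusE) (simp_all add: antiherm_emb H_herm V_herm)

lemma skew_partial: "I \<subseteq> J \<Longrightarrow> skew (\<Sum>j\<in>I. coef g j *\<^sub>R term_op j)"
  by (intro antiherm_skew antiherm_sum antiherm_scaleR antiherm_term_op) auto

lemma skew_KK: "skew (KK g)"
  unfolding KK_sum by (rule skew_partial) simp

lemma KK_upd: "i < M \<Longrightarrow> KK (g(i := y)) = KK (g(i := z)) + (y - z) *\<^sub>R W i"
proof -
  assume i: "i < M"
  have *: "(\<Sum>k<M. (g(i := u)) k *\<^sub>R W k) = u *\<^sub>R W i + (\<Sum>k\<in>{..<M} - {i}. g k *\<^sub>R W k)" for u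
    using i by (subst sum.remove[of _ i]) auto
  show ?thesis unfolding KK_def * by (simp add: algebra_simps)
qed

lemma continuous_KK: "continuous_on UNIV KK"
  unfolding KK_def
  by (intro continuous_on_add continuous_on_const continuous_on_sum continuous_on_scaleR
      continuous_on_product_coordinates)

lemma supported_term_op:
  assumes "j \<in> J"
  obtains A where "term_op j = emb S A" "supported_on S (supp j) A"
proof -
  from assms consider \<alpha> where "\<alpha> \<in> S" "j = Inl \<alpha>" | i where "i < M" "j = Inr i" by (auto simp: J_def)
  then show thesis
  proof cases
    case 1
    show thesis
      by (rule that[of "oscale \<i> (H \<alpha>)"])
        (use 1 H_supp in \<open>auto simp: term_op_def supp_def intro: supported_on_scale\<close>)
  next
    case 2
    show thesis
      by (rule that[of "oscale \<i> (V i)"])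
        (use 2 V_supp in \<open>auto simp: term_op_def supp_def W_def intro: supported_on_scale\<close>)
  qed
qed

lemma comm_term_op_disjoint:
  assumes "j \<in> J" "k \<in> J" "supp j \<inter> supp k = {}"
  shows "comm (term_op j) (term_op k) = 0"
proof -
  obtain A B where A: "term_op j = emb S A" "supported_on S (supp j) A"
    and B: "term_op k = emb S B" "supported_on S (supp k) B"
    using supported_term_op[OF assms(1)] supported_term_op[OF assms(2)] by metis
  show ?thesis
    unfolding comm_def A(1) B(1) using emb_commute_disjoint[OF finite_S A(2) B(2) assms(3)] by simp
qed

lemma comm_term_op_OB:
  assumes "j \<in> J" "supp j \<inter> SO = {}"
  shows "comm (term_op j) OB = 0"
proof -
  obtain A where A: "term_op j = emb S A" "supported_on S (supp j) A"
    using supported_term_op[OF assms(1)] .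
  show ?thesis
    unfolding comm_def A(1) OB_def using emb_commute_disjoint[OF finite_S A(2) Ob_supp assms(2)] by simp
qed

lemma centre_supp:
  assumes "j \<in> J"
  shows "centre j \<in> S" "supp j \<subseteq> lball L d (centre j) r"
proof -
  from assms consider \<alpha> where "\<alpha> \<in> S" "j = Inl \<alpha>" | i where "i < M" "j = Inr i" by (auto simp: J_def)
  then have "centre j \<in> S \<and> supp j \<subseteq> lball L d (centre j) r"
  proof cases
    case 1
    then show ?thesis using lball_mono[of r0 r] by (simp add: centre_def supp_def r_def)
  next
    case 2
    have "\<exists>c. c \<in> S \<and> X i \<subseteq> lball L d c r1" using V_ball[OF 2(1)] by blast
    then have "centre j \<in> S \<and> X i \<subseteq> lball L d (centre j) r1"
      unfolding centre_def 2(2) sum.case by (rule someI_ex)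
    moreover have "lball L d (centre j) r1 \<subseteq> lball L d (centre j) r"
      by (rule lball_mono) (simp add: r_def)
    ultimately show ?thesis using 2(2) by (auto simp: supp_def)
  qed
  then show "centre j \<in> S" "supp j \<subseteq> lball L d (centre j) r" by simp_all
qed

lemma supp_dst:
  assumes "j \<in> J" "y \<in> supp j"
  shows "y \<in> S" "dst (centre j) y \<le> r"
  using centre_supp(2)[OF assms(1)] assms(2) by (auto simp: lball_def)

lemma origin: "origin \<in> S" "SO \<subseteq> lball L d origin s0"
proof -
  have "\<exists>x. x \<in> S \<and> SO \<subseteq> lball L d x s0"
  proof (cases "SO = {}")
    case True
    have "(\<lambda>_. 0) \<in> S" using L by (simp add: sites_def)
    then show ?thesis using True by blast
  next
    case False
    then obtain x where "x \<in> SO" by blast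
    then show ?thesis using SO_sites SO_diam by (intro exI[of _ x]) (auto simp: lball_def)
  qed
  then have "origin \<in> S \<and> SO \<subseteq> lball L d origin s0" unfolding origin_def by (rule someI_ex)
  then show "origin \<in> S" "SO \<subseteq> lball L d origin s0" by simp_all
qed

lemma Dst_pos_comm:
  assumes j: "j \<in> J" and D: "0 < Dst j"
  shows "comm (term_op j) OB = 0"
proof (rule comm_term_op_OB[OF j], rule ccontr)
  assume "supp j \<inter> SO \<noteq> {}"
  then obtain y where y: "y \<in> supp j" "y \<in> SO" by blast
  have "dst origin (centre j) \<le> dst origin y + dst y (centre j)"
    by (intro tdist_triangle origin supp_dst[OF j y(1)] centre_supp j)
  also have "\<dots> \<le> s0 + r"
    using origin(2) y supp_dst[OF j y(1)] by (intro add_mono) (auto simp: lball_def tdist_sym)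
  also have "\<dots> < R" by (simp add: R_def)
  finally show False using D by (simp add: Dst_def)
qed

lemma Dst_nbrs:
  assumes j: "j \<in> J" and k: "k \<in> nbrs j"
  shows "Dst j \<le> Dst k + 1"
proof -
  obtain y where y: "y \<in> supp j" "y \<in> supp k" and kJ: "k \<in> J" using k by (auto simp: nbrs_def)
  have "dst origin (centre j) \<le> dst origin (centre k) + dst (centre k) (centre j)"
    by (intro tdist_triangle origin centre_supp j kJ)
  also have "dst (centre k) (centre j) \<le> dst (centre k) y + dst y (centre j)"
    by (intro tdist_triangle supp_dst[OF j y(1)] centre_supp j kJ)
  also have "\<dots> \<le> r + r"
    using supp_dst[OF j y(1)] supp_dst[OF kJ y(2)] by (intro add_mono) (auto simp: tdist_sym)
  also have "r + r \<le> R" by (simp add: R_def)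
  finally have "dst origin (centre j) \<le> dst origin (centre k) + R" by simp
  then have "dst origin (centre j) div R \<le> (dst origin (centre k) + R) div R" by (rule div_le_mono)
  also have "\<dots> = dst origin (centre k) div R + 1" using R_pos by simp
  finally show ?thesis by (simp add: Dst_def)
qed

text \<open>Error terms are counted through the sites of \<open>B\<close> that they touch, as
  several of them may share a centre.\<close>

lemma card_touching_le:
  assumes B: "B \<subseteq> lball L d c \<rho>" and c: "c \<in> S"
  shows "card {i. i < M \<and> X i \<inter> B \<noteq> {}} \<le> Kn * (2 * \<rho> + 1) ^ d"
proof -
  have fB: "finite B" using B finite_lball finite_subset by blast
  have BS: "B \<subseteq> S" using B by (auto simp: lball_def)
  have "{i. i < M \<and> X i \<inter> B \<noteq> {}} = (\<Union>y\<in>B. {i. i < M \<and> y \<in> X i})" by auto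
  then have "card {i. i < M \<and> X i \<inter> B \<noteq> {}} \<le> (\<Sum>y\<in>B. card {i. i < M \<and> y \<in> X i})"
    using card_UN_le[OF fB] by simp
  also have "\<dots> \<le> (\<Sum>y\<in>B. Kn)" by (intro sum_mono X_card) (use BS in auto)
  also have "\<dots> = Kn * card B" by simp
  also have "card B \<le> (2 * \<rho> + 1) ^ d"
    by (rule order_trans[OF card_mono[OF finite_lball B] card_lball_le[OF c]])
  finally show ?thesis by simp
qed

lemma card_nbrs_le:
  assumes j: "j \<in> J"
  shows "card (nbrs j) \<le> \<Delta>"
proof -
  let ?A = "lball L d (centre j) (2 * r)" and ?B = "{i. i < M \<and> X i \<inter> supp j \<noteq> {}}"
  have "nbrs j \<subseteq> Inl ` ?A \<union> Inr ` ?B"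
  proof
    fix k assume "k \<in> nbrs j"
    then have kJ: "k \<in> J" and "supp k \<inter> supp j \<noteq> {}" by (auto simp: nbrs_def)
    then obtain y where y: "y \<in> supp k" "y \<in> supp j" by blast
    from kJ consider \<alpha> where "\<alpha> \<in> S" "k = Inl \<alpha>" | i where "i < M" "k = Inr i" by (auto simp: J_def)
    then show "k \<in> Inl ` ?A \<union> Inr ` ?B"
    proof cases
      case 1
      have ck: "centre k = \<alpha>" using 1 by (simp add: centre_def)
      have "dst (centre j) \<alpha> \<le> dst (centre j) y + dst y \<alpha>"
        by (intro tdist_triangle supp_dst[OF j y(2)] centre_supp j 1)
      also have "\<dots> \<le> r + r"
        using supp_dst[OF j y(2)] supp_dst[OF kJ y(1)] unfolding ck
        by (intro add_mono) (auto simp: tdist_sym)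
      finally show ?thesis using 1 by (simp add: lball_def)
    next
      case 2
      then show ?thesis using y by (auto simp: supp_def)
    qed
  qed
  then have "card (nbrs j) \<le> card (Inl ` ?A \<union> Inr ` ?B)"
    by (rule card_mono[rotated]) (simp add: finite_lball)
  also have "\<dots> \<le> card (Inl ` ?A :: (site + nat) set) + card (Inr ` ?B :: (site + nat) set)"
    by (rule card_Un_le)
  also have "\<dots> \<le> card ?A + card ?B"
    by (intro add_mono card_image_le) (simp_all add: finite_lball)
  also have "\<dots> \<le> \<Delta>"
    unfolding \<Delta>_def
    by (intro add_mono card_lball_le card_touching_le[OF centre_supp(2)] centre_supp j)
  finally show ?thesis .
qed

lemma light_cone_bound:
  assumes g: "\<And>i. \<bar>g i\<bar> \<le> \<gamma>" and i: "i < M" and s: "0 \<le> s" "s \<le> t"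
  shows "norm (comm (W i) (evo (KK g) s OB)) \<le> lcb t i"
proof (cases "X i = {}")
  case True
  have iJ: "Inr i \<in> J" using i by (auto simp: J_def)
  have WI: "term_op (Inr i) = W i" by (simp add: term_op_def)
  have sI: "supp (Inr i) = {}" using True by (simp add: supp_def)
  have "comm (KK g) (W i) = 0"
    unfolding KK_sum comm_sum_left comm_scaleR_left WI[symmetric]
    by (intro sum.neutral ballI) (simp add: comm_term_op_disjoint iJ sI)
  then have "comm (W i) (evo (KK g) s OB) = evo (KK g) s (comm (W i) OB)"
    by (simp add: evo_comm evo_commuting)
  also have "comm (W i) OB = 0"
    using comm_term_op_OB[OF iJ] by (simp add: sI WI)
  finally show ?thesis by (simp add: lcb_def True evo_def)
next
  case False
  have iJ: "Inr i \<in> J" using i by (auto simp: J_def)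
  have WI: "term_op (Inr i) = W i" by (simp add: term_op_def)
  have lr: "norm (comm (W i) (evo (KK g) s OB)) \<le> 2 * \<alpha>0 * Q * ((vel * t) ^ n / fact n)"
    if n: "n \<le> Dst (Inr i)" for n
  proof -
    have "norm (comm (term_op (Inr i)) (evo (KK g) s OB))
      \<le> 2 * \<alpha>0 * norm OB * ((2 * \<alpha>0 * \<gamma> * real \<Delta> * s) ^ n / fact n)"
    proof (rule lieb_robinson[where N = nbrs and D = Dst and c = "coef g" and J = J,
          OF finite_J skew_partial _ card_nbrs_le _ norm_term_op_le _ Dst_pos_comm Dst_nbrs KK_sum iJ n s(1)])
      show "nbrs j \<subseteq> J" for j by (auto simp: nbrs_def)
      show "comm (term_op k) (term_op j) = 0" if "j \<in> J" "k \<in> J - nbrs j" for j k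
        by (rule comm_term_op_disjoint) (use that in \<open>auto simp: nbrs_def\<close>)
      show "\<bar>coef g j\<bar> \<le> \<gamma>" for j
        using g \<gamma> by (simp add: coef_def split: sum.split)
    qed
    also have "\<dots> \<le> 2 * \<alpha>0 * Q * ((vel * t) ^ n / fact n)"
    proof (rule mult_mono)
      show "2 * \<alpha>0 * norm OB \<le> 2 * \<alpha>0 * Q"
        using norm_OB_le \<alpha>0_pos by (intro mult_left_mono) auto
      have "(2 * \<alpha>0 * \<gamma> * real \<Delta> * s) ^ n \<le> (vel * t) ^ n"
        unfolding vel_def[symmetric]
        by (intro power_mono mult_left_mono s vel_nonneg mult_nonneg_nonneg)
      then show "(2 * \<alpha>0 * \<gamma> * real \<Delta> * s) ^ n / fact n \<le> (vel * t) ^ n / fact n"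
        by (rule divide_right_mono) simp
      show "0 \<le> 2 * \<alpha>0 * Q" using \<alpha>0_pos Q_nonneg by simp
      show "0 \<le> (2 * \<alpha>0 * \<gamma> * real \<Delta> * s) ^ n / fact n"
        unfolding vel_def[symmetric] using vel_nonneg s by simp
    qed
    finally show ?thesis unfolding WI .
  qed
  \<comment> \<open>Inserting a factor \<open>exp 1 ^ n\<close> into the single-term bound for the
    exponential series trades the factorial for exponential decay beyond a cone of speed
    \<open>exp 1 * vel\<close>.\<close>
  have "(vel * t) ^ Dst (Inr i) / fact (Dst (Inr i)) \<le> exp (exp 1 * (vel * t) - Dst (Inr i))"
  proof -
    let ?n = "Dst (Inr i)"
    have "(exp 1 * (vel * t)) ^ ?n / fact ?n \<le> exp (exp 1 * (vel * t))"
      by (rule power_div_fact_le_exp) (use vel_nonneg s in simp)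
    then have "exp (real ?n) * ((vel * t) ^ ?n / fact ?n) \<le> exp (exp 1 * (vel * t))"
      by (simp add: power_mult_distrib flip: exp_of_nat_mult)
    then show ?thesis by (simp add: exp_diff field_simps)
  qed
  then have "2 * \<alpha>0 * Q * ((vel * t) ^ Dst (Inr i) / fact (Dst (Inr i)))
      \<le> 2 * \<alpha>0 * Q * exp (exp 1 * (vel * t) - Dst (Inr i))"
    by (rule mult_left_mono) (use \<alpha>0_pos Q_nonneg in simp)
  then have "norm (comm (W i) (evo (KK g) s OB)) \<le> 2 * \<alpha>0 * Q * exp (exp 1 * (vel * t) - Dst (Inr i))"
    using lr[OF order_refl] by linarith
  \<comment> \<open>Order 0 is the trivial bound, better inside the cone; the minimum of both is
    \<open>lcb\<close>.\<close>
  then show ?thesis using lr[of 0] False by (simp add: lcb_def min_def)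
qed

lemma lcb_nonneg: "0 \<le> lcb t i"
  using \<alpha>0_pos Q_nonneg by (simp add: lcb_def)

lemma lcb_le: "lcb t i \<le> 2 * \<alpha>0 * Q"
proof (cases "X i = {}")
  case False
  have "2 * \<alpha>0 * Q * min 1 (exp (exp 1 * (vel * t) - Dst (Inr i))) \<le> 2 * \<alpha>0 * Q * 1"
    using \<alpha>0_pos Q_nonneg by (intro mult_left_mono) auto
  then show ?thesis using False by (simp add: lcb_def)
qed (use \<alpha>0_pos Q_nonneg in \<open>simp add: lcb_def\<close>)

lemma card_Dst_le:
  "real (card {i \<in> {i. i < M \<and> X i \<noteq> {}}. Dst (Inr i) \<le> m}) \<le> cnt * (real m + 1) ^ d"
proof -
  \<comment> \<open>Such a term has its centre at distance less than \<open>(m + 1) * R\<close>, and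
    its support reaches at most \<open>R\<close> further.\<close>
  let ?B = "lball L d origin ((m + 2) * R)"
  have "{i \<in> {i. i < M \<and> X i \<noteq> {}}. Dst (Inr i) \<le> m} \<subseteq> {i. i < M \<and> X i \<inter> ?B \<noteq> {}}"
  proof
    fix i assume "i \<in> {i \<in> {i. i < M \<and> X i \<noteq> {}}. Dst (Inr i) \<le> m}"
    then have i: "i < M" "Dst (Inr i) \<le> m" and "X i \<noteq> {}" by auto
    then obtain y where y: "y \<in> X i" by blast
    have iJ: "Inr i \<in> J" using i by (auto simp: J_def)
    have yi: "y \<in> supp (Inr i)" using y by (simp add: supp_def)
    have "dst origin (centre (Inr i)) < (m + 1) * R"
      using i(2) unfolding Dst_def by (subst div_less_iff_less_mult[OF R_pos, symmetric]) simp
    moreover have "dst origin y \<le> dst origin (centre (Inr i)) + dst (centre (Inr i)) y"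
      by (intro tdist_triangle origin supp_dst[OF iJ yi] centre_supp iJ)
    moreover have "dst (centre (Inr i)) y \<le> R" using supp_dst[OF iJ yi] by (simp add: R_def)
    ultimately have "dst origin y \<le> (m + 2) * R" by simp
    then have "y \<in> ?B" using supp_dst[OF iJ yi] by (simp add: lball_def)
    then show "i \<in> {i. i < M \<and> X i \<inter> ?B \<noteq> {}}" using i y by blast
  qed
  then have "card {i \<in> {i. i < M \<and> X i \<noteq> {}}. Dst (Inr i) \<le> m} \<le> card {i. i < M \<and> X i \<inter> ?B \<noteq> {}}"
    by (rule card_mono[rotated]) simp
  also have "\<dots> \<le> Kn * (2 * ((m + 2) * R) + 1) ^ d"
    by (rule card_touching_le[OF order_refl origin(1)])
  finally have "real (card {i \<in> {i. i < M \<and> X i \<noteq> {}}. Dst (Inr i) \<le> m})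
      \<le> real (Kn * (2 * ((m + 2) * R) + 1) ^ d)" by (rule of_nat_mono)
  also have "\<dots> = real Kn * (2 * ((real m + 2) * real R) + 1) ^ d" by (simp add: algebra_simps)
  also have "\<dots> \<le> real Kn * ((4 * real R + 1) * (real m + 1)) ^ d"
    by (intro mult_left_mono power_mono) (auto simp: algebra_simps)
  finally show ?thesis by (simp add: cnt_def power_mult_distrib)
qed

text \<open>Depends on the locality parameters and the coupling range only, not on \<open>L\<close>,
  \<open>M\<close>, \<open>t\<close> or the operators; this is why the final constants can be fixed
  before the system is chosen.\<close>

definition "Ctot = 2 * \<alpha>0 * (cnt * 2 ^ d * (1 + exp 1 * vel) ^ d * shell_const d)"

lemma sum_lcb_le:
  assumes t: "0 \<le> t"
  shows "(\<Sum>i<M. lcb t i) \<le> Ctot * Q * (1 + t) ^ d"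
proof -
  let ?I = "{i. i < M \<and> X i \<noteq> {}}"
  have cnt: "0 \<le> cnt" by (simp add: cnt_def)
  have "(\<Sum>i<M. lcb t i) = (\<Sum>i\<in>?I. lcb t i)"
    by (rule sum.mono_neutral_right) (auto simp: lcb_def)
  also have "\<dots> = 2 * \<alpha>0 * Q * (\<Sum>i\<in>?I. min 1 (exp (exp 1 * (vel * t) - Dst (Inr i))))"
    unfolding sum_distrib_left by (rule sum.cong) (auto simp: lcb_def)
  also have "\<dots> \<le> 2 * \<alpha>0 * Q * (cnt * 2 ^ d * (1 + exp 1 * (vel * t)) ^ d * shell_const d)"
  proof (rule mult_left_mono)
    show "(\<Sum>i\<in>?I. min 1 (exp (exp 1 * (vel * t) - Dst (Inr i))))
        \<le> cnt * 2 ^ d * (1 + exp 1 * (vel * t)) ^ d * shell_const d"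
      by (rule sum_light_cone[OF _ cnt _ card_Dst_le]) (use t vel_nonneg in auto)
  qed (use \<alpha>0_pos Q_nonneg in simp)
  also have "\<dots> \<le> 2 * \<alpha>0 * Q * (cnt * 2 ^ d * ((1 + exp 1 * vel) * (1 + t)) ^ d * shell_const d)"
    using t vel_nonneg \<alpha>0_pos Q_nonneg cnt shell_const_pos[of d]
    by (intro mult_left_mono mult_right_mono power_mono mult_nonneg_nonneg) (auto simp: algebra_simps)
  finally show ?thesis by (simp add: Ctot_def power_mult_distrib mult_ac)
qed

end

section \<open>Deviation of the perturbed expectation value\<close>

context lattice_model
begin

text \<open>Complex-valued, and a function of the whole coupling vector, so that couplings can be
  varied one at a time and the unperturbed value is the one at zero.\<close>

definition expct :: "qop \<Rightarrow> real \<Rightarrow> (nat \<Rightarrow> real) \<Rightarrow> complex" where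
  "expct \<rho> t g = otrace S (omul S \<rho> (ent (evo (KK g) t OB) S))"

lemma otrace_omul_cong:
  "(\<And>\<sigma> \<tau>. \<sigma> \<in> cfgs S \<Longrightarrow> \<tau> \<in> cfgs S \<Longrightarrow> A \<sigma> \<tau> = B \<sigma> \<tau>) \<Longrightarrow>
    otrace S (omul S \<rho> A) = otrace S (omul S \<rho> B)"
  by (simp add: otrace_def omul_def cong: sum.cong)

lemma KK_emb:
  "KK g = emb S (oscale \<i> (oplus (osum S H) (osum {..<M} (\<lambda>i. oscale (of_real (g i)) (V i)))))"
proof -
  have "oscale \<i> (oplus (osum S H) (osum {..<M} (\<lambda>i. oscale (of_real (g i)) (V i))))
    = oplus (osum S (\<lambda>\<alpha>. oscale \<i> (H \<alpha>))) (osum {..<M} (\<lambda>i. oscale (of_real (g i)) (oscale \<i> (V i))))"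
    by (simp add: oscale_def oplus_def osum_def sum_distrib_left distrib_left mult.left_commute)
  then show ?thesis by (simp add: KK_def W_def emb_oplus emb_osum emb_scale)
qed

lemma expct_heis:
  "expct \<rho> t g = otrace S (omul S \<rho>
    (heis S (oplus (osum S H) (osum {..<M} (\<lambda>i. oscale (of_real (g i)) (V i)))) t Ob))"
  unfolding expct_def KK_emb OB_def by (rule otrace_omul_cong) (rule ent_evo_emb[OF finite_S])

lemma expct_heis_0: "expct \<rho> t (\<lambda>_. 0) = otrace S (omul S \<rho> (heis S (osum S H) t Ob))"
proof -
  have "oplus (osum S H) (osum {..<M} (\<lambda>i. oscale (of_real 0) (V i))) = osum S H"
    by (simp add: oplus_def osum_def oscale_def)
  then show ?thesis unfolding expct_heis by simp
qed

context
  fixes \<rho> :: qop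
  assumes \<rho>: "density_matrix S \<rho>"
begin

lemma functional:
  shows "linear (\<lambda>x. otrace S (omul S \<rho> (ent x S)))"
    and "cmod (otrace S (omul S \<rho> (ent x S))) \<le> norm x"
proof -
  show "linear (\<lambda>x. otrace S (omul S \<rho> (ent x S)))"
    by (rule linearI)
      (simp_all add: otrace_def omul_def ent_simps distrib_left sum.distrib sum_distrib_left
        scaleR_conv_of_real[where 'a = complex] mult.left_commute)
  show "cmod (otrace S (omul S \<rho> (ent x S))) \<le> norm x"
    by (rule order_trans[OF density_matrix_trace_le[OF finite_S \<rho>] opnorm_ent_le_norm[OF finite_S]])
qed

lemma expct_diff_le: "cmod (expct \<rho> t g - expct \<rho> t g') \<le> norm (evo (KK g) t OB - evo (KK g') t OB)"
  unfolding expct_def using functional(2)[of "evo (KK g) t OB - evo (KK g') t OB"]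
  by (simp add: linear_diff[OF functional(1)])

lemma cmod_expct_le: "cmod (expct \<rho> t g) \<le> Q"
  unfolding expct_def
  by (rule order_trans[OF functional(2)]) (simp add: norm_evo[OF skew_KK] norm_OB_le)

lemma continuous_expct: "0 \<le> t \<Longrightarrow> continuous_on UNIV (expct \<rho> t)"
proof -
  assume t: "0 \<le> t"
  have "bounded_linear (\<lambda>x. otrace S (omul S \<rho> (ent x S)))"
    by (rule bounded_linear_intro[of _ 1])
      (auto simp: functional(2) linear_add[OF functional(1)] linear_scale[OF functional(1)])
  moreover have "continuous_on UNIV (\<lambda>g. evo (KK g) t OB)"
    by (rule continuous_on_evo[OF continuous_KK skew_KK t])
  ultimately show ?thesis
    unfolding expct_def[abs_def] by (rule bounded_linear.continuous_on)
qed

lemma expct_lipschitz: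
  assumes i: "i < M" and g: "\<And>j. \<bar>g j\<bar> \<le> \<gamma>" and yz: "\<bar>y\<bar> \<le> \<gamma>" "\<bar>z\<bar> \<le> \<gamma>" and t: "0 \<le> t"
  shows "cmod (expct \<rho> t (g(i := y)) - expct \<rho> t (g(i := z))) \<le> t * lcb t i * \<bar>y - z\<bar>"
proof -
  have "norm (evo (KK (g(i := y))) t OB - evo (KK (g(i := z))) t OB) \<le> t * (\<bar>y - z\<bar> * lcb t i)"
  proof (rule duhamel[OF skew_KK t])
    fix s assume s: "0 \<le> s" "s \<le> t"
    have "KK (g(i := y)) - KK (g(i := z)) = (y - z) *\<^sub>R W i" using KK_upd[OF i, of g y z] by simp
    then have "norm (comm (KK (g(i := y)) - KK (g(i := z))) (evo (KK (g(i := z))) s OB))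
        = \<bar>y - z\<bar> * norm (comm (W i) (evo (KK (g(i := z))) s OB))"
      by (simp add: comm_scaleR_left)
    also have "\<dots> \<le> \<bar>y - z\<bar> * lcb t i"
      by (intro mult_left_mono light_cone_bound i s) (use g yz in auto)
    finally show "norm (comm (KK (g(i := y)) - KK (g(i := z))) (evo (KK (g(i := z))) s OB))
        \<le> \<bar>y - z\<bar> * lcb t i" .
  qed
  then show ?thesis using expct_diff_le[of t "g(i := y)" "g(i := z)"] by (simp add: mult_ac)
qed

lemma expct_second_order:
  assumes i: "i < M" and g: "\<And>j. \<bar>g j\<bar> \<le> \<gamma>" and t: "0 \<le> t"
  shows "\<exists>D. \<forall>y. \<bar>y\<bar> \<le> \<gamma> \<longrightarrow>
    cmod (expct \<rho> t (g(i := y)) - expct \<rho> t (g(i := 0)) - y *\<^sub>R D) \<le> 2 * t\<^sup>2 * lcb t i * y\<^sup>2"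
proof -
  have upd: "KK (g(i := y)) = KK (g(i := 0)) + y *\<^sub>R W i" for y
    using KK_upd[OF i, of g y 0] by simp
  have g0: "\<bar>(g(i := 0)) j\<bar> \<le> \<gamma>" for j using g \<gamma> by simp
  obtain D where "\<And>y. \<bar>y\<bar> \<le> \<gamma> \<Longrightarrow>
      cmod (otrace S (omul S \<rho> (ent (evo (KK (g(i := 0)) + y *\<^sub>R W i) t OB) S))
        - otrace S (omul S \<rho> (ent (evo (KK (g(i := 0))) t OB) S)) - y *\<^sub>R D) \<le> 2 * t\<^sup>2 * lcb t i * y\<^sup>2"
  proof (rule second_order[where \<Gamma> = \<gamma> and K = "KK (g(i := 0))" and W = "W i" and A = OB
        and l = "lcb t i", OF functional _ t norm_W_le[OF i]])
    show "skew (KK (g(i := 0)) + y *\<^sub>R W i)" for y unfolding upd[symmetric] by (rule skew_KK)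
    show "norm (comm (W i) (evo (KK (g(i := 0))) s OB)) \<le> lcb t i" if "0 \<le> s" "s \<le> t" for s
      by (rule light_cone_bound[OF g0 i that])
  qed blast
  then show ?thesis unfolding expct_def upd[symmetric] by blast
qed

text \<open>The two lower bounds on \<open>v\<close> and \<open>\<beta>\<close> are the summed
  variances and biases. A free \<open>C\<close> above \<open>Ctot\<close> allows a positive constant
  to be used without examining the sign of \<open>Ctot\<close>.\<close>

lemma expct_concentration:
  assumes chi: "\<And>i. i < M \<Longrightarrow> chi_deformed \<delta> \<Gamma> (chi i)" and \<Gamma>: "\<Gamma> \<le> \<gamma>"
    and t: "0 \<le> t" and a: "0 < a" and v: "0 < v"
    and C: "0 \<le> C" "Ctot \<le> C"
    and v_ge: "2 * \<alpha>0 * C * (Q * (t * \<delta>))\<^sup>2 * (1 + t) ^ d \<le> v"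
    and \<beta>: "2 * C * Q * (t * \<delta>)\<^sup>2 * (1 + t) ^ d \<le> \<beta>"
  shows "1 - 4 * exp (- a\<^sup>2) \<le> measure (gauss_prod M) {\<theta> \<in> space (gauss_prod M).
    cmod (expct \<rho> t (\<lambda>i. if i < M then chi i (\<theta> i) else 0) - expct \<rho> t (\<lambda>_. 0)) \<le> 2 * (2 * a * sqrt v + \<beta>)}"
proof -
  interpret prob_space "gauss_prod M" by (rule prob_space_gauss_prod)
  let ?f = "\<lambda>\<theta>. expct \<rho> t (\<lambda>i. if i < M then chi i (\<theta> i) else 0)"
  let ?s = "2 * a * sqrt v + \<beta>"
  have \<gamma>0: "0 \<le> \<gamma>" using \<gamma> by simp
  have sum_le: "(\<Sum>i<M. lcb t i) \<le> C * Q * (1 + t) ^ d"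
    by (rule order_trans[OF sum_lcb_le[OF t]]) (use C Q_nonneg t in \<open>intro mult_right_mono; simp\<close>)
  have v_sum: "(\<Sum>i<M. (t * lcb t i * \<delta>)\<^sup>2) \<le> v"
  proof -
    \<comment> \<open>One factor \<open>lcb t i\<close> is replaced by its maximum and only the
      other is summed, so the variance carries the volume \<open>(1 + t) ^ d\<close> once.\<close>
    have "(\<Sum>i<M. (t * lcb t i * \<delta>)\<^sup>2) \<le> (\<Sum>i<M. (t * \<delta>)\<^sup>2 * (2 * \<alpha>0 * Q) * lcb t i)"
    proof (rule sum_mono)
      fix i
      have "(t * lcb t i * \<delta>)\<^sup>2 = (t * \<delta>)\<^sup>2 * (lcb t i * lcb t i)" by (simp add: power2_eq_square mult_ac)
      also have "\<dots> \<le> (t * \<delta>)\<^sup>2 * ((2 * \<alpha>0 * Q) * lcb t i)"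
        by (intro mult_left_mono mult_right_mono lcb_le lcb_nonneg) simp
      finally show "(t * lcb t i * \<delta>)\<^sup>2 \<le> (t * \<delta>)\<^sup>2 * (2 * \<alpha>0 * Q) * lcb t i" by (simp add: mult.assoc)
    qed
    also have "\<dots> = (t * \<delta>)\<^sup>2 * (2 * \<alpha>0 * Q) * (\<Sum>i<M. lcb t i)" by (simp add: sum_distrib_left)
    also have "\<dots> \<le> (t * \<delta>)\<^sup>2 * (2 * \<alpha>0 * Q) * (C * Q * (1 + t) ^ d)"
      by (rule mult_left_mono[OF sum_le]) (use \<alpha>0_pos Q_nonneg in simp)
    also have "\<dots> = 2 * \<alpha>0 * C * (Q * (t * \<delta>))\<^sup>2 * (1 + t) ^ d" by (simp add: power2_eq_square mult_ac)
    finally show ?thesis using v_ge by simp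
  qed
  have \<beta>_sum: "(\<Sum>i<M. 2 * t\<^sup>2 * lcb t i * \<delta>\<^sup>2) \<le> \<beta>"
  proof -
    have "(\<Sum>i<M. 2 * t\<^sup>2 * lcb t i * \<delta>\<^sup>2) = 2 * (t * \<delta>)\<^sup>2 * (\<Sum>i<M. lcb t i)"
      by (simp add: sum_distrib_left power_mult_distrib mult_ac)
    also have "\<dots> \<le> 2 * (t * \<delta>)\<^sup>2 * (C * Q * (1 + t) ^ d)"
      by (rule mult_left_mono[OF sum_le]) simp
    finally show ?thesis using \<beta> by (simp add: mult_ac)
  qed
  have part: "prob {\<theta> \<in> space (gauss_prod M). ?s < \<bar>P (?f \<theta>) - P (expct \<rho> t (\<lambda>_. 0))\<bar>} \<le> 2 * exp (- a\<^sup>2)"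
    if P: "linear P" "\<And>z. \<bar>P z\<bar> \<le> cmod z" for P :: "complex \<Rightarrow> real"
  proof (rule chi_deformed_concentration[where \<Phi> = "\<lambda>g. P (expct \<rho> t g)" and chi = chi
        and p = "\<lambda>i. t * lcb t i" and q = "\<lambda>i. 2 * t\<^sup>2 * lcb t i", OF chi \<Gamma> \<gamma>0 _ _ _ _ _ v v_sum \<beta>_sum a])
    have "bounded_linear P"
      by (rule bounded_linear_intro[of _ 1]) (auto simp: linear_add[OF P(1)] linear_scale[OF P(1)] P(2))
    then show "continuous_on UNIV (\<lambda>g. P (expct \<rho> t g))"
      by (rule bounded_linear.continuous_on[OF _ continuous_expct[OF t]])
    show "0 \<le> t * lcb t i" "0 \<le> 2 * t\<^sup>2 * lcb t i" for i using t lcb_nonneg by simp_all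
  next
    fix g :: "nat \<Rightarrow> real" and i y z
    assume i: "i < M" and g: "\<And>j. \<bar>g j\<bar> \<le> \<gamma>" and yz: "\<bar>y\<bar> \<le> \<gamma>" "\<bar>z\<bar> \<le> \<gamma>"
    show "\<bar>P (expct \<rho> t (g(i := y))) - P (expct \<rho> t (g(i := z)))\<bar> \<le> t * lcb t i * \<bar>y - z\<bar>"
      using expct_lipschitz[where g = g, OF i g yz t] P(2)[of "expct \<rho> t (g(i := y)) - expct \<rho> t (g(i := z))"]
      by (simp add: linear_diff[OF P(1)])
  next
    fix g :: "nat \<Rightarrow> real" and i
    assume i: "i < M" and g: "\<And>j. \<bar>g j\<bar> \<le> \<gamma>"
    obtain D where D: "\<forall>y. \<bar>y\<bar> \<le> \<gamma> \<longrightarrow>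
        cmod (expct \<rho> t (g(i := y)) - expct \<rho> t (g(i := 0)) - y *\<^sub>R D) \<le> 2 * t\<^sup>2 * lcb t i * y\<^sup>2"
      using expct_second_order[where g = g, OF i g t] by (elim exE)
    show "\<exists>D. \<forall>y. \<bar>y\<bar> \<le> \<gamma> \<longrightarrow>
        \<bar>P (expct \<rho> t (g(i := y))) - P (expct \<rho> t (g(i := 0))) - y * D\<bar> \<le> 2 * t\<^sup>2 * lcb t i * y\<^sup>2"
    proof (intro exI[of _ "P D"] allI impI)
      fix y assume "\<bar>y\<bar> \<le> \<gamma>"
      with D have "cmod (expct \<rho> t (g(i := y)) - expct \<rho> t (g(i := 0)) - y *\<^sub>R D) \<le> 2 * t\<^sup>2 * lcb t i * y\<^sup>2"
        by (elim allE impE)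
      from order_trans[OF P(2) this]
      show "\<bar>P (expct \<rho> t (g(i := y))) - P (expct \<rho> t (g(i := 0))) - y * P D\<bar> \<le> 2 * t\<^sup>2 * lcb t i * y\<^sup>2"
        by (simp only: linear_diff[OF P(1)] linear_scale[OF P(1)] real_scaleR_def)
    qed
  qed
  have f [measurable]: "random_variable borel ?f"
    using measurable_chi_deformed_family[where k = M, OF chi continuous_expct[OF t]]
    unfolding gauss_prod_def
    by (rule measurable_cong[THEN iffD1, rotated]) (auto intro!: arg_cong[where f = "expct \<rho> t"])
  \<comment> \<open>The factor 2 comes from bounding the modulus by the sum of the real and
    imaginary parts in absolute value; two tails for each part give the failure probability
    \<open>4 * exp (- a\<^sup>2)\<close>.\<close>
  let ?good = "{\<theta> \<in> space (gauss_prod M). cmod (?f \<theta> - expct \<rho> t (\<lambda>_. 0)) \<le> 2 * ?s}"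
  let ?bad = "\<lambda>P. {\<theta> \<in> space (gauss_prod M). ?s < \<bar>P (?f \<theta>) - P (expct \<rho> t (\<lambda>_. 0))\<bar>}"
  have "prob (space (gauss_prod M) - ?good) \<le> prob (?bad Re \<union> ?bad Im)"
  proof (rule finite_measure_mono)
    show "space (gauss_prod M) - ?good \<subseteq> ?bad Re \<union> ?bad Im"
    proof
      fix \<theta> assume \<theta>: "\<theta> \<in> space (gauss_prod M) - ?good"
      let ?z = "?f \<theta> - expct \<rho> t (\<lambda>_. 0)"
      have "2 * ?s < cmod ?z" using \<theta> by auto
      also have "cmod ?z \<le> \<bar>Re ?z\<bar> + \<bar>Im ?z\<bar>" by (rule cmod_le)
      finally have z: "2 * ?s < \<bar>Re ?z\<bar> + \<bar>Im ?z\<bar>" .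
      have "u < x \<or> u < y" if "2 * u < x + y" for u x y :: real using that by linarith
      from this[OF z] have "?s < \<bar>Re ?z\<bar> \<or> ?s < \<bar>Im ?z\<bar>" .
      then show "\<theta> \<in> ?bad Re \<union> ?bad Im" using \<theta> by auto
    qed
  qed measurable
  also have "\<dots> \<le> prob (?bad Re) + prob (?bad Im)"
    by (rule measure_Un_le) measurable
  also have "\<dots> \<le> 2 * exp (- a\<^sup>2) + 2 * exp (- a\<^sup>2)"
    by (intro add_mono part) (auto simp: linear_iff abs_Re_le_cmod abs_Im_le_cmod)
  also have "prob (space (gauss_prod M) - ?good) = 1 - prob ?good"
    by (rule prob_compl) measurable
  finally show ?thesis by simp
qed

end

end

text \<open>\<open>s * Q * E\<close> is the root of the variance and
  \<open>2 * C * Q * E\<^sup>2\<close> the bias. Since \<open>E\<close> is bounded under the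
  assumption on \<open>C0\<close>, the bias is at most linear in \<open>E\<close>, and
  \<open>E\<close> splits into the short-time part \<open>t * \<delta>\<close> and the long-time
  part \<open>T1\<close>.\<close>

lemma error_bound_arith:
  fixes t \<delta> Q a s C C0 :: real and d :: nat
  defines "E \<equiv> t * \<delta> * (1 + t) powr (real d / 2)"
    and "K1 \<equiv> (4 * s + 4 * C * (2 powr (real d / 2) * (1 / 2 + 2 * \<bar>C0\<bar>))) * 2 powr (real d / 2)"
  assumes t: "0 < t" and \<delta>: "0 < \<delta>" "\<delta> \<le> 1 / 2" and Q: "0 \<le> Q" and a: "1 \<le> a"
    and s: "0 \<le> s" and C: "0 \<le> C" and C0: "t powr (real d / 2 + 1) * \<delta> \<le> C0"
  shows "2 * (2 * a * (s * Q * E) + 2 * C * Q * E\<^sup>2)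
    \<le> K1 * a * t powr (real d / 2 + 1) * \<delta> * Q
      + K1 / ln 2 powr (real d / 2) * a * t * \<delta> * ln (1 / \<delta>) powr (real d / 2) * Q"
proof -
  define h where "h = 2 powr (real d / 2)"
  define T1 where "T1 = t powr (real d / 2 + 1) * \<delta>"
  define T2 where "T2 = t * \<delta> * (ln (1 / \<delta>) powr (real d / 2) / ln 2 powr (real d / 2))"
  have h: "0 < h" by (simp add: h_def)
  have T1: "T1 = t * \<delta> * t powr (real d / 2)" using t by (simp add: T1_def powr_add)
  have T1_nonneg: "0 \<le> T1" using \<delta> by (simp add: T1_def)
  have "(1 + t) powr (real d / 2) \<le> h * (1 + t powr (real d / 2))"
  proof (cases "t \<le> 1")
    case True
    have "(1 + t) powr (real d / 2) \<le> h" unfolding h_def using t True by (intro powr_mono2) auto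
    also have "\<dots> \<le> h * (1 + t powr (real d / 2))" using h by simp
    finally show ?thesis .
  next
    case False
    have "(1 + t) powr (real d / 2) \<le> (2 * t) powr (real d / 2)"
      using t False by (intro powr_mono2) auto
    also have "\<dots> = h * t powr (real d / 2)" using t by (simp add: powr_mult h_def)
    also have "\<dots> \<le> h * (1 + t powr (real d / 2))" using h by simp
    finally show ?thesis .
  qed
  then have "t * \<delta> * (1 + t) powr (real d / 2) \<le> t * \<delta> * (h * (1 + t powr (real d / 2)))"
    using t \<delta> by (intro mult_left_mono) auto
  then have E: "E \<le> h * (t * \<delta> + T1)" unfolding E_def T1 by (simp add: algebra_simps)
  \<comment> \<open>\<open>\<delta> \<le> 1 / 2\<close> keeps the logarithm above
    \<open>ln 2\<close>, so the logarithmic term dominates \<open>t * \<delta>\<close>; this fixes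
    the ratio of the two final constants.\<close>
  have T2: "t * \<delta> \<le> T2"
  proof -
    have "ln 2 \<le> ln (1 / \<delta>)" using \<delta> by (intro ln_mono) (auto simp: field_simps)
    then have "ln 2 powr (real d / 2) \<le> ln (1 / \<delta>) powr (real d / 2)" by (intro powr_mono2) auto
    then have "1 \<le> ln (1 / \<delta>) powr (real d / 2) / ln 2 powr (real d / 2)" by simp
    then have "t * \<delta> * 1 \<le> T2" unfolding T2_def using t \<delta> by (intro mult_left_mono) auto
    then show ?thesis by simp
  qed
  \<comment> \<open>Short times are controlled by \<open>\<delta> \<le> 1 / 2\<close>, long times by
    \<open>t * \<delta> \<le> T1\<close>.\<close>
  have "t * \<delta> \<le> 1 / 2 + \<bar>C0\<bar>"
  proof (cases "t \<le> 1")
    case True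
    then have "t * \<delta> \<le> 1 * (1 / 2)" using t \<delta> by (intro mult_mono) auto
    then show ?thesis by simp
  next
    case False
    then have "t * \<delta> * 1 \<le> t * \<delta> * t powr (real d / 2)"
      using \<delta> by (intro mult_left_mono ge_one_powr_ge_zero) auto
    then show ?thesis using C0 unfolding T1_def[symmetric] T1 by linarith
  qed
  moreover have "T1 \<le> \<bar>C0\<bar>" using C0 by (simp add: T1_def)
  ultimately have "h * (t * \<delta> + T1) \<le> h * (1 / 2 + 2 * \<bar>C0\<bar>)" using h by (intro mult_left_mono) auto
  with E have E1: "E \<le> h * (1 / 2 + 2 * \<bar>C0\<bar>)" by linarith
  have E0: "0 \<le> E" using t \<delta> by (simp add: E_def)
  let ?k = "4 * s + 4 * C * (h * (1 / 2 + 2 * \<bar>C0\<bar>))"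
  have "2 * (2 * a * (s * Q * E) + 2 * C * Q * E\<^sup>2) = a * Q * E * (4 * s) + Q * E * (4 * C * E)"
    by (simp add: power2_eq_square algebra_simps)
  \<comment> \<open>One factor of \<open>E\<^sup>2\<close> is replaced by its upper bound, and
    \<open>1 \<le> a\<close> supplies the factor \<open>a\<close> that the bias does not have by
    itself.\<close>
  also have "\<dots> \<le> a * Q * E * (4 * s) + a * Q * E * (4 * C * (h * (1 / 2 + 2 * \<bar>C0\<bar>)))"
  proof (rule add_left_mono, rule mult_mono)
    show "Q * E \<le> a * Q * E" using mult_right_mono[OF a, of "Q * E"] Q E0 by (simp add: mult.assoc)
    show "4 * C * E \<le> 4 * C * (h * (1 / 2 + 2 * \<bar>C0\<bar>))"
      using C by (intro mult_left_mono E1) simp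
  qed (use E0 Q C a in auto)
  also have "\<dots> = a * Q * ?k * E" by (simp add: algebra_simps)
  also have "\<dots> \<le> a * Q * ?k * (h * (T2 + T1))"
  proof (rule mult_left_mono)
    have "h * (t * \<delta> + T1) \<le> h * (T2 + T1)" using T2 h by (intro mult_left_mono) auto
    then show "E \<le> h * (T2 + T1)" using E by linarith
    show "0 \<le> a * Q * ?k" using a Q s C h by simp
  qed
  also have "\<dots> = K1 * a * T1 * Q + K1 * a * T2 * Q"
    unfolding K1_def h_def[symmetric] by (simp add: algebra_simps)
  finally show ?thesis by (simp add: T1_def T2_def mult_ac)
qed

theorem theorem2:
  fixes d r0 r1 s0 K :: nat and hH \<kappa> \<Gamma>0 C0 :: real
  assumes "d \<ge> 1"
  shows "\<exists>C1 C2 c :: real. C1 > 0 \<and> C2 > 0 \<and> c > 0 \<and>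
    (\<forall>(L::nat) (H :: site \<Rightarrow> qop) (M::nat) (V :: nat \<Rightarrow> qop) (X :: nat \<Rightarrow> site set)
       (chi :: nat \<Rightarrow> real \<Rightarrow> real) (\<delta>::real) (\<Gamma>::real) (t::real) (Ob :: qop) (SO :: site set)
       (\<rho> :: qop) (a::real).
      let S = sites L d in
      L \<ge> 1 \<longrightarrow>
      (\<forall>\<alpha>\<in>S. hermitian_op S (H \<alpha>) \<and> opnorm S (H \<alpha>) \<le> hH \<and>
              supported_on S (lball L d \<alpha> r0) (H \<alpha>)) \<longrightarrow>
      real M \<le> \<kappa> * real (L ^ d) \<longrightarrow>
      (\<forall>i<M. hermitian_op S (V i) \<and> opnorm S (V i) \<le> 1 \<and>
              (\<exists>c\<in>S. X i \<subseteq> lball L d c r1) \<and> supported_on S (X i) (V i)) \<longrightarrow>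
      (\<forall>x\<in>S. card {i. i < M \<and> x \<in> X i} \<le> K) \<longrightarrow>
      \<delta> > 0 \<longrightarrow> \<delta> \<le> 1/2 \<longrightarrow> \<Gamma> \<le> \<Gamma>0 \<longrightarrow>
      (\<forall>i<M. chi_deformed \<delta> \<Gamma> (chi i)) \<longrightarrow>
      t \<ge> 0 \<longrightarrow> t powr (real d / 2 + 1) * \<delta> \<le> C0 \<longrightarrow>
      hermitian_op S Ob \<longrightarrow> SO \<subseteq> S \<longrightarrow> card SO \<le> s0 \<longrightarrow>
      (\<forall>x\<in>SO. \<forall>y\<in>SO. tdist L d x y \<le> s0) \<longrightarrow> supported_on S SO Ob \<longrightarrow>
      density_matrix S \<rho> \<longrightarrow>
      a > 0 \<longrightarrow>
      measure (gauss_prod M)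
        {\<theta> \<in> space (gauss_prod M).
           cmod (otrace S (omul S \<rho>
                   (heis S (oplus (osum S H) (osum {..<M} (\<lambda>i. oscale (of_real (chi i (\<theta> i))) (V i)))) t Ob))
                 - otrace S (omul S \<rho> (heis S (osum S H) t Ob)))
           \<le> C1 * a * t powr (real d / 2 + 1) * \<delta> * opnorm S Ob
             + C2 * a * t * \<delta> * (ln (1 / \<delta>)) powr (real d / 2) * opnorm S Ob}
      \<ge> 1 - 2 * exp (- c * a\<^sup>2))"
proof -
  define \<gamma> where "\<gamma> = max 1 \<Gamma>0"
  \<comment> \<open>The locale constants are taken as functions of the parameters, before any system
    is given; the absolute value plus one makes them positive.\<close>
  define C where "C = \<bar>lattice_model.Ctot d r0 r1 s0 K hH \<gamma>\<bar> + 1"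
  define A where "A = \<bar>lattice_model.\<alpha>0 hH\<bar> + 1"
  define s where "s = sqrt (2 * A * C)"
  define h where "h = 2 powr (real d / 2)"
  define C1 where "C1 = (4 * s + 4 * C * (h * (1 / 2 + 2 * \<bar>C0\<bar>))) * h"
  define C2 where "C2 = C1 / ln 2 powr (real d / 2)"
  have C: "0 < C" and A: "0 < A" by (simp_all add: C_def A_def)
  have s: "0 < s" using C A by (simp add: s_def)
  have h: "0 < h" by (simp add: h_def)
  have C1: "0 < C1" unfolding C1_def using s C h by (intro mult_pos_pos add_pos_nonneg) auto
  then have C2: "0 < C2" by (simp add: C2_def)
  show ?thesis
  \<comment> \<open>The value \<open>c = 1 / 2\<close> gives room to reduce the prefactor 4 from the
    four tails to 2.\<close>
  proof (rule exI[of _ C1], rule exI[of _ C2], rule exI[of _ "1 / 2 :: real"], intro conjI allI,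
      rule C1, rule C2, simp, unfold Let_def, intro impI, goal_cases)
    case (1 L H M V X chi \<delta> \<Gamma> t Ob SO \<rho> a)
    interpret lattice_model L d r0 r1 s0 K M hH \<gamma> H V X Ob SO
      using 1 by unfold_locales (auto simp: \<gamma>_def)
    let ?P = "gauss_prod M"
    interpret P: prob_space ?P by (rule prob_space_gauss_prod)
    let ?f = "\<lambda>\<theta>. expct \<rho> t (\<lambda>i. if i < M then chi i (\<theta> i) else 0)"
    let ?rhs = "C1 * a * t powr (real d / 2 + 1) * \<delta> * opnorm S Ob
      + C2 * a * t * \<delta> * ln (1 / \<delta>) powr (real d / 2) * opnorm S Ob"
    have \<rho>: "density_matrix S \<rho>" and t: "0 \<le> t" and \<delta>: "0 < \<delta>" "\<delta> \<le> 1 / 2" and a: "0 < a"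
      and chi: "\<And>i. i < M \<Longrightarrow> chi_deformed \<delta> \<Gamma> (chi i)" and \<Gamma>: "\<Gamma> \<le> \<gamma>"
      and C0: "t powr (real d / 2 + 1) * \<delta> \<le> C0"
      using 1 by (auto simp: \<gamma>_def)
    have Q: "opnorm S Ob = Q" by (simp add: Q_def)
    have eq: "osum {..<M} (\<lambda>i. oscale (of_real (if i < M then chi i (\<theta> i) else 0)) (V i))
        = osum {..<M} (\<lambda>i. oscale (of_real (chi i (\<theta> i))) (V i))" for \<theta>
      by (auto simp: osum_def intro!: ext sum.cong)
    have rhs0: "0 \<le> ?rhs"
      unfolding Q using C1 C2 a t \<delta> Q_nonneg by simp
    have "1 - 2 * exp (- (1 / 2) * a\<^sup>2) \<le>
      measure ?P {\<theta> \<in> space ?P. cmod (?f \<theta> - expct \<rho> t (\<lambda>_. 0)) \<le> ?rhs}"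
    proof -
      \<comment> \<open>For \<open>t = 0\<close> or \<open>Q = 0\<close> the deviation vanishes and
        so would the variance, which Chernoff's bound needs to be positive. In the second case the
        claimed probability is not positive.\<close>
      consider "t = 0 \<or> Q = 0" | "1 - 2 * exp (- (1 / 2) * a\<^sup>2) \<le> 0"
        | "0 < t" "0 < Q" "2 * exp (- (1 / 2) * a\<^sup>2) < 1"
        using t Q_nonneg by fastforce
      then show ?thesis
      proof cases
        case 1
        have "cmod (?f \<theta> - expct \<rho> t (\<lambda>_. 0)) = 0" for \<theta>
        proof (cases "Q = 0")
          case True
          then show ?thesis using cmod_expct_le[OF \<rho>] by simp
        next
          case False
          then show ?thesis using 1 by (simp add: expct_def)
        qed
        then have "{\<theta> \<in> space ?P. cmod (?f \<theta> - expct \<rho> t (\<lambda>_. 0)) \<le> ?rhs} = space ?P"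
          using rhs0 by simp
        then show ?thesis by (simp add: P.prob_space)
      next
        case 2
        then show ?thesis using measure_nonneg order_trans by blast
      next
        case 3
        \<comment> \<open>For \<open>a < 1\<close> the failure bound
          \<open>2 * exp (- a\<^sup>2 / 2)\<close> would be at least 1, so a nontrivial claim forces
          the bound on \<open>a\<close> that absorbs the bias.\<close>
        have a1: "1 \<le> a"
        proof (rule ccontr)
          assume "\<not> 1 \<le> a"
          then have "a\<^sup>2 \<le> 1" using a by (simp add: power_le_one)
          moreover have "1 + (- (1 / 2) * a\<^sup>2) \<le> exp (- (1 / 2) * a\<^sup>2)" by (rule exp_ge_add_one_self)
          ultimately show False using 3(3) by linarith
        qed
        define E where "E = t * \<delta> * (1 + t) powr (real d / 2)"
        define v where "v = (s * Q * E)\<^sup>2"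
        define \<beta> where "\<beta> = 2 * C * Q * E\<^sup>2"
        have E: "0 < E" using 3 \<delta> by (simp add: E_def)
        have E2: "E\<^sup>2 = (t * \<delta>)\<^sup>2 * (1 + t) ^ d"
        proof -
          have "((1 + t) powr (real d / 2))\<^sup>2 = (1 + t) powr (real d)"
            unfolding power2_eq_square powr_add[symmetric] by simp
          then show ?thesis using t by (simp add: E_def power_mult_distrib powr_realpow)
        qed
        have s2: "s\<^sup>2 = 2 * A * C" using A C by (simp add: s_def)
        have v0: "0 < v" using s 3 E by (simp add: v_def)
        have sv: "sqrt v = s * Q * E" using s 3 E by (simp add: v_def)
        have "1 - 4 * exp (- a\<^sup>2) \<le> measure ?P {\<theta> \<in> space ?P.
            cmod (?f \<theta> - expct \<rho> t (\<lambda>_. 0)) \<le> 2 * (2 * a * sqrt v + \<beta>)}"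
        proof (rule expct_concentration[OF \<rho> chi \<Gamma> t a v0])
          show "0 \<le> C" using C by simp
          show "Ctot \<le> C" unfolding C_def by simp
          have "2 * \<alpha>0 * C * (Q * (t * \<delta>))\<^sup>2 * (1 + t) ^ d = 2 * \<alpha>0 * C * (Q\<^sup>2 * E\<^sup>2)"
            unfolding E2 by (simp add: power_mult_distrib)
          also have "\<dots> \<le> 2 * A * C * (Q\<^sup>2 * E\<^sup>2)"
            using C by (intro mult_right_mono mult_left_mono) (auto simp: A_def)
          also have "\<dots> = v" unfolding v_def power_mult_distrib s2 by simp
          finally show "2 * \<alpha>0 * C * (Q * (t * \<delta>))\<^sup>2 * (1 + t) ^ d \<le> v" .
          show "2 * C * Q * (t * \<delta>)\<^sup>2 * (1 + t) ^ d \<le> \<beta>" unfolding \<beta>_def E2 by simp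
        qed
        also have "\<dots> \<le> measure ?P {\<theta> \<in> space ?P. cmod (?f \<theta> - expct \<rho> t (\<lambda>_. 0)) \<le> ?rhs}"
        proof (rule P.finite_measure_mono)
          have "2 * (2 * a * sqrt v + \<beta>) \<le> ?rhs"
            unfolding sv \<beta>_def Q C2_def C1_def h_def E_def
            by (rule error_bound_arith) (use 3 \<delta> a1 s C C0 in auto)
          then show "{\<theta> \<in> space ?P. cmod (?f \<theta> - expct \<rho> t (\<lambda>_. 0)) \<le> 2 * (2 * a * sqrt v + \<beta>)}
            \<subseteq> {\<theta> \<in> space ?P. cmod (?f \<theta> - expct \<rho> t (\<lambda>_. 0)) \<le> ?rhs}" by auto
          have "?f \<in> borel_measurable ?P"
            using measurable_chi_deformed_family[where k = M, OF chi continuous_expct[OF \<rho> t]]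
            unfolding gauss_prod_def
            by (rule measurable_cong[THEN iffD1, rotated]) (auto intro!: arg_cong[where f = "expct \<rho> t"])
          then show "{\<theta> \<in> space ?P. cmod (?f \<theta> - expct \<rho> t (\<lambda>_. 0)) \<le> ?rhs} \<in> P.events" by measurable
        qed
        finally have "1 - 4 * exp (- a\<^sup>2) \<le> measure ?P {\<theta> \<in> space ?P. cmod (?f \<theta> - expct \<rho> t (\<lambda>_. 0)) \<le> ?rhs}" .
        \<comment> \<open>With \<open>x = exp (- a\<^sup>2 / 2)\<close> this is
          \<open>4 * x\<^sup>2 \<le> 2 * x\<close>, which holds because \<open>2 * x < 1\<close> in
          this case.\<close>
        moreover have "4 * exp (- a\<^sup>2) \<le> 2 * exp (- (1 / 2) * a\<^sup>2)"
        proof -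
          let ?e = "exp (- (1 / 2) * a\<^sup>2)"
          have "exp (- a\<^sup>2) = ?e * ?e" by (simp flip: exp_add)
          then have "4 * exp (- a\<^sup>2) = (2 * ?e) * (2 * ?e)" by simp
          also have "\<dots> \<le> 1 * (2 * ?e)" using 3(3) by (intro mult_right_mono) auto
          finally show ?thesis by simp
        qed
        ultimately show ?thesis by linarith
      qed
    qed
    then show ?case unfolding expct_heis_0 unfolding expct_heis eq .
  qed
qed

end
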